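(* Let $X_n$ be any of $A_n,B_n,C_n,D_n,E_{6,7,8},F_4,G_2$, let $1\le r\le n$, $s\in\mathbb Z_{\ge1}$, $\lambda\in\overline P$, and assume $s/t_r\in\mathbb Z$. For $L\in\mathbb{Z}_{\ge 1}$ put $m^{(a)}_{i,0}=L\,C^{-1}_{ra}\,\delta_{i,\,t_as/t_r}$ ($1\le a\le n$, $i\ge1$). Then $$\lim\ q^{-c(\{m^{(a)}_{i,0}\})}\,M(W^{(r)\otimes L}_s,\lambda,q)=\sum_{\zeta}\frac{M(W(\zeta),\lambda,q^{-1})\,M_{s/t_r}(W(\zeta),q^{-1})}{(q)_{\zeta_1}\cdots(q)_{\zeta_n}},\qquad W(\zeta)=\bigotimes_{a=1}^nW^{(a)\otimes\zeta_a}_1.$$ Here the limit $L\to\infty$ is taken over $L$ such that $LC^{-1}_{ra}\in\mathbb Z$ for all $1\le a\le n$; for such $L$, $c(\{m^{(a)}_{i,0}\})=-L^2sC^{-1}_{rr}/2\in\mathbb Z$, where $c$ is the quadratic form attached to $W^{(r)\otimes L}_s$. The sum is over $\zeta_1,\dots,\zeta_n\in\mathbb Z_{\ge0}$ such that $\zeta=\sum_{a=1}^n\zeta_a\overline\Lambda_a\in\overline Q$.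
   Context: Lie algebra notation. $X_n$ is one of $A_n\,(n\ge1)$, $B_n\,(n\ge2)$, $C_n\,(n\ge2)$, $D_n\,(n\ge4)$, $E_{6,7,8},F_4,G_2$. $\alpha_a$, $\overline\Lambda_a$ ($1\le a\le n$) are simple roots and fundamental weights; $\overline P=\bigoplus_a\mathbb Z\overline\Lambda_a$, $\overline Q=\bigoplus_a\mathbb Z\alpha_a$. The form $(\cdot|\cdot)$ is normalized so that long roots have square length $2$; $t_a=2/(\alpha_a|\alpha_a)$, $C_{ab}=t_a(\alpha_a|\alpha_b)$ (Cartan matrix), $C^{-1}_{ab}=t_a(\overline\Lambda_a|\overline\Lambda_b)$ (its inverse). Vertex numbering (Kac): in $A_n,B_n,C_n,F_4,G_2$ the Dynkin diagram is a chain $1,\dots,n$; in $B_n$ only $\alpha_n$ is short, in $C_n$ only $\alpha_n$ is long, in $F_4$ $\alpha_3,\alpha_4$ are short, in $G_2$ $\alpha_2$ is short; $D_n$: chain $1,\dots,n-1$ with $n$ attached to $n-2$; $E_6$: chain $1,\dots,5$ with $6$ attached to $3$; $E_7$: chain $1,\dots,6$ with $7$ attached to $3$; $E_8$: chain $1,\dots,7$ with $8$ attached to $5$. $q$-notation. $(q)_k=\prod_{i=1}^k(1-q^i)$. For $m\in\mathbb Z_{\ge0}$, $p\in\mathbb Z$, $\left[{p+m\atop m}\right]_q$ is the usual $q$-binomial coefficient $\frac{(q)_{p+m}}{(q)_p(q)_m}$ if $p\ge0$ and $0$ if $p<0$. The limit is coefficientwise, as formal power series in $q$. Fermionic forms.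 The symbol $W=\bigotimes_{a=1}^n\bigotimes_{j\ge1}(W^{(a)}_j)^{\otimes\nu^{(a)}_j}$ records data $\nu^{(a)}_j\in\mathbb Z_{\ge0}$, finitely many non-zero. For $\lambda\in\overline P$, $$M(W,\lambda,q)=\sum_{\{m\}}q^{c(\{m\})}\prod_{1\le a\le n,\,i\ge1}\left[{p^{(a)}_i+m^{(a)}_i\atop m^{(a)}_i}\right]_q,$$ $$c(\{m\})=\tfrac12\sum_{a,b}(\alpha_a|\alpha_b)\sum_{j,k\ge1}\min(t_bj,t_ak)m^{(a)}_jm^{(b)}_k-\sum_a\sum_{j,k\ge1}\nu^{(a)}_j\min(j,k)m^{(a)}_k,$$ $$p^{(a)}_i=\sum_{j\ge1}\nu^{(a)}_j\min(i,j)-\sum_b(\alpha_a|\alpha_b)\sum_{k\ge1}\min(t_bi,t_ak)m^{(b)}_k,$$ summed over $m^{(a)}_i\in\mathbb Z_{\ge0}$ with all $p^{(a)}_i\ge0$ and $\sum_{a,i}i\,m^{(a)}_i\alpha_a=\sum_{a,i}i\,\nu^{(a)}_i\overline\Lambda_a-\lambda$. For $l\in\mathbb Z_{\ge1}$ let $H_l=\{(a,j)\mid1\le a\le n,\ 1\le j\le t_al\}$; for $W=\bigotimes_{(a,j)\in H_l}(W^{(a)}_j)^{\otimes\nu^{(a)}_j}$, $$M_l(W,q)=\sum_{\{m\}}q^{c_l(\{m\})}\prod_{(a,i)\in H_l}\left[{p^{(a)}_i+m^{(a)}_i\atop m^{(a)}_i}\right]_q,$$ where $c_l$ and $p^{(a)}_i$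 are given by the same formulas as $c$ and $p^{(a)}_i$ above with all sums over $(a,j),(b,k)$ restricted to $H_l$, and the sum is over $\{m^{(a)}_i\in\mathbb Z_{\ge0}\mid(a,i)\in H_l\}$ with all $p^{(a)}_i\ge0$ and $\sum_{(a,i)\in H_l}i\,m^{(a)}_i\alpha_a=\sum_{(a,i)\in H_l}i\,\nu^{(a)}_i\overline\Lambda_a$. $W^{(r)\otimes L}_s$ means $\nu^{(a)}_j=L\delta_{a,r}\delta_{j,s}$. *)

theory Defs
  imports "HOL-Analysis.Analysis" "HOL-Computational_Algebra.Formal_Laurent_Series"
begin

section \<open>Simple roots and fundamental weights\<close>

datatype dynkin =
  Type_A nat | Type_B nat | Type_C nat | Type_D nat | Type_E nat | Type_F4 | Type_G2

fun finite_type :: "dynkin \<Rightarrow> bool" where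
  "finite_type (Type_A n) \<longleftrightarrow> n \<ge> 1"
| "finite_type (Type_B n) \<longleftrightarrow> n \<ge> 2"
| "finite_type (Type_C n) \<longleftrightarrow> n \<ge> 2"
| "finite_type (Type_D n) \<longleftrightarrow> n \<ge> 4"
| "finite_type (Type_E n) \<longleftrightarrow> n \<in> {6, 7, 8}"
| "finite_type Type_F4 \<longleftrightarrow> True"
| "finite_type Type_G2 \<longleftrightarrow> True"

fun dynkin_rank :: "dynkin \<Rightarrow> nat" where
  "dynkin_rank (Type_A n) = n"
| "dynkin_rank (Type_B n) = n"
| "dynkin_rank (Type_C n) = n"
| "dynkin_rank (Type_D n) = n"
| "dynkin_rank (Type_E n) = n"
| "dynkin_rank Type_F4 = 4"
| "dynkin_rank Type_G2 = 2"

abbreviation vertices :: "dynkin \<Rightarrow> nat set" where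
  "vertices X \<equiv> {1..dynkin_rank X}"

text \<open>Kac's numbering. An edge is listed with its smaller vertex first; for the \<open>D\<close> and \<open>E\<close>
  series the last vertex is attached to an inner vertex of the chain formed by the others.\<close>

fun edge :: "dynkin \<Rightarrow> nat \<Rightarrow> nat \<Rightarrow> bool" where
  "edge (Type_D n) a b \<longleftrightarrow>
     (1 \<le> a \<and> b = Suc a \<and> b \<le> n - 1) \<or> (a = n - 2 \<and> b = n)"
| "edge (Type_E n) a b \<longleftrightarrow>
     (1 \<le> a \<and> b = Suc a \<and> b \<le> n - 1) \<or> (a = (if n = 8 then 5 else 3) \<and> b = n)"
| "edge X a b \<longleftrightarrow> 1 \<le> a \<and> b = Suc a \<and> b \<le> dynkin_rank X"

text \<open>Square lengths of the simple roots, long roots having square length 2.\<close>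

fun sq_length :: "dynkin \<Rightarrow> nat \<Rightarrow> real" where
  "sq_length (Type_B n) a = (if a = n then 1 else 2)"
| "sq_length (Type_C n) a = (if a = n then 2 else 1)"
| "sq_length Type_F4 a = (if a \<in> {3, 4} then 1 else 2)"
| "sq_length Type_G2 a = (if a = 2 then 2/3 else 2)"
| "sq_length _ a = 2"

text \<open>
  The form on the weight space is the inner product of an ambient space. The diagram, with its
  arrows, determines all inner products of simple roots: for adjacent \<open>a\<close>, \<open>b\<close> the Cartan integer
  with respect to the longer of the two roots is \<open>-1\<close>.
\<close>

definition simple_roots :: "dynkin \<Rightarrow> (nat \<Rightarrow> 'v::real_inner) \<Rightarrow> bool" where
  "simple_roots X \<alpha> \<longleftrightarrow>
     inj_on \<alpha> (vertices X) \<and> independent (\<alpha> ` vertices X) \<and>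
     (\<forall>a\<in>vertices X. \<forall>b\<in>vertices X.
        \<alpha> a \<bullet> \<alpha> b =
          (if a = b then sq_length X a
           else if edge X a b \<or> edge X b a then - max (sq_length X a) (sq_length X b) / 2
           else 0))"

definition fundamental_weights ::
    "dynkin \<Rightarrow> (nat \<Rightarrow> 'v::real_inner) \<Rightarrow> (nat \<Rightarrow> 'v) \<Rightarrow> bool" where
  "fundamental_weights X \<alpha> \<Lambda> \<longleftrightarrow>
     (\<forall>a\<in>vertices X. \<Lambda> a \<in> span (\<alpha> ` vertices X) \<and>
        (\<forall>b\<in>vertices X. 2 * (\<alpha> b \<bullet> \<Lambda> a) / (\<alpha> b \<bullet> \<alpha> b) = (if a = b then 1 else 0)))"

text \<open>The lattice spanned by \<open>v 1, \<dots>, v n\<close>: the root lattice for \<open>v = \<alpha>\<close> and the weight lattice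
  for \<open>v = \<Lambda>\<close>.\<close>

definition int_span :: "dynkin \<Rightarrow> (nat \<Rightarrow> 'v::real_vector) \<Rightarrow> 'v set" where
  "int_span X v = range (\<lambda>k :: nat \<Rightarrow> int. \<Sum>a\<in>vertices X. of_int (k a) *\<^sub>R v a)"

definition tnum :: "(nat \<Rightarrow> 'v::real_inner) \<Rightarrow> nat \<Rightarrow> real" where
  "tnum \<alpha> a = 2 / (\<alpha> a \<bullet> \<alpha> a)"

definition cartan_inv ::
    "(nat \<Rightarrow> 'v::real_inner) \<Rightarrow> (nat \<Rightarrow> 'v) \<Rightarrow> nat \<Rightarrow> nat \<Rightarrow> real" where
  "cartan_inv \<alpha> \<Lambda> a b = tnum \<alpha> a * (\<Lambda> a \<bullet> \<Lambda> b)"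


section \<open>Gaussian binomials\<close>

definition qfact :: "'a::field \<Rightarrow> nat \<Rightarrow> 'a" where
  "qfact q k = (\<Prod>i=1..k. 1 - q ^ i)"

text \<open>\<open>qbinom q p m\<close> is the coefficient with upper entry \<open>p + m\<close> and lower entry \<open>m\<close>. The quotient
  is meaningful when \<open>q\<close> is not a root of unity; only \<open>fls_X\<close> and its inverse are used.\<close>

definition qbinom :: "'a::field \<Rightarrow> int \<Rightarrow> nat \<Rightarrow> 'a" where
  "qbinom q p m =
     (if p < 0 then 0 else qfact q (nat p + m) / (qfact q (nat p) * qfact q m))"


section \<open>Fermionic forms\<close>

text \<open>
  A family of numbers with upper index \<open>a\<close> and lower index \<open>j\<close> is a function of the pair \<open>(a, j)\<close>.
  \<open>H\<close> is the set of index pairs, all of them for \<open>M(W,\<lambda>,q)\<close> and \<open>H\<^sub>l\<close> for \<open>M\<^sub>l(W,q)\<close>. All families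
  have finite support, and sums over \<open>H\<close> are written as finite sums over the support in \<open>H\<close>.
\<close>

definition all_indices :: "dynkin \<Rightarrow> (nat \<times> nat) set" where
  "all_indices X = {(a, j). a \<in> vertices X \<and> 1 \<le> j}"

definition level_indices :: "dynkin \<Rightarrow> (nat \<Rightarrow> 'v::real_inner) \<Rightarrow> nat \<Rightarrow> (nat \<times> nat) set" where
  "level_indices X \<alpha> l = {(a, j). a \<in> vertices X \<and> 1 \<le> j \<and> real j \<le> tnum \<alpha> a * real l}"

definition supp :: "(nat \<times> nat) set \<Rightarrow> (nat \<times> nat \<Rightarrow> 'b::zero) \<Rightarrow> (nat \<times> nat) set" where
  "supp H f = {x \<in> H. f x \<noteq> 0}"

definition charge ::
    "(nat \<Rightarrow> 'v::real_inner) \<Rightarrow> (nat \<times> nat) set \<Rightarrow> (nat \<times> nat \<Rightarrow> nat) \<Rightarrow> (nat \<times> nat \<Rightarrow> real) \<Rightarrow> real"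
  where
  "charge \<alpha> H \<nu> m =
     1/2 * (\<Sum>(a,j)\<in>supp H m. \<Sum>(b,k)\<in>supp H m.
              (\<alpha> a \<bullet> \<alpha> b) * min (tnum \<alpha> b * real j) (tnum \<alpha> a * real k) * m (a,j) * m (b,k))
     - (\<Sum>(a,j)\<in>supp H \<nu>. \<Sum>k | (a,k) \<in> supp H m.
          real (\<nu> (a,j)) * min (real j) (real k) * m (a,k))"

definition vacancy ::
    "(nat \<Rightarrow> 'v::real_inner) \<Rightarrow> (nat \<times> nat) set \<Rightarrow> (nat \<times> nat \<Rightarrow> nat) \<Rightarrow> (nat \<times> nat \<Rightarrow> real) \<Rightarrow>
       nat \<Rightarrow> nat \<Rightarrow> real"
  where
  "vacancy \<alpha> H \<nu> m a i =
     (\<Sum>j | (a,j) \<in> supp H \<nu>. real (\<nu> (a,j)) * min (real i) (real j))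
     - (\<Sum>(b,k)\<in>supp H m.
          (\<alpha> a \<bullet> \<alpha> b) * min (tnum \<alpha> b * real i) (tnum \<alpha> a * real k) * m (b,k))"

definition configurations ::
    "(nat \<Rightarrow> 'v::real_inner) \<Rightarrow> (nat \<Rightarrow> 'v) \<Rightarrow> (nat \<times> nat) set \<Rightarrow> (nat \<times> nat \<Rightarrow> nat) \<Rightarrow> 'v \<Rightarrow>
       (nat \<times> nat \<Rightarrow> nat) set"
  where
  "configurations \<alpha> \<Lambda> H \<nu> \<mu> =
     {m. finite {x. m x \<noteq> 0} \<and> {x. m x \<noteq> 0} \<subseteq> H \<and>
         (\<forall>(a,i)\<in>H. vacancy \<alpha> H \<nu> (real \<circ> m) a i \<ge> 0) \<and>
         (\<Sum>(a,i)\<in>supp H m. real (i * m (a,i)) *\<^sub>R \<alpha> a)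
           = (\<Sum>(a,i)\<in>supp H \<nu>. real (i * \<nu> (a,i)) *\<^sub>R \<Lambda> a) - \<mu>}"

text \<open>
  Charges and vacancy numbers of integral \<open>m\<close> are integers (see below), so the floors only convert
  types. The product over \<open>H\<close> reduces to the support of \<open>m\<close>, because a Gaussian binomial with
  \<open>m = 0\<close> and \<open>p \<ge> 0\<close> is 1.
\<close>

definition fermionic_form ::
    "(nat \<Rightarrow> 'v::real_inner) \<Rightarrow> (nat \<Rightarrow> 'v) \<Rightarrow> (nat \<times> nat) set \<Rightarrow> (nat \<times> nat \<Rightarrow> nat) \<Rightarrow> 'v \<Rightarrow>
       'a::field \<Rightarrow> 'a"
  where
  "fermionic_form \<alpha> \<Lambda> H \<nu> \<mu> q =
     (\<Sum>m\<in>configurations \<alpha> \<Lambda> H \<nu> \<mu>.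
        q powi \<lfloor>charge \<alpha> H \<nu> (real \<circ> m)\<rfloor> *
        (\<Prod>(a,i)\<in>supp H m. qbinom q \<lfloor>vacancy \<alpha> H \<nu> (real \<circ> m) a i\<rfloor> (m (a,i))))"

definition M_form ::
    "dynkin \<Rightarrow> (nat \<Rightarrow> 'v::real_inner) \<Rightarrow> (nat \<Rightarrow> 'v) \<Rightarrow> (nat \<times> nat \<Rightarrow> nat) \<Rightarrow> 'v \<Rightarrow> 'a::field \<Rightarrow> 'a"
  where
  "M_form X \<alpha> \<Lambda> \<nu> \<mu> q = fermionic_form \<alpha> \<Lambda> (all_indices X) \<nu> \<mu> q"

definition M_level ::
    "dynkin \<Rightarrow> (nat \<Rightarrow> 'v::real_inner) \<Rightarrow> (nat \<Rightarrow> 'v) \<Rightarrow> nat \<Rightarrow> (nat \<times> nat \<Rightarrow> nat) \<Rightarrow> 'a::field \<Rightarrow> 'a"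
  where
  "M_level X \<alpha> \<Lambda> l \<nu> q = fermionic_form \<alpha> \<Lambda> (level_indices X \<alpha> l) \<nu> 0 q"

text \<open>The data \<open>\<nu>\<close> of \<open>W\<^sup>(\<^sup>r\<^sup>)\<^sup>\<otimes>\<^sup>L\<close> with lower index \<open>s\<close>, and of \<open>W(\<zeta>)\<close>.\<close>

definition W_pow :: "nat \<Rightarrow> nat \<Rightarrow> nat \<Rightarrow> nat \<times> nat \<Rightarrow> nat" where
  "W_pow r s L = (\<lambda>(a, j). if a = r \<and> j = s then L else 0)"

definition W_zeta :: "(nat \<Rightarrow> nat) \<Rightarrow> nat \<times> nat \<Rightarrow> nat" where
  "W_zeta \<zeta> = (\<lambda>(a, j). if j = 1 then \<zeta> a else 0)"

text \<open>The minimizing configuration, equal to \<open>L C\<^sup>-\<^sup>1\<close> with indices \<open>r\<close>, \<open>a\<close> at \<open>i = t\<^sub>a s / t\<^sub>r\<close>.\<close>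

definition m_zero ::
    "dynkin \<Rightarrow> (nat \<Rightarrow> 'v::real_inner) \<Rightarrow> (nat \<Rightarrow> 'v) \<Rightarrow> nat \<Rightarrow> nat \<Rightarrow> nat \<Rightarrow> nat \<times> nat \<Rightarrow> real" where
  "m_zero X \<alpha> \<Lambda> r s L =
     (\<lambda>(a, i). if a \<in> vertices X \<and> i \<ge> 1 \<and> real i = tnum \<alpha> a * real s / tnum \<alpha> r
               then real L * cartan_inv \<alpha> \<Lambda> r a else 0)"

definition integral_powers :: "dynkin \<Rightarrow> (nat \<Rightarrow> 'v::real_inner) \<Rightarrow> (nat \<Rightarrow> 'v) \<Rightarrow> nat \<Rightarrow> nat set" where
  "integral_powers X \<alpha> \<Lambda> r = {L. L \<ge> 1 \<and> (\<forall>a\<in>vertices X. real L * cartan_inv \<alpha> \<Lambda> r a \<in> \<int>)}"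

definition zetas :: "dynkin \<Rightarrow> (nat \<Rightarrow> 'v::real_inner) \<Rightarrow> (nat \<Rightarrow> 'v) \<Rightarrow> (nat \<Rightarrow> nat) set" where
  "zetas X \<alpha> \<Lambda> =
     {\<zeta>. (\<forall>a. a \<notin> vertices X \<longrightarrow> \<zeta> a = 0) \<and>
         (\<Sum>a\<in>vertices X. real (\<zeta> a) *\<^sub>R \<Lambda> a) \<in> int_span X \<alpha>}"


section \<open>Integrality of charges and vacancy numbers\<close>

lemma tnum_simple_root:
  assumes "simple_roots X \<alpha>" "a \<in> vertices X"
  shows "tnum \<alpha> a = 2 / sq_length X a"
  using assms unfolding simple_roots_def tnum_def by auto

lemma cartan_entry_Ints:
  assumes "simple_roots X \<alpha>" "a \<in> vertices X" "b \<in> vertices X"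
  shows "tnum \<alpha> a * (\<alpha> a \<bullet> \<alpha> b) \<in> \<int>"
proof -
  have s: "sq_length X a > 0" "max (sq_length X a) (sq_length X b) / sq_length X a \<in> {1, 2, 3}"
    by (cases X; simp)+
  have e: "\<alpha> a \<bullet> \<alpha> b =
          (if a = b then sq_length X a
           else if edge X a b \<or> edge X b a then - max (sq_length X a) (sq_length X b) / 2
           else 0)"
    using assms unfolding simple_roots_def by blast
  have "tnum \<alpha> a * (\<alpha> a \<bullet> \<alpha> b) \<in>
      {2, 0, - (max (sq_length X a) (sq_length X b) / sq_length X a)}"
    using s(1) by (simp add: tnum_simple_root[OF assms(1,2)] e)
  then show ?thesis using s(2) by auto
qed

lemma pairing_Ints:
  assumes "simple_roots X \<alpha>" "a \<in> vertices X" "b \<in> vertices X"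
  shows "(\<alpha> a \<bullet> \<alpha> b) * min (tnum \<alpha> b * real j) (tnum \<alpha> a * real k) \<in> \<int>"
proof -
  have "tnum \<alpha> b * (\<alpha> a \<bullet> \<alpha> b) * real j \<in> \<int>" "tnum \<alpha> a * (\<alpha> a \<bullet> \<alpha> b) * real k \<in> \<int>"
    using cartan_entry_Ints[of X \<alpha> a b] cartan_entry_Ints[of X \<alpha> b a] assms
    by (auto simp: inner_commute[of "\<alpha> b"])
  then show ?thesis by (simp add: min_def mult_ac)
qed

lemma vacancy_Ints:
  assumes "simple_roots X \<alpha>" "H \<subseteq> all_indices X" "a \<in> vertices X"
  shows "vacancy \<alpha> H \<nu> (real \<circ> m) a i \<in> \<int>"
proof -
  have "(\<alpha> a \<bullet> \<alpha> b) * min (tnum \<alpha> b * real i) (tnum \<alpha> a * real k) * real (m (b,k)) \<in> \<int>"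
    if "(b,k) \<in> supp H (real \<circ> m)" for b k
    using that assms pairing_Ints[of X \<alpha> a b i k] unfolding supp_def all_indices_def by auto
  moreover have "real x * min (real y) (real z) \<in> \<int>" for x y z
    by (simp add: min_def)
  ultimately show ?thesis
    unfolding vacancy_def by (intro Ints_diff Ints_sum) auto
qed

lemma half_symmetric_sum_Ints:
  fixes S :: "'c \<Rightarrow> 'c \<Rightarrow> real"
  assumes "finite A"
    and "\<And>x y. x \<in> A \<Longrightarrow> y \<in> A \<Longrightarrow> S x y = S y x \<and> S x y \<in> \<int>"
    and "\<And>x. x \<in> A \<Longrightarrow> S x x / 2 \<in> \<int>"
  shows "1/2 * (\<Sum>x\<in>A. \<Sum>y\<in>A. S x y) \<in> \<int>"
  using assms
proof (induction A rule: finite_induct)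
  case empty
  then show ?case by simp
next
  case (insert z A)
  have "(\<Sum>x\<in>A. S x z) = (\<Sum>x\<in>A. S z x)"
    using insert.prems by (intro sum.cong) auto
  then have "1/2 * (\<Sum>x\<in>insert z A. \<Sum>y\<in>insert z A. S x y)
      = S z z / 2 + (\<Sum>x\<in>A. S z x) + 1/2 * (\<Sum>x\<in>A. \<Sum>y\<in>A. S x y)"
    using insert.hyps by (simp add: sum.distrib algebra_simps)
  also have "\<dots> \<in> \<int>"
    using insert by (intro Ints_add Ints_sum) auto
  finally show ?case .
qed

lemma charge_Ints:
  assumes sr: "simple_roots X \<alpha>" and H: "H \<subseteq> all_indices X" and fin: "finite {x. m x \<noteq> 0}"
  shows "charge \<alpha> H \<nu> (real \<circ> m) \<in> \<int>"
proof -
  define S where "S x y = (\<alpha> (fst x) \<bullet> \<alpha> (fst y)) *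
      min (tnum \<alpha> (fst y) * real (snd x)) (tnum \<alpha> (fst x) * real (snd y)) * real (m x) * real (m y)"
    for x y
  have "1/2 * (\<Sum>x\<in>supp H (real \<circ> m). \<Sum>y\<in>supp H (real \<circ> m). S x y) \<in> \<int>"
  proof (rule half_symmetric_sum_Ints)
    show "finite (supp H (real \<circ> m))"
      using fin by (rule rev_finite_subset) (auto simp: supp_def)
  next
    fix x y assume "x \<in> supp H (real \<circ> m)" "y \<in> supp H (real \<circ> m)"
    then have "fst x \<in> vertices X" "fst y \<in> vertices X"
      using H by (auto simp: supp_def all_indices_def)
    then show "S x y = S y x \<and> S x y \<in> \<int>"
      using pairing_Ints[OF sr, of "fst x" "fst y" "snd x" "snd y"]
      by (auto simp: S_def inner_commute min.commute)
  next
    fix x assume "x \<in> supp H (real \<circ> m)"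
    then have x: "fst x \<in> vertices X"
      using H by (auto simp: supp_def all_indices_def)
    have "sq_length X (fst x) > 0" by (cases X) auto
    then have "tnum \<alpha> (fst x) * (\<alpha> (fst x) \<bullet> \<alpha> (fst x)) = 2"
      using sr x unfolding tnum_def simple_roots_def by auto
    then have "S x x / 2 = real (snd x) * real (m x) * real (m x)"
      by (simp add: S_def algebra_simps)
    then show "S x x / 2 \<in> \<int>" by simp
  qed
  moreover have "real x * min (real y) (real z) * real w \<in> \<int>" for x y z w
    by (simp add: min_def)
  ultimately show ?thesis
    unfolding charge_def by (intro Ints_diff Ints_sum) (auto simp: S_def case_prod_beta)
qed

end

theory Submission
  imports Defs
begin

text \<open>
  Put \<open>l = s / t\<^sub>r\<close> and encode a family \<open>m\<close> by the step function
  \<open>v(x) = \<Sum>\<^sub>a t\<^sub>a (\<Sum>\<^bsub>k > t\<^sub>a x\<^esub> m (a,k)) \<alpha>\<^sub>a\<close> on the half line. The quadratic form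
  is then the square of the \<open>L\<^sup>2\<close> norm of \<open>v\<close>, the weight of \<open>m\<close> is the integral of \<open>v\<close>, and
  \<open>m\<close> contributes to vacancy numbers integrals of \<open>- t\<^sub>a (\<alpha>\<^sub>a | v)\<close> over initial intervals.
  The minimizing configuration has \<open>v = L t\<^sub>r \<Lambda>\<^sub>r\<close> on \<open>[0,l)\<close>, zero beyond, and vanishing vacancy
  numbers. Hence, for differences \<open>n\<close> from it, charges, vacancy numbers and the weight condition
  do not depend on \<open>L\<close>, while the binomials at \<open>i = t\<^sub>a l\<close> tend to \<open>1 / (q)\<^sub>p\<close> because
  \<open>C\<^sup>-\<^sup>1\<close> has positive entries.

  Cutting the step function of \<open>n\<close> at \<open>x = l\<close> gives the right hand side: the part on \<open>[l,\<infinity>)\<close>,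
  translated, is a configuration of \<open>M(W(\<zeta>),\<lambda>)\<close>, the part on \<open>[0,l)\<close>, reflected and negated, is
  one of \<open>M\<^sub>l(W(\<zeta>))\<close>, where \<open>\<zeta>\<^sub>a\<close> is the vacancy number of \<open>n\<close> at \<open>i = t\<^sub>a l\<close>. The norm is
  additive under this cut, and passing to \<open>q\<^sup>-\<^sup>1\<close> turns charges into half norms. Coefficientwise
  convergence holds because only finitely many \<open>n\<close> have bounded norm.
\<close>

section \<open>Power series\<close>

unbundle fps_syntax
unbundle no vec_syntax

text \<open>The kernel \<open>min (t_b j) (t_a k)\<close> is \<open>t_a t_b\<close> times the
  overlap of the intervals [0, j/t_a) and [0, k/t_b); writing the overlap as an integral of
  indicator functions makes the quadratic form an inner product. As all t_a are 1, 2 or 3, cells of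
  length 1/6 turn these integrals into finite sums. Passing to inverse q rests on two facts: a
  Gaussian binomial acquires the factor \<open>q powi (- p * m)\<close>, and the charge plus the sum
  of all products \<open>p * m\<close> is minus half the norm. The delicate point of the cut is that
  every limiting difference arises by gluing. The reflected lower part needs a last entry at t_a l,
  and this entry is minus a root coordinate of the step function at 0. No sign condition on the
  difference makes it nonnegative; that follows from the vacancy numbers at \<open>i = 1\<close> and
  the nonnegativity of the inverse Cartan matrix. The data W(zeta) have lower index 1 because the
  cut shifts all vacancy numbers of component \<open>a\<close> by one constant zeta_a. The weight of
  the lower part is zeta itself, which puts zeta into the root lattice.\<close>

lemma fps_to_fls_tendsto_iff:
  fixes f :: "'b \<Rightarrow> 'a::field fps"
  shows "((\<lambda>x. fps_to_fls (f x)) \<longlongrightarrow> fps_to_fls g) F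
           \<longleftrightarrow> (\<forall>N. eventually (\<lambda>x. f x $ N = g $ N) F)" (is "?l \<longleftrightarrow> ?r")
proof
  assume l: ?l
  show ?r
  proof
    fix N
    have "eventually (\<lambda>x. dist (fps_to_fls (f x)) (fps_to_fls g) < inverse (2 ^ N)) F"
      using l by (intro tendstoD) auto
    then show "eventually (\<lambda>x. f x $ N = g $ N) F"
    proof eventually_elim
      case (elim x)
      have "f x $ N = g $ N" if "f x \<noteq> g"
      proof -
        have d: "fls_subdegree (fps_to_fls (f x) - fps_to_fls g) = subdegree (f x - g)"
          by (metis fls_subdegree_fls_to_fps fps_to_fls_minus)
        then have "inverse (2 ^ subdegree (f x - g)) < (inverse (2 ^ N) :: real)"
          using elim that by (simp add: dist_fls_def)
        then have "N < subdegree (f x - g)" by simp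
        then have "(f x - g) $ N = 0" by (rule nth_less_subdegree_zero)
        then show ?thesis by simp
      qed
      then show ?case by auto
    qed
  qed
next
  assume r: ?r
  show ?l
  proof (rule tendstoI)
    fix e :: real assume e: "e > 0"
    \<comment> \<open>The distance is 2 to the power minus the subdegree of the difference, so
      accuracy \<open>e\<close> amounts to agreement of finitely many coefficients.\<close>
    obtain N where N: "inverse (2 ^ N) < e"
      using reals_power_lt_ex[OF e, of 2] by (auto simp: power_one_over inverse_eq_divide)
    have "eventually (\<lambda>x. \<forall>k\<in>{..N}. f x $ k = g $ k) F"
      using r by (intro eventually_ball_finite) auto
    then show "eventually (\<lambda>x. dist (fps_to_fls (f x)) (fps_to_fls g) < e) F"
    proof eventually_elim
      case (elim x)
      show ?case
      proof (cases "f x = g")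
        case False
        have d: "fls_subdegree (fps_to_fls (f x) - fps_to_fls g) = subdegree (f x - g)"
          by (metis fls_subdegree_fls_to_fps fps_to_fls_minus)
        have "(f x - g) $ subdegree (f x - g) \<noteq> 0"
          using False by (intro nth_subdegree_nonzero) simp
        then have "N < subdegree (f x - g)" using elim by (force simp: not_less[symmetric])
        then have "inverse (2 ^ subdegree (f x - g)) < (inverse (2 ^ N) :: real)" by simp
        then have "inverse (2 ^ subdegree (f x - g)) < e" using N by linarith
        then show ?thesis using False d by (simp add: dist_fls_def del: fps_to_fls_minus)
      qed (use e in simp)
    qed
  qed
qed

lemma fps_to_fls_sum: "fps_to_fls (\<Sum>x\<in>A. f x) = (\<Sum>x\<in>A. fps_to_fls (f x))"
  by (induction A rule: infinite_finite_induct) auto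

lemma fps_to_fls_prod:
  fixes f :: "'b \<Rightarrow> 'a::field fps"
  shows "fps_to_fls (\<Prod>x\<in>A. f x) = (\<Prod>x\<in>A. fps_to_fls (f x))"
  by (induction A rule: infinite_finite_induct) (auto simp: fls_times_fps_to_fls)

text \<open>A coefficient of degree \<open>N\<close> only sees the finitely many indices with
  \<open>d i \<le> N\<close>, so pointwise eventual conditions hold for all of them simultaneously.
  It serves both the limit in \<open>L\<close> and the net of partial sums over zeta; the two sides
  of the theorem agree because both lead to the same series.\<close>

lemma graded_limit:
  fixes c :: "'i \<Rightarrow> 'a::field fps" and b :: "'l \<Rightarrow> 'i \<Rightarrow> 'a fps" and d :: "'i \<Rightarrow> nat"
  assumes fin: "\<And>N. finite {i\<in>I. d i \<le> N}"
    and S: "\<And>x. finite (S x)" "\<And>x. S x \<subseteq> I"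
    and ev: "\<And>i. i \<in> I \<Longrightarrow> eventually (\<lambda>x. i \<in> S x) F"
    and coeff: "\<And>i N. i \<in> I \<Longrightarrow> eventually (\<lambda>x. b x i $ N = c i $ N) F"
  shows "((\<lambda>x. fps_to_fls (\<Sum>i\<in>S x. fps_X ^ d i * b x i)) \<longlongrightarrow>
            fps_to_fls (Abs_fps (\<lambda>N. \<Sum>i | i \<in> I \<and> d i \<le> N. (fps_X ^ d i * c i) $ N))) F"
  unfolding fps_to_fls_tendsto_iff
proof
  fix N
  let ?I = "{i\<in>I. d i \<le> N}"
  have "eventually (\<lambda>x. \<forall>i\<in>?I. i \<in> S x \<and> b x i $ (N - d i) = c i $ (N - d i)) F"
    using ev coeff by (intro eventually_ball_finite fin ballI eventually_conj) auto
  then show "eventually (\<lambda>x. (\<Sum>i\<in>S x. fps_X ^ d i * b x i) $ N =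
      Abs_fps (\<lambda>N. \<Sum>i\<in>{i\<in>I. d i \<le> N}. (fps_X ^ d i * c i) $ N) $ N) F"
  proof eventually_elim
    case (elim x)
    have "(\<Sum>i\<in>S x. fps_X ^ d i * b x i) $ N = (\<Sum>i\<in>?I. (fps_X ^ d i * b x i) $ N)"
      unfolding fps_sum_nth
      by (rule sum.mono_neutral_right) (use S elim in \<open>auto simp: fps_X_power_mult_nth\<close>)
    also have "\<dots> = (\<Sum>i\<in>?I. (fps_X ^ d i * c i) $ N)"
      using elim by (intro sum.cong) (auto simp: fps_X_power_mult_nth)
    finally show ?case by simp
  qed
qed

section \<open>q-factorials and Gaussian binomials as power series\<close>

definition qfact_fps :: "nat \<Rightarrow> 'a::field fps" where
  "qfact_fps k = (\<Prod>i=1..k. 1 - fps_X ^ i)"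

definition qbinom_fps :: "nat \<Rightarrow> nat \<Rightarrow> 'a::field fps" where
  "qbinom_fps p m = qfact_fps (p + m) * inverse (qfact_fps p * qfact_fps m)"

lemma qfact_fps_nth_0 [simp]: "qfact_fps k $ 0 = 1"
proof -
  have "(1 - fps_X ^ i :: 'a fps) $ 0 = 1" if "i \<ge> 1" for i
    using that by (simp add: fps_X_power_iff)
  moreover have "(\<Prod>i\<in>A. f i) $ 0 = (\<Prod>i\<in>A. f i $ 0)" for f :: "nat \<Rightarrow> 'a fps" and A
    by (induction A rule: infinite_finite_induct) auto
  ultimately show ?thesis by (simp add: qfact_fps_def)
qed

lemma qfact_fps_nonzero [simp]: "qfact_fps k \<noteq> (0 :: 'a::field fps)"
  by (metis fps_zero_nth qfact_fps_nth_0 zero_neq_one)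

text \<open>Vacancy number 0 makes a factor trivial whatever the entry; this disposes of the entries
  at the top index of the level restricted configurations.\<close>

lemma qbinom_fps_0_left: "qbinom_fps 0 m = (1 :: 'a::field fps)"
proof -
  have "qfact_fps m * inverse (qfact_fps m) = (1 :: 'a fps)" by (rule inverse_mult_eq_1') simp
  then show ?thesis by (simp add: qbinom_fps_def) (simp add: qfact_fps_def)
qed

lemma qfact_fls_X: "qfact fls_X k = fps_to_fls (qfact_fps k)"
  by (simp add: qfact_def qfact_fps_def fps_to_fls_prod fps_to_fls_power)

lemma fps_to_fls_inverse: "f $ 0 \<noteq> 0 \<Longrightarrow> fps_to_fls (inverse f) = inverse (fps_to_fls (f :: 'a::field fps))"
  by (simp add: fls_inverse_fps_to_fls)

lemma qbinom_fls_X: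
  "qbinom fls_X (int p) m = fps_to_fls (qbinom_fps p m)"
  by (simp add: qbinom_def qbinom_fps_def qfact_fls_X fls_times_fps_to_fls fps_to_fls_inverse
      divide_inverse)

lemma qbinom_0_right:
  assumes "p \<ge> 0"
  shows "qbinom (fls_X :: 'a::field fls) p 0 = 1"
  using assms by (simp add: qbinom_def qfact_fls_X) (simp add: qfact_fps_def)

lemma qfact_inverse:
  fixes q :: "'a::field"
  assumes "q \<noteq> 0"
  shows "qfact (inverse q) k = (-1) ^ k * inverse q ^ (\<Sum>{1..k}) * qfact q k"
proof -
  have "1 - inverse q ^ i = (-1) * inverse q ^ i * (1 - q ^ i)" for i
    using assms by (simp add: power_inverse field_simps)
  then have "qfact (inverse q) k = (\<Prod>i=1..k. (-1) * inverse q ^ i * (1 - q ^ i))"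
    unfolding qfact_def by (intro prod.cong) auto
  then show ?thesis
    unfolding prod.distrib by (simp add: power_sum qfact_def)
qed

lemma sum_upto_add: "\<Sum>{1..p + m} = \<Sum>{1..p} + \<Sum>{1..m} + p * (m::nat)"
  by (induction m) auto

text \<open>Each factor \<open>1 - q ^ i\<close> yields \<open>- q ^ i\<close> in the denominator on
  inversion. The signs cancel between numerator and denominator, and the triangular exponents differ
  by \<open>p * m\<close> according to \<open>sum_upto_add\<close>.\<close>

lemma qbinom_inverse:
  fixes q :: "'a::field"
  assumes "q \<noteq> 0"
  shows "qbinom (inverse q) p m = q powi (- p * int m) * qbinom q p m"
proof (cases "p < 0")
  case False
  then obtain n where n: "p = int n" by (metis nonneg_int_cases not_less)
  let ?c = "inverse q"
  \<comment> \<open>All signs and powers from the denominator; the numerator carries the same factor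
    and the surplus \<open>?c ^ (n * m)\<close>.\<close>
  define d where "d = (-1) ^ n * ?c ^ \<Sum>{1..n} * ((-1) ^ m * ?c ^ \<Sum>{1..m})"
  have "d \<noteq> 0" using assms by (simp add: d_def)
  have num: "qfact ?c (n + m) = d * (?c ^ (n * m) * qfact q (n + m))"
    using assms by (simp add: qfact_inverse sum_upto_add power_add d_def mult_ac del: One_nat_def)
  have den: "qfact ?c n * qfact ?c m = d * (qfact q n * qfact q m)"
    using assms by (simp add: qfact_inverse d_def mult_ac del: One_nat_def)
  have "qbinom ?c p m = ?c ^ (n * m) * qfact q (n + m) / (qfact q n * qfact q m)"
    using \<open>d \<noteq> 0\<close> unfolding qbinom_def n by (simp only: nat_int num den) simp
  moreover have "q powi (- p * int m) = ?c ^ (n * m)"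
    by (simp add: n power_int_minus power_inverse flip: of_nat_mult)
  ultimately show ?thesis by (simp add: qbinom_def n)
qed (simp add: qbinom_def)

text \<open>Congruence to 1 modulo \<open>x\<close> is multiplicative; it is phrased by divisibility
  to work modulo powers of \<open>fps_X\<close>.\<close>

lemma dvd_mult_minus_1:
  fixes f g :: "'a::comm_ring_1"
  assumes "x dvd f - 1" "x dvd g - 1"
  shows "x dvd f * g - 1"
proof -
  have "f * g - 1 = f * (g - 1) + (f - 1)" by (simp add: algebra_simps)
  also have "x dvd \<dots>" using assms by (intro dvd_add dvd_mult)
  finally show ?thesis .
qed

lemma dvd_prod_minus_1:
  fixes f :: "'b \<Rightarrow> 'a::comm_ring_1"
  shows "(\<And>i. i \<in> A \<Longrightarrow> x dvd f i - 1) \<Longrightarrow> x dvd (\<Prod>i\<in>A. f i) - 1"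
  by (induction A rule: infinite_finite_induct) (auto intro: dvd_mult_minus_1)

lemma fps_nth_mult_near_1:
  fixes f g :: "'a::field fps"
  assumes "fps_X ^ Suc N dvd g - 1"
  shows "(f * g) $ N = f $ N"
proof -
  obtain h where "g - 1 = fps_X ^ Suc N * h" using assms by (auto elim: dvdE)
  then have g: "g = 1 + fps_X ^ Suc N * h" by (simp add: algebra_simps)
  have "f * g = f + fps_X ^ Suc N * (f * h)" by (simp add: g algebra_simps)
  then show ?thesis by (simp add: fps_X_power_mult_nth del: power_Suc)
qed

text \<open>The quotient of \<open>qfact_fps (p + m)\<close> by \<open>qfact_fps m\<close> is the
  product of \<open>1 - fps_X ^ i\<close> over \<open>m < i \<le> p + m\<close>, hence 1 modulo
  \<open>fps_X ^ Suc m\<close>. This is a quantitative form of the limit \<open>1 / (q)_p\<close>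
  for growing \<open>m\<close>.\<close>

lemma qbinom_fps_limit:
  "\<exists>h. qbinom_fps p m = inverse (qfact_fps p) * h \<and> fps_X ^ Suc m dvd (h :: 'a::field fps) - 1"
proof -
  define h where "h = (\<Prod>i=m+1..p+m. 1 - fps_X ^ i :: 'a fps)"
  have "{1..p+m} = {1..m} \<union> {m+1..p+m}" "{1..m} \<inter> {m+1..p+m} = {}" by auto
  then have "qfact_fps (p + m) = qfact_fps m * h"
    unfolding qfact_fps_def h_def by (simp add: prod.union_disjoint)
  then have "qbinom_fps p m = inverse (qfact_fps p) * h"
    by (simp add: qbinom_fps_def fps_inverse_mult inverse_mult_eq_1 mult_ac)
      (metis inverse_mult_eq_1' mult.left_commute mult.right_neutral qfact_fps_nth_0 zero_neq_one)
  moreover have "fps_X ^ Suc m dvd h - 1"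
    unfolding h_def
  proof (rule dvd_prod_minus_1)
    fix i assume "i \<in> {m+1..p+m}"
    then show "fps_X ^ Suc m dvd (1 - fps_X ^ i - 1 :: 'a fps)"
      by (simp add: le_imp_power_dvd del: power_Suc)
  qed
  ultimately show ?thesis by blast
qed

section \<open>Simple roots and step functions\<close>

text \<open>Discrete form of the integral of a product of two indicator functions of initial
  intervals; through it every \<open>min\<close> of the quadratic form enters.\<close>

lemma sum_below_min:
  "(\<Sum>z<m. if z < n then c else 0) = of_nat (min m n) *\<^sub>R (c :: 'w::real_vector)"
proof -
  have "(\<Sum>z<m. if z < n then c else 0) = (\<Sum>z<min m n. c)"
    by (rule sum.mono_neutral_cong_right) auto
  then show ?thesis by (simp add: sum_constant_scaleR)
qed

lemma sum_trunc:
  fixes f :: "nat \<Rightarrow> 'w::comm_monoid_add"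
  assumes "\<And>z. z \<ge> M \<Longrightarrow> f z = 0" "\<And>z. z \<ge> N \<Longrightarrow> f z = 0"
  shows "(\<Sum>z<M. f z) = (\<Sum>z<N. f z)"
proof -
  have "(\<Sum>z<M. f z) = (\<Sum>z<max M N. f z)"
    by (rule sum.mono_neutral_left) (use assms in auto)
  also have "\<dots> = (\<Sum>z<N. f z)"
    by (rule sum.mono_neutral_right) (use assms in auto)
  finally show ?thesis .
qed

lemma finite_slice: "finite {y. m y \<noteq> 0} \<Longrightarrow> finite {k. m (a,k) \<noteq> 0}"
  by (rule finite_subset[of _ "snd ` {y. m y \<noteq> 0}"]) force+

lemma sum_lessThan_add:
  fixes f :: "nat \<Rightarrow> 'a::comm_monoid_add"
  shows "(\<Sum>z<m + n. f z) = (\<Sum>z<m. f z) + (\<Sum>z<n. f (m + z))"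
  by (induction n) (auto simp: add.assoc)

lemma sq_length_cases: "sq_length X a \<in> {1, 2, 2/3}"
  by (cases X) auto

lemma edge_imp_less: "finite_type X \<Longrightarrow> edge X a b \<Longrightarrow> 1 \<le> a \<and> a < b \<and> b \<le> dynkin_rank X"
  by (cases X) (auto split: if_splits)

text \<open>Connectedness of the diagram in inductive form: choosing a smaller neighbour makes it a
  tree rooted at 1. The witness \<open>p\<close> is \<open>b - 1\<close> except for the branch
  vertex of the D and E series.\<close>

lemma edge_below:
  assumes "finite_type X" "b \<in> vertices X" "b \<noteq> 1"
  shows "\<exists>a<b. a \<in> vertices X \<and> edge X a b"
proof -
  define p where "p = (case X of Type_D n \<Rightarrow> (if b = n then n - 2 else b - 1)
    | Type_E n \<Rightarrow> (if b = n then (if n = 8 then 5 else 3) else b - 1) | _ \<Rightarrow> b - 1)"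
  have "p < b \<and> p \<in> vertices X \<and> edge X p b"
    using assms by (cases X) (auto simp: p_def)
  then show ?thesis by blast
qed

locale root_data =
  fixes X :: dynkin and \<alpha> \<Lambda> :: "nat \<Rightarrow> 'v::real_inner"
  assumes fin: "finite_type X" and sr: "simple_roots X \<alpha>" and fw: "fundamental_weights X \<alpha> \<Lambda>"
begin

definition tnat :: "nat \<Rightarrow> nat" where "tnat a = nat \<lfloor>tnum \<alpha> a\<rfloor>"

text \<open>All \<open>t\<^sub>a\<close> divide 6, so positions \<open>i / t\<^sub>a\<close> become integers after scaling by 6.\<close>
definition u :: "nat \<Rightarrow> nat" where "u a = 6 div tnat a"

lemma tnum_cases:
  assumes "a \<in> vertices X"
  shows "tnum \<alpha> a \<in> {1, 2, 3}"
proof -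
  have "2 / x \<in> {1, 2, 3}" if "x \<in> {1, 2, 2/3}" for x :: real
    using that by (elim insertE emptyE; hypsubst) simp_all
  then show ?thesis using sq_length_cases[of X a] unfolding tnum_simple_root[OF sr assms] .
qed

lemma real_tnat: "a \<in> vertices X \<Longrightarrow> real (tnat a) = tnum \<alpha> a"
  using tnum_cases[of a] by (auto simp: tnat_def)

lemma tnat_cases: "a \<in> vertices X \<Longrightarrow> tnat a \<in> {1, 2, 3}"
  using tnum_cases[of a] by (auto simp: tnat_def)

lemma u_tnat: "a \<in> vertices X \<Longrightarrow> u a * tnat a = 6"
  using tnat_cases[of a] by (auto simp: u_def)

lemma real_u: "a \<in> vertices X \<Longrightarrow> real (u a) = 6 / tnum \<alpha> a"
  using tnat_cases[of a] real_tnat[of a] by (auto simp: u_def)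

lemma u_pos: "a \<in> vertices X \<Longrightarrow> u a > 0"
  using tnat_cases[of a] by (auto simp: u_def)

lemma tnum_pos: "a \<in> vertices X \<Longrightarrow> tnum \<alpha> a > 0"
  using tnum_cases[of a] by auto

section \<open>Geometry of simple roots and fundamental weights\<close>

lemma root_inner_nonpos:
  assumes "a \<in> vertices X" "b \<in> vertices X" "a \<noteq> b"
  shows "\<alpha> a \<bullet> \<alpha> b \<le> 0"
proof -
  have "sq_length X a > 0" using sq_length_cases[of X a] by auto
  then show ?thesis using sr assms unfolding simple_roots_def by (auto simp: max_def)
qed

lemma root_inner_edge_neg:
  assumes "a \<in> vertices X" "b \<in> vertices X" "edge X a b \<or> edge X b a"
  shows "\<alpha> a \<bullet> \<alpha> b < 0"
proof -
  have "sq_length X a > 0" "sq_length X b > 0"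
    using sq_length_cases[of X a] sq_length_cases[of X b] by auto
  moreover have "a \<noteq> b" using assms edge_imp_less[OF fin] by blast
  ultimately show ?thesis using sr assms unfolding simple_roots_def by (auto simp: max_def)
qed

lemma root_weight:
  assumes "a \<in> vertices X" "b \<in> vertices X"
  shows "\<alpha> a \<bullet> \<Lambda> b = (if a = b then 1 / tnum \<alpha> a else 0)"
proof -
  have "tnum \<alpha> a * (\<alpha> a \<bullet> \<Lambda> b) = (if b = a then 1 else 0)"
    using fw assms unfolding fundamental_weights_def tnum_def by auto
  then show ?thesis using tnum_pos[OF assms(1)] by (auto simp: field_simps split: if_splits)
qed

text \<open>The ambient space may be larger than the span of the roots, so expansions and
  orthogonality criteria are restricted to this subspace.\<close>

abbreviation rspan :: "'v set" where "rspan \<equiv> span (\<alpha> ` vertices X)"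

lemma root_in_rspan: "a \<in> vertices X \<Longrightarrow> \<alpha> a \<in> rspan"
  by (intro span_base) auto

lemma weight_in_rspan: "a \<in> vertices X \<Longrightarrow> \<Lambda> a \<in> rspan"
  using fw unfolding fundamental_weights_def by blast

text \<open>The vectors \<open>t_b \<Lambda> b\<close> pair with the simple roots as a dual basis,
  so the identity holds on roots and extends linearly.\<close>

lemma root_expansion:
  assumes "v \<in> rspan"
  shows "v = (\<Sum>b\<in>vertices X. (tnum \<alpha> b * (v \<bullet> \<Lambda> b)) *\<^sub>R \<alpha> b)"
  using assms
proof (induction rule: span_induct)
  case base
  define E where "E v = (\<Sum>b\<in>vertices X. (tnum \<alpha> b * (v \<bullet> \<Lambda> b)) *\<^sub>R \<alpha> b)" for v
  have "E (v + w) = E v + E w" "E (c *\<^sub>R v) = c *\<^sub>R E v" "E 0 = 0" for v w c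
    by (simp_all add: E_def inner_add_left scaleR_add_left distrib_left sum.distrib
        scaleR_sum_right mult_ac)
  then have "subspace {v. v = E v}" by (simp add: subspace_def)
  then show ?case by (simp only: E_def)
next
  case (step x)
  then obtain a where a: "a \<in> vertices X" "x = \<alpha> a" by blast
  have "(\<Sum>b\<in>vertices X. (tnum \<alpha> b * (\<alpha> a \<bullet> \<Lambda> b)) *\<^sub>R \<alpha> b)
      = (\<Sum>b\<in>vertices X. if a = b then \<alpha> b else 0)"
    using a tnum_pos[of a] by (intro sum.cong) (auto simp: root_weight)
  then show ?case using a by simp
qed

lemma rspan_orthogonal:
  assumes "v \<in> rspan" "\<And>a. a \<in> vertices X \<Longrightarrow> \<alpha> a \<bullet> v = 0"
  shows "v = 0"
proof -
  have "v \<bullet> v = (\<Sum>b\<in>vertices X. (tnum \<alpha> b * (v \<bullet> \<Lambda> b)) *\<^sub>R \<alpha> b) \<bullet> v"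
    using root_expansion[OF assms(1)] by simp
  also have "\<dots> = 0" using assms(2) by (simp add: inner_sum_left)
  finally show ?thesis by simp
qed

lemma weight_expansion:
  assumes "v \<in> rspan"
  shows "v = (\<Sum>b\<in>vertices X. (tnum \<alpha> b * (\<alpha> b \<bullet> v)) *\<^sub>R \<Lambda> b)"
proof -
  let ?w = "\<Sum>b\<in>vertices X. (tnum \<alpha> b * (\<alpha> b \<bullet> v)) *\<^sub>R \<Lambda> b"
  have "v - ?w = 0"
  proof (rule rspan_orthogonal)
    show "v - ?w \<in> rspan"
      using assms weight_in_rspan by (intro span_diff span_sum span_scale) auto
  next
    fix a assume a: "a \<in> vertices X"
    have "\<alpha> a \<bullet> ?w = (\<Sum>b\<in>vertices X. if a = b then \<alpha> b \<bullet> v else 0)"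
      unfolding inner_sum_right using a tnum_pos[of a]
      by (intro sum.cong) (auto simp: root_weight)
    then show "\<alpha> a \<bullet> (v - ?w) = 0" using a by (simp add: inner_diff_right)
  qed
  then show ?thesis by simp
qed

text \<open>Nonnegativity of the inverse Cartan matrix. Write \<open>v = p - n\<close> with the
  positive and negative root coordinates separated. Off-diagonal products of roots are nonpositive,
  so \<open>p \<bullet> n \<le> 0\<close>; dominance gives \<open>v \<bullet> n \<ge> 0\<close>;
  together \<open>n \<bullet> n \<le> 0\<close>.\<close>

lemma dominant_imp_nonneg:
  assumes v: "v \<in> rspan" "\<And>a. a \<in> vertices X \<Longrightarrow> \<alpha> a \<bullet> v \<ge> 0" and b: "b \<in> vertices X"
  shows "v \<bullet> \<Lambda> b \<ge> 0"
proof -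
  define c where "c a = tnum \<alpha> a * (v \<bullet> \<Lambda> a)" for a
  define p where "p = (\<Sum>a\<in>vertices X. max 0 (c a) *\<^sub>R \<alpha> a)"
  define n where "n = (\<Sum>a\<in>vertices X. max 0 (- c a) *\<^sub>R \<alpha> a)"
  have "v = (\<Sum>a\<in>vertices X. c a *\<^sub>R \<alpha> a)"
    using root_expansion[OF v(1)] by (simp add: c_def)
  also have "\<dots> = (\<Sum>a\<in>vertices X. max 0 (c a) *\<^sub>R \<alpha> a - max 0 (- c a) *\<^sub>R \<alpha> a)"
    by (intro sum.cong) (auto simp: max_def)
  also have "\<dots> = p - n" by (simp add: p_def n_def sum_subtractf)
  finally have vpn: "v = p - n" .
  \<comment> \<open>For \<open>a = d\<close> one of the two maxima vanishes, so only off-diagonal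
    products of roots matter.\<close>
  have pn: "(max 0 (c a) *\<^sub>R \<alpha> a) \<bullet> (max 0 (- c d) *\<^sub>R \<alpha> d) \<le> 0"
    if "a \<in> vertices X" "d \<in> vertices X" for a d
  proof (cases "a = d")
    case False
    have "max 0 (c a) * max 0 (- c d) * (\<alpha> a \<bullet> \<alpha> d) \<le> 0"
      by (rule mult_nonneg_nonpos) (use root_inner_nonpos[OF that False] in auto)
    then show ?thesis by (simp add: mult_ac)
  qed (auto simp: max_def)
  have "p \<bullet> n \<le> 0"
    unfolding p_def n_def inner_sum_left inner_sum_right by (intro sum_nonpos pn)
  moreover have "v \<bullet> n \<ge> 0"
    unfolding n_def inner_sum_right using v(2)
    by (intro sum_nonneg) (auto simp: inner_commute)
  moreover have "v \<bullet> n = p \<bullet> n - n \<bullet> n" by (simp add: vpn inner_diff_left)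
  ultimately have "n \<bullet> n \<le> 0" by linarith
  then have "n = 0" by (metis inner_eq_zero_iff inner_ge_zero order_antisym)
  then have "0 = n \<bullet> \<Lambda> b" by simp
  also have "\<dots> = (\<Sum>a\<in>vertices X. if a = b then max 0 (- c a) / tnum \<alpha> b else 0)"
    unfolding n_def inner_sum_left using b by (intro sum.cong) (auto simp: root_weight)
  also have "\<dots> = max 0 (- c b) / tnum \<alpha> b" using b by simp
  finally have "c b \<ge> 0" using tnum_pos[OF b] by (auto simp: max_def split: if_splits)
  then show ?thesis using tnum_pos[OF b] by (auto simp: c_def zero_le_mult_iff)
qed

lemma weight_inner_nonneg: "a \<in> vertices X \<Longrightarrow> b \<in> vertices X \<Longrightarrow> \<Lambda> a \<bullet> \<Lambda> b \<ge> 0"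
  by (rule dominant_imp_nonneg[OF weight_in_rspan])
    (simp_all add: root_weight tnum_pos less_imp_le)

text \<open>The vertices at which a fundamental weight is orthogonal to \<open>\<Lambda> r\<close> form a union of
  components of the Dynkin diagram that does not contain \<open>r\<close>; the diagram is connected.\<close>
lemma weight_inner_pos:
  assumes r: "r \<in> vertices X" and a: "a \<in> vertices X"
  shows "\<Lambda> r \<bullet> \<Lambda> a > 0"
proof (rule ccontr)
  define c where "c d = tnum \<alpha> d * (\<Lambda> r \<bullet> \<Lambda> d)" for d
  define Z where "Z = {b\<in>vertices X. c b = 0}"
  assume "\<not> \<Lambda> r \<bullet> \<Lambda> a > 0"
  then have aZ: "a \<in> Z" using a r weight_inner_nonneg[OF r a] by (auto simp: Z_def c_def)
  have c0: "c d \<ge> 0" if "d \<in> vertices X" for d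
    using weight_inner_nonneg[OF r that] tnum_pos[OF that] by (simp add: c_def)
  have nb: "b \<noteq> r \<and> (\<forall>d\<in>vertices X. edge X b d \<or> edge X d b \<longrightarrow> d \<in> Z)" if "b \<in> Z" for b
  proof -
    have b: "b \<in> vertices X" "c b = 0" using that by (auto simp: Z_def)
    have "\<Lambda> r = (\<Sum>d\<in>vertices X. c d *\<^sub>R \<alpha> d)"
      using root_expansion[OF weight_in_rspan[OF r]] by (simp add: c_def)
    then have e: "\<alpha> b \<bullet> \<Lambda> r = (\<Sum>d\<in>vertices X. c d * (\<alpha> b \<bullet> \<alpha> d))"
      by (metis (no_types, lifting) inner_scaleR_right inner_sum_right sum.cong)
    \<comment> \<open>The diagonal term drops out since \<open>c b = 0\<close>. The nonpositive
      remaining terms sum to \<open>\<alpha> b \<bullet> \<Lambda> r\<close>, which is never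
      negative; thus \<open>b\<close> differs from \<open>r\<close> and every term is 0.\<close>
    have np: "c d * (\<alpha> b \<bullet> \<alpha> d) \<le> 0" if "d \<in> vertices X" for d
      using b c0[OF that] root_inner_nonpos[OF b(1) that] by (cases "d = b") (auto simp: mult_nonneg_nonpos)
    then have "\<alpha> b \<bullet> \<Lambda> r \<le> 0" unfolding e by (intro sum_nonpos)
    then have br: "b \<noteq> r" and z: "\<alpha> b \<bullet> \<Lambda> r = 0"
      using root_weight[OF b(1) r] tnum_pos[OF r] by (auto split: if_splits simp: not_le[symmetric])
    have "(\<Sum>d\<in>vertices X. - (c d * (\<alpha> b \<bullet> \<alpha> d))) = 0"
      using z unfolding e by (simp add: sum_negf)
    then have "c d * (\<alpha> b \<bullet> \<alpha> d) = 0" if "d \<in> vertices X" for d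
      using np that by (subst (asm) sum_nonneg_eq_0_iff) auto
    then show ?thesis
      using br root_inner_edge_neg[OF b(1)] by (force simp: Z_def)
  qed
  \<comment> \<open>The zero set is closed under neighbours: it spreads from \<open>a\<close> down
    to the root 1 of the tree, and from there up to all vertices, including
    \<open>r\<close>.\<close>
  have "b \<in> Z \<Longrightarrow> 1 \<in> Z" for b
  proof (induction b rule: less_induct)
    case (less b)
    then have "b \<in> vertices X" by (auto simp: Z_def)
    then show ?case
      using less edge_below[OF fin, of b] nb[OF less.prems] by (cases "b = 1") auto
  qed
  then have "1 \<in> Z" using aZ by blast
  have "b \<in> vertices X \<longrightarrow> b \<in> Z" for b
  proof (induction b rule: less_induct)
    case (less b)
    then show ?case
      using \<open>1 \<in> Z\<close> edge_below[OF fin, of b] nb by (cases "b = 1") blast+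
  qed
  then show False using nb r by blast
qed

text \<open>\<open>vec m\<close> encodes a family \<open>m\<close> by the step function on the half line taking at \<open>x / 6\<close>
  the value \<open>\<Sum>\<^sub>a t\<^sub>a (\<Sum>\<^bsub>k > x t\<^sub>a / 6\<^esub> m (a,k)) \<alpha>\<^sub>a\<close>.\<close>
definition cum :: "(nat \<times> nat \<Rightarrow> real) \<Rightarrow> nat \<Rightarrow> nat \<Rightarrow> real" where
  "cum m a x = (\<Sum>k | m (a,k) \<noteq> 0 \<and> x < u a * k. m (a,k))"

definition vec :: "(nat \<times> nat \<Rightarrow> real) \<Rightarrow> nat \<Rightarrow> 'v" where
  "vec m x = (\<Sum>a\<in>vertices X. (tnum \<alpha> a * cum m a x) *\<^sub>R \<alpha> a)"

definition supported :: "(nat \<times> nat \<Rightarrow> real) \<Rightarrow> bool" where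
  "supported m \<longleftrightarrow> finite {y. m y \<noteq> 0} \<and> {y. m y \<noteq> 0} \<subseteq> all_indices X"

definition pairing :: "nat \<times> nat \<Rightarrow> nat \<times> nat \<Rightarrow> real" where
  "pairing x y = (\<alpha> (fst x) \<bullet> \<alpha> (fst y)) *
     min (tnum \<alpha> (fst y) * real (snd x)) (tnum \<alpha> (fst x) * real (snd y))"

definition bil :: "(nat \<times> nat \<Rightarrow> real) \<Rightarrow> (nat \<times> nat \<Rightarrow> real) \<Rightarrow> real" where
  "bil m n = (\<Sum>x | m x \<noteq> 0. \<Sum>y | n y \<noteq> 0. pairing x y * m x * n y)"

text \<open>The division by 6 undoes the scaling of positions: \<open>u a * i\<close> cells cover an
  interval of length \<open>i / t_a\<close>. The formula goes through \<open>vec\<close> because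
  gluing acts on step functions, whereas \<open>pairing_vec\<close> recovers the sum over
  entries.\<close>

definition pot :: "(nat \<times> nat \<Rightarrow> real) \<Rightarrow> nat \<Rightarrow> nat \<Rightarrow> real" where
  "pot m a i = - (tnum \<alpha> a / 6 * (\<Sum>z<u a * i. \<alpha> a \<bullet> vec m z))"

section \<open>Quadratic form, vacancy numbers and weight through step functions\<close>

lemma cum_eq:
  assumes "finite K" "{k. m (a,k) \<noteq> 0} \<subseteq> K"
  shows "cum m a x = (\<Sum>k\<in>K. if x < u a * k then m (a,k) else 0)"
  unfolding cum_def by (rule sum.mono_neutral_cong_left) (use assms in auto)

lemma vec_in_rspan: "vec m x \<in> rspan"
  unfolding vec_def by (intro span_sum span_scale root_in_rspan)

lemma vec_weight: "a \<in> vertices X \<Longrightarrow> vec m x \<bullet> \<Lambda> a = cum m a x"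
proof -
  assume a: "a \<in> vertices X"
  have "vec m x \<bullet> \<Lambda> a = (\<Sum>b\<in>vertices X. if b = a then cum m b x else 0)"
    unfolding vec_def inner_sum_left using a tnum_pos[OF a]
    by (intro sum.cong) (auto simp: root_weight)
  then show ?thesis using a by simp
qed

text \<open>A sum of indicator functions over any finite \<open>S\<close> containing the support;
  the freedom in \<open>S\<close> allows several families to share one index set.\<close>

lemma vec_eq:
  assumes "finite S" "{y. m y \<noteq> 0} \<subseteq> S" "S \<subseteq> all_indices X"
  shows "vec m x = (\<Sum>y\<in>S. if x < u (fst y) * snd y then (m y * tnum \<alpha> (fst y)) *\<^sub>R \<alpha> (fst y) else 0)"
proof -
  let ?K = "snd ` S"
  have fK: "finite ?K" using assms by simp
  have "cum m a x = (\<Sum>k\<in>?K. if x < u a * k then m (a,k) else 0)" for a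
    using assms by (intro cum_eq fK) force
  then have "vec m x = (\<Sum>a\<in>vertices X. \<Sum>k\<in>?K.
      if x < u a * k then (m (a,k) * tnum \<alpha> a) *\<^sub>R \<alpha> a else 0)"
    unfolding vec_def
    by (auto simp: scaleR_sum_left sum_distrib_left mult_ac intro!: sum.cong)
  also have "\<dots> = (\<Sum>y\<in>vertices X \<times> ?K.
      if x < u (fst y) * snd y then (m y * tnum \<alpha> (fst y)) *\<^sub>R \<alpha> (fst y) else 0)"
    unfolding sum.cartesian_product by (intro sum.cong) auto
  also have "\<dots> = (\<Sum>y\<in>S. if x < u (fst y) * snd y then (m y * tnum \<alpha> (fst y)) *\<^sub>R \<alpha> (fst y) else 0)"
    by (rule sum.mono_neutral_right) (use assms fK in \<open>force simp: all_indices_def\<close>)+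
  finally show ?thesis .
qed

lemma vec_eventually_0:
  assumes "finite {y. m y \<noteq> 0}"
  obtains M where "\<And>z. z \<ge> M \<Longrightarrow> vec m z = 0"
    "\<And>y. m y \<noteq> 0 \<Longrightarrow> u (fst y) * snd y \<le> M"
proof -
  define M where "M = Max (insert 0 ((\<lambda>y. u (fst y) * snd y) ` {y. m y \<noteq> 0}))"
  have M: "u (fst y) * snd y \<le> M" if "m y \<noteq> 0" for y
    unfolding M_def using that assms by (intro Max_ge) auto
  have "cum m a z = 0" if "z \<ge> M" for a z
  proof -
    have "{k. m (a,k) \<noteq> 0 \<and> z < u a * k} = {}" using M[of "(a,_)"] that by force
    then show ?thesis unfolding cum_def by (metis sum.empty)
  qed
  then have "vec m z = 0" if "z \<ge> M" for z using that by (simp add: vec_def)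
  then show ?thesis using that M by blast
qed

lemma pairing_vec:
  assumes m: "supported m" and a: "a \<in> vertices X"
  shows "(\<Sum>y | m y \<noteq> 0. pairing (a,i) y * m y) = - pot m a i"
proof -
  let ?S = "{y. m y \<noteq> 0}"
  have S: "finite ?S" "?S \<subseteq> all_indices X" using m by (auto simp: supported_def)
  have "(\<Sum>z<u a * i. \<alpha> a \<bullet> vec m z) = (\<Sum>z<u a * i. \<Sum>y\<in>?S.
      if z < u (fst y) * snd y then m y * tnum \<alpha> (fst y) * (\<alpha> a \<bullet> \<alpha> (fst y)) else 0)"
    by (subst vec_eq[OF S(1) order_refl S(2)])
      (auto simp: inner_sum_right intro!: sum.cong)
  also have "\<dots> = (\<Sum>y\<in>?S. \<Sum>z<u a * i.
      if z < u (fst y) * snd y then m y * tnum \<alpha> (fst y) * (\<alpha> a \<bullet> \<alpha> (fst y)) else 0)"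
    by (rule sum.swap)
  also have "\<dots> = (\<Sum>y\<in>?S. real (min (u a * i) (u (fst y) * snd y)) *
      (m y * tnum \<alpha> (fst y) * (\<alpha> a \<bullet> \<alpha> (fst y))))"
    by (simp add: sum_below_min)
  finally have "- pot m a i = (\<Sum>y\<in>?S. tnum \<alpha> a / 6 * (real (min (u a * i) (u (fst y) * snd y)) *
      (m y * tnum \<alpha> (fst y) * (\<alpha> a \<bullet> \<alpha> (fst y)))))"
    by (simp add: pot_def sum_distrib_left)
  also have "\<dots> = (\<Sum>y\<in>?S. pairing (a,i) y * m y)"
  proof (rule sum.cong[OF refl])
    fix y assume "y \<in> ?S"
    then have b: "fst y \<in> vertices X" using S by (auto simp: all_indices_def)
    let ?t = "tnum \<alpha> a" and ?t' = "tnum \<alpha> (fst y)"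
    have pos: "?t > 0" "?t' > 0" using tnum_pos a b by auto
    \<comment> \<open>Since \<open>u a = 6 / t_a\<close>, scaling the overlap in cells by
      \<open>t_a t_b / 6\<close> turns it into \<open>min (t_b i) (t_a k)\<close>.\<close>
    have "?t * ?t' / 6 * real (min (u a * i) (u (fst y) * snd y))
        = min (?t * ?t' / 6 * (6 / ?t * real i)) (?t * ?t' / 6 * (6 / ?t' * real (snd y)))"
      unfolding of_nat_min of_nat_mult real_u[OF a] real_u[OF b]
      using pos by (simp only: min_mult_distrib_left) simp
    also have "\<dots> = min (?t' * real i) (?t * real (snd y))"
      using pos by simp
    finally show "?t / 6 * (real (min (u a * i) (u (fst y) * snd y)) *
      (m y * ?t' * (\<alpha> a \<bullet> \<alpha> (fst y)))) = pairing (a,i) y * m y"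
      by (simp add: pairing_def mult_ac)
  qed
  finally show ?thesis by simp
qed

lemma bil_pot:
  assumes "supported m" "supported n"
  shows "bil m n = - (\<Sum>x | m x \<noteq> 0. m x * pot n (fst x) (snd x))"
proof -
  have "bil m n = (\<Sum>x | m x \<noteq> 0. m x * (\<Sum>y | n y \<noteq> 0. pairing (fst x, snd x) y * n y))"
    unfolding bil_def by (simp add: sum_distrib_left mult_ac)
  also have "\<dots> = (\<Sum>x | m x \<noteq> 0. m x * (- pot n (fst x) (snd x)))"
  proof (rule sum.cong[OF refl])
    fix x assume "x \<in> {x. m x \<noteq> 0}"
    then have "fst x \<in> vertices X" using assms by (auto simp: supported_def all_indices_def)
    then show "m x * (\<Sum>y | n y \<noteq> 0. pairing (fst x, snd x) y * n y) = m x * (- pot n (fst x) (snd x))"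
      using pairing_vec[OF assms(2), of "fst x" "snd x"] by (simp only:)
  qed
  finally show ?thesis by (simp add: sum_negf)
qed

text \<open>Each entry of \<open>m\<close> is paired with the integral of the step function of
  \<open>n\<close> over an initial interval; summing the corresponding indicators rebuilds the step
  function of \<open>m\<close>. The cutoff only has to lie beyond the overlap of the two
  functions.\<close>

lemma bil_vec:
  assumes m: "supported m" and n: "supported n"
    and M: "\<And>z. z \<ge> M \<Longrightarrow> vec m z \<bullet> vec n z = 0"
  shows "bil m n = 1/6 * (\<Sum>z<M. vec m z \<bullet> vec n z)"
proof -
  let ?S = "{y. m y \<noteq> 0}"
  have S: "finite ?S" "?S \<subseteq> all_indices X" using m by (auto simp: supported_def)
  obtain N where N: "\<And>z. z \<ge> N \<Longrightarrow> vec m z = 0" "\<And>y. m y \<noteq> 0 \<Longrightarrow> u (fst y) * snd y \<le> N"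
    using vec_eventually_0[OF S(1)] by blast
  have "(\<Sum>z<N. vec m z \<bullet> vec n z) = (\<Sum>z<N. \<Sum>y\<in>?S.
      if z < u (fst y) * snd y then m y * tnum \<alpha> (fst y) * (\<alpha> (fst y) \<bullet> vec n z) else 0)"
    by (subst vec_eq[OF S(1) order_refl S(2)])
      (auto simp: inner_sum_left intro!: sum.cong)
  also have "\<dots> = (\<Sum>y\<in>?S. \<Sum>z<N.
      if z < u (fst y) * snd y then m y * tnum \<alpha> (fst y) * (\<alpha> (fst y) \<bullet> vec n z) else 0)"
    by (rule sum.swap)
  also have "\<dots> = (\<Sum>y\<in>?S. m y * (- 6 * pot n (fst y) (snd y)))"
  proof (rule sum.cong[OF refl])
    fix y assume "y \<in> ?S"
    then have "(\<Sum>z<N. if z < u (fst y) * snd y then m y * tnum \<alpha> (fst y) * (\<alpha> (fst y) \<bullet> vec n z) else 0)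
        = (\<Sum>z<u (fst y) * snd y. m y * tnum \<alpha> (fst y) * (\<alpha> (fst y) \<bullet> vec n z))"
      using N(2)[of y] by (intro sum.mono_neutral_cong_right) auto
    also have "\<dots> = m y * tnum \<alpha> (fst y) * (\<Sum>z<u (fst y) * snd y. \<alpha> (fst y) \<bullet> vec n z)"
      by (rule sum_distrib_left[symmetric])
    finally show "(\<Sum>z<N. if z < u (fst y) * snd y then m y * tnum \<alpha> (fst y) * (\<alpha> (fst y) \<bullet> vec n z) else 0)
        = m y * (- 6 * pot n (fst y) (snd y))"
      by (simp add: pot_def)
  qed
  finally have "1/6 * (\<Sum>z<N. vec m z \<bullet> vec n z) = bil m n"
    by (simp add: bil_pot[OF m n] sum_distrib_left sum_negf)
  moreover have "(\<Sum>z<M. vec m z \<bullet> vec n z) = (\<Sum>z<N. vec m z \<bullet> vec n z)"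
    by (rule sum_trunc) (use M N in auto)
  ultimately show ?thesis by simp
qed

text \<open>An entry at \<open>(a,k)\<close> is a block of height \<open>t_a \<alpha> a\<close> and
  length \<open>k / t_a\<close>, so its area is \<open>k \<alpha> a\<close>.\<close>

lemma weight_vec:
  assumes m: "supported m" and M: "\<And>z. z \<ge> M \<Longrightarrow> vec m z = 0"
  shows "(\<Sum>y | m y \<noteq> 0. (real (snd y) * m y) *\<^sub>R \<alpha> (fst y)) = (1/6) *\<^sub>R (\<Sum>z<M. vec m z)"
proof -
  let ?S = "{y. m y \<noteq> 0}"
  have S: "finite ?S" "?S \<subseteq> all_indices X" using m by (auto simp: supported_def)
  obtain N where N: "\<And>z. z \<ge> N \<Longrightarrow> vec m z = 0" "\<And>y. m y \<noteq> 0 \<Longrightarrow> u (fst y) * snd y \<le> N"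
    using vec_eventually_0[OF S(1)] by blast
  have "(\<Sum>z<N. vec m z) = (\<Sum>y\<in>?S. \<Sum>z<N.
      if z < u (fst y) * snd y then (m y * tnum \<alpha> (fst y)) *\<^sub>R \<alpha> (fst y) else 0)"
    by (subst vec_eq[OF S(1) order_refl S(2)]) (rule sum.swap)
  also have "\<dots> = (\<Sum>y\<in>?S. 6 *\<^sub>R ((real (snd y) * m y) *\<^sub>R \<alpha> (fst y)))"
  proof (rule sum.cong[OF refl])
    fix y assume y: "y \<in> ?S"
    then have "fst y \<in> vertices X" using S by (auto simp: all_indices_def)
    then have "real (u (fst y)) * tnum \<alpha> (fst y) = 6"
      using real_u[of "fst y"] tnum_pos[of "fst y"] by simp
    then have "real (u (fst y)) * real (snd y) * (m y * tnum \<alpha> (fst y)) = 6 * (real (snd y) * m y)"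
      by (metis mult.assoc mult.commute)
    then show "(\<Sum>z<N. if z < u (fst y) * snd y then (m y * tnum \<alpha> (fst y)) *\<^sub>R \<alpha> (fst y) else 0)
        = 6 *\<^sub>R ((real (snd y) * m y) *\<^sub>R \<alpha> (fst y))"
      using N(2)[of y] y by (simp add: sum_below_min min_absorb2)
  qed
  finally have "(\<Sum>y | m y \<noteq> 0. (real (snd y) * m y) *\<^sub>R \<alpha> (fst y)) = (1/6) *\<^sub>R (\<Sum>z<N. vec m z)"
    by (simp add: scaleR_sum_right)
  moreover have "(\<Sum>z<M. vec m z) = (\<Sum>z<N. vec m z)"
    by (rule sum_trunc) (use M N in auto)
  ultimately show ?thesis by simp
qed

lemma vec_add:
  assumes "supported m" "supported n"
  shows "vec (\<lambda>y. m y + n y) x = vec m x + vec n x"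
proof -
  let ?S = "{y. m y \<noteq> 0} \<union> {y. n y \<noteq> 0}"
  have S: "finite ?S" "?S \<subseteq> all_indices X" using assms by (auto simp: supported_def)
  \<comment> \<open>Entries may cancel in the sum, so all three families are expanded over the union
    of the two supports.\<close>
  have "vec f x = (\<Sum>y\<in>?S. if x < u (fst y) * snd y then (f y * tnum \<alpha> (fst y)) *\<^sub>R \<alpha> (fst y) else 0)"
    if "f \<in> {m, n, \<lambda>y. m y + n y}" for f
    by (rule vec_eq) (use S that in auto)
  then show ?thesis
    by (auto simp: sum.distrib[symmetric] distrib_right scaleR_add_left intro!: sum.cong)
qed

lemma supported_add:
  assumes "supported m" "supported n"
  shows "supported (\<lambda>y. m y + n y)"
proof -
  have "{y. m y + n y \<noteq> 0} \<subseteq> {y. m y \<noteq> 0} \<union> {y. n y \<noteq> 0}" by auto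
  then show ?thesis
    using assms unfolding supported_def by (meson Un_least finite_UnI finite_subset subset_trans)
qed

end

section \<open>Fermionic forms in terms of step functions\<close>

lemma of_int_floor_Ints: "x \<in> \<int> \<Longrightarrow> of_int \<lfloor>x\<rfloor> = x"
  by (elim Ints_cases) simp

lemma power_int_inverse_left: "inverse x powi n = (x :: 'a::field) powi (- n)"
  by (simp add: power_int_inverse power_int_minus)

lemma power_int_prod:
  fixes x :: "'a::field"
  assumes "x \<noteq> 0"
  shows "(\<Prod>i\<in>A. x powi f i) = x powi (\<Sum>i\<in>A. f i)"
  by (induction A rule: infinite_finite_induct) (use assms in \<open>auto simp: power_int_add\<close>)

text \<open>On the support both factors of \<open>snd y * m y\<close> are at least 1, so one bound
  limits positions and multiplicities together.\<close>

lemma finite_bounded_families: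
  "finite {m :: nat \<times> nat \<Rightarrow> nat. finite {y. m y \<noteq> 0} \<and> {y. m y \<noteq> 0} \<subseteq> all_indices X \<and>
      (\<forall>y. snd y * m y \<le> C)}"
proof (rule finite_subset)
  let ?B = "vertices X \<times> {1..C}"
  show "{m :: nat \<times> nat \<Rightarrow> nat. finite {y. m y \<noteq> 0} \<and> {y. m y \<noteq> 0} \<subseteq> all_indices X \<and>
      (\<forall>y. snd y * m y \<le> C)} \<subseteq> {f. \<forall>y. (y \<in> ?B \<longrightarrow> f y \<in> {..C}) \<and> (y \<notin> ?B \<longrightarrow> f y = 0)}"
  proof (intro subsetI CollectI allI)
    fix m :: "nat \<times> nat \<Rightarrow> nat" and y
    assume "m \<in> {m. finite {y. m y \<noteq> 0} \<and> {y. m y \<noteq> 0} \<subseteq> all_indices X \<and> (\<forall>y. snd y * m y \<le> C)}"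
    then have m: "{y. m y \<noteq> 0} \<subseteq> all_indices X" "snd y * m y \<le> C" by blast+
    show "(y \<in> ?B \<longrightarrow> m y \<in> {..C}) \<and> (y \<notin> ?B \<longrightarrow> m y = 0)"
    proof (cases "m y = 0")
      case False
      then have y: "fst y \<in> vertices X" "1 \<le> snd y" using m(1) by (auto simp: all_indices_def)
      have "1 * m y \<le> snd y * m y" "snd y * 1 \<le> snd y * m y"
        using y False by (intro mult_le_mono; simp)+
      then have "m y \<le> C" "snd y \<le> C" using m(2) by linarith+
      then show ?thesis using y by (auto simp: mem_Times_iff)
    qed auto
  qed
  show "finite {f. \<forall>y. (y \<in> ?B \<longrightarrow> f y \<in> {..C}) \<and> (y \<notin> ?B \<longrightarrow> f y = (0::nat))}"
    by (rule finite_set_of_finite_funs) auto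
qed

context root_data
begin

definition wt :: "(nat \<times> nat \<Rightarrow> real) \<Rightarrow> 'v" where
  "wt m = (\<Sum>y | m y \<noteq> 0. (real (snd y) * m y) *\<^sub>R \<alpha> (fst y))"

text \<open>The same numbers are the constant part of the vacancy numbers and the coefficients of
  the linear part of the charge (\<open>vacancy_eq\<close>, \<open>charge_eq\<close>); both square
  completions below depend on this coincidence.\<close>

definition source :: "(nat \<times> nat) set \<Rightarrow> (nat \<times> nat \<Rightarrow> nat) \<Rightarrow> nat \<Rightarrow> nat \<Rightarrow> real" where
  "source H \<nu> a i = (\<Sum>j | (a,j) \<in> supp H \<nu>. real (\<nu> (a,j)) * min (real i) (real j))"

lemma supp_eq: "{y. m y \<noteq> 0} \<subseteq> H \<Longrightarrow> supp H m = {y. m y \<noteq> 0}"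
  by (auto simp: supp_def)

lemma supportedD:
  assumes "supported m"
  shows "finite {y. m y \<noteq> 0}" "{y. m y \<noteq> 0} \<subseteq> all_indices X"
    and "m y \<noteq> 0 \<Longrightarrow> fst y \<in> vertices X" "m y \<noteq> 0 \<Longrightarrow> 1 \<le> snd y"
  using assms by (auto simp: supported_def all_indices_def)

lemma supported_bound:
  assumes "supported m"
  shows "\<exists>M. \<forall>z\<ge>M. vec m z = 0"
proof -
  obtain M where "\<And>z. z \<ge> M \<Longrightarrow> vec m z = 0" "\<And>y. m y \<noteq> 0 \<Longrightarrow> u (fst y) * snd y \<le> M"
    using vec_eventually_0[OF supportedD(1)[OF assms]] by blast
  then show ?thesis by blast
qed

lemma vacancy_eq:
  assumes "supported m" "{y. m y \<noteq> 0} \<subseteq> H" "a \<in> vertices X"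
  shows "vacancy \<alpha> H \<nu> m a i = source H \<nu> a i + pot m a i"
  using pairing_vec[OF assms(1,3), of i]
  by (simp add: vacancy_def source_def supp_eq[OF assms(2)] pairing_def case_prod_beta)

lemma charge_eq:
  assumes "{y. m y \<noteq> 0} \<subseteq> H" "finite {y. m y \<noteq> 0}" "finite (supp H \<nu>)"
  shows "charge \<alpha> H \<nu> m = 1/2 * bil m m - (\<Sum>y | m y \<noteq> 0. source H \<nu> (fst y) (snd y) * m y)"
proof -
  let ?S = "{y. m y \<noteq> 0}" and ?T = "supp H \<nu>"
  define g where "g x y = (if fst x = fst y then
      real (\<nu> x) * min (real (snd x)) (real (snd y)) * m y else 0)" for x y :: "nat \<times> nat"
  have "(\<Sum>(a,j)\<in>?T. \<Sum>k | (a,k) \<in> supp H m. real (\<nu> (a,j)) * min (real j) (real k) * m (a,k))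
      = (\<Sum>x\<in>?T. \<Sum>y\<in>?S. g x y)"
  proof (rule sum.cong[OF refl], unfold case_prod_beta)
    fix x assume "x \<in> ?T"
    have "(\<Sum>y\<in>?S. g x y) = (\<Sum>y\<in>{y\<in>?S. fst y = fst x}. g x y)"
      by (rule sum.mono_neutral_right) (use assms in \<open>auto simp: g_def\<close>)
    also have "\<dots> = (\<Sum>k | (fst x,k) \<in> ?S. g x (fst x, k))"
      by (rule sum.reindex_bij_witness[of _ "\<lambda>k. (fst x, k)" snd]) auto
    finally show "(\<Sum>k | (fst x,k) \<in> supp H m.
        real (\<nu> (fst x, snd x)) * min (real (snd x)) (real k) * m (fst x, k)) = (\<Sum>y\<in>?S. g x y)"
      by (simp add: supp_eq[OF assms(1)] g_def)
  qed
  also have "\<dots> = (\<Sum>y\<in>?S. \<Sum>x\<in>?T. g x y)" by (rule sum.swap)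
  also have "\<dots> = (\<Sum>y\<in>?S. source H \<nu> (fst y) (snd y) * m y)"
  proof (rule sum.cong[OF refl])
    fix y assume "y \<in> ?S"
    have "(\<Sum>x\<in>?T. g x y) = (\<Sum>x\<in>{x\<in>?T. fst x = fst y}. g x y)"
      by (rule sum.mono_neutral_right) (use assms in \<open>auto simp: g_def\<close>)
    also have "\<dots> = (\<Sum>j | (fst y,j) \<in> ?T. g (fst y, j) y)"
      by (rule sum.reindex_bij_witness[of _ "\<lambda>j. (fst y, j)" snd]) auto
    finally show "(\<Sum>x\<in>?T. g x y) = source H \<nu> (fst y) (snd y) * m y"
      by (simp add: source_def g_def sum_distrib_right min.commute)
  qed
  finally show ?thesis
    by (simp add: charge_def supp_eq[OF assms(1)] bil_def pairing_def case_prod_beta)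
qed

lemma bil_nonneg: "supported m \<Longrightarrow> bil m m \<ge> 0"
proof -
  assume m: "supported m"
  then obtain M where "\<forall>z\<ge>M. vec m z = 0"
    using supported_bound by blast
  then have "bil m m = 1/6 * (\<Sum>z<M. vec m z \<bullet> vec m z)"
    using m by (intro bil_vec) auto
  moreover have "(\<Sum>z<M. vec m z \<bullet> vec m z) \<ge> 0" by (intro sum_nonneg) simp
  ultimately show ?thesis by linarith
qed

text \<open>Pairing the vacancy numbers with \<open>m\<close> gives the linear part of the charge
  minus \<open>bil m m\<close>. The linear parts cancel, and the coefficient 1/2 of the norm becomes
  -1/2.\<close>

lemma charge_plus_vacancies:
  assumes m: "supported m" "{y. m y \<noteq> 0} \<subseteq> H" and \<nu>: "finite (supp H \<nu>)"
  shows "charge \<alpha> H \<nu> m + (\<Sum>y | m y \<noteq> 0. m y * vacancy \<alpha> H \<nu> m (fst y) (snd y)) = - (1/2 * bil m m)"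
proof -
  have "(\<Sum>y | m y \<noteq> 0. m y * vacancy \<alpha> H \<nu> m (fst y) (snd y))
      = (\<Sum>y | m y \<noteq> 0. m y * (source H \<nu> (fst y) (snd y) + pot m (fst y) (snd y)))"
  proof (rule sum.cong[OF refl])
    fix y assume "y \<in> {y. m y \<noteq> 0}"
    then have "fst y \<in> vertices X" using supportedD(3)[OF m(1)] by blast
    then show "m y * vacancy \<alpha> H \<nu> m (fst y) (snd y)
        = m y * (source H \<nu> (fst y) (snd y) + pot m (fst y) (snd y))"
      by (simp only: vacancy_eq[OF m])
  qed
  also have "\<dots> = (\<Sum>y | m y \<noteq> 0. source H \<nu> (fst y) (snd y) * m y) - bil m m"
    by (simp add: bil_pot[OF m(1) m(1)] distrib_left sum.distrib mult_ac)
  finally show ?thesis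
    using charge_eq[OF m(2) _ \<nu>] m(1) by (simp add: supported_def)
qed

text \<open>Half the norm is the charge for \<open>\<nu> = 0\<close>, so integrality of charges
  applies.\<close>

lemma half_bil_Ints:
  assumes "supported (real \<circ> m)"
  shows "1/2 * bil (real \<circ> m) (real \<circ> m) \<in> \<int>"
proof -
  have s: "finite {y. m y \<noteq> 0}" "{y. (real \<circ> m) y \<noteq> 0} \<subseteq> all_indices X"
    using assms by (simp_all add: supported_def)
  have "charge \<alpha> (all_indices X) (\<lambda>_. 0) (real \<circ> m) \<in> \<int>"
    using charge_Ints[OF sr order_refl s(1)] .
  moreover have "charge \<alpha> (all_indices X) (\<lambda>_. 0) (real \<circ> m) = 1/2 * bil (real \<circ> m) (real \<circ> m)"
    using s by (subst charge_eq) (simp_all add: supp_def source_def)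
  ultimately show ?thesis by simp
qed

lemma summand_inverse_q:
  assumes m: "supported (real \<circ> m)" "{y. m y \<noteq> 0} \<subseteq> H" and H: "H \<subseteq> all_indices X"
    and \<nu>: "finite (supp H \<nu>)"
    and vac: "\<And>a i. (a,i) \<in> H \<Longrightarrow> vacancy \<alpha> H \<nu> (real \<circ> m) a i \<ge> 0"
  shows "(inverse fls_X :: 'a::field fls) powi \<lfloor>charge \<alpha> H \<nu> (real \<circ> m)\<rfloor> *
        (\<Prod>(a,i)\<in>supp H m. qbinom (inverse fls_X) \<lfloor>vacancy \<alpha> H \<nu> (real \<circ> m) a i\<rfloor> (m (a,i)))
      = fps_to_fls (fps_X ^ nat \<lfloor>1/2 * bil (real \<circ> m) (real \<circ> m)\<rfloor> *
          (\<Prod>y | m y \<noteq> 0. qbinom_fps (nat \<lfloor>vacancy \<alpha> H \<nu> (real \<circ> m) (fst y) (snd y)\<rfloor>) (m y)))"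
proof -
  let ?S = "{y. m y \<noteq> 0}" and ?q = "fls_X :: 'a fls"
  have S: "finite ?S" "?S \<subseteq> all_indices X" using m by (auto simp: supported_def)
  define c where "c = \<lfloor>charge \<alpha> H \<nu> (real \<circ> m)\<rfloor>"
  define p where "p y = \<lfloor>vacancy \<alpha> H \<nu> (real \<circ> m) (fst y) (snd y)\<rfloor>" for y
  define Q where "Q = nat \<lfloor>1/2 * bil (real \<circ> m) (real \<circ> m)\<rfloor>"
  have c: "of_int c = charge \<alpha> H \<nu> (real \<circ> m)"
    unfolding c_def using charge_Ints[OF sr H S(1)] by (rule of_int_floor_Ints)
  have p: "of_int (p y) = vacancy \<alpha> H \<nu> (real \<circ> m) (fst y) (snd y)" if "y \<in> ?S" for y
    unfolding p_def using vacancy_Ints[OF sr H, of "fst y" \<nu> m "snd y"] that supportedD(3)[OF m(1), of y]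
    by (intro of_int_floor_Ints) simp
  have p0: "p y \<ge> 0" if "y \<in> ?S" for y
    using vac[of "fst y" "snd y"] that m(2) by (auto simp: p_def)
  have Q: "real Q = 1/2 * bil (real \<circ> m) (real \<circ> m)"
    using of_int_floor_Ints[OF half_bil_Ints[OF m(1)]] bil_nonneg[OF m(1)] by (simp add: Q_def)
  have "real_of_int (c + (\<Sum>y\<in>?S. p y * int (m y))) = - real Q"
    using charge_plus_vacancies[OF m(1) _ \<nu>] m(2) by (simp add: c p Q mult.commute)
  \<comment> \<open>The total exponent after inverting \<open>q\<close>: minus the charge from the
    prefactor and \<open>- p * m\<close> from every binomial. It is nonnegative, so the summand is a
    power series.\<close>
  then have cpQ: "int Q = - c + (\<Sum>y\<in>?S. - p y * int (m y))"
    by (simp only: mult_minus_left sum_negf)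
  have "(\<Prod>(a,i)\<in>supp H m. qbinom (inverse ?q) \<lfloor>vacancy \<alpha> H \<nu> (real \<circ> m) a i\<rfloor> (m (a,i)))
      = (\<Prod>y\<in>?S. ?q powi (- p y * int (m y)) * qbinom ?q (p y) (m y))"
    unfolding supp_eq[OF m(2)]
  proof (rule prod.cong[OF refl])
    fix y
    show "(case y of (a,i) \<Rightarrow> qbinom (inverse ?q) \<lfloor>vacancy \<alpha> H \<nu> (real \<circ> m) a i\<rfloor> (m (a,i)))
        = ?q powi (- p y * int (m y)) * qbinom ?q (p y) (m y)"
      by (cases y) (simp only: prod.case p_def fst_conv snd_conv qbinom_inverse[OF fls_X_nonzero])
  qed
  then have "inverse ?q powi c * (\<Prod>(a,i)\<in>supp H m. qbinom (inverse ?q) \<lfloor>vacancy \<alpha> H \<nu> (real \<circ> m) a i\<rfloor> (m (a,i)))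
      = ?q powi (- c) * (\<Prod>y\<in>?S. ?q powi (- p y * int (m y)) * qbinom ?q (p y) (m y))"
    by (simp only: power_int_inverse_left)
  also have "\<dots> = ?q powi (- c + (\<Sum>y\<in>?S. - p y * int (m y))) * (\<Prod>y\<in>?S. qbinom ?q (p y) (m y))"
    unfolding prod.distrib power_int_prod[OF fls_X_nonzero]
    by (subst power_int_add[OF disjI1[OF fls_X_nonzero]]) (rule mult.assoc[symmetric])
  also have "\<dots> = ?q ^ Q * (\<Prod>y\<in>?S. qbinom ?q (int (nat (p y))) (m y))"
    using p0 by (simp only: cpQ[symmetric] power_int_of_nat) simp
  also have "\<dots> = fps_to_fls (fps_X ^ Q * (\<Prod>y\<in>?S. qbinom_fps (nat (p y)) (m y)))"
    by (simp only: qbinom_fls_X fls_times_fps_to_fls fps_to_fls_power fps_X_to_fls fps_to_fls_prod)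
  finally show ?thesis by (simp add: c_def p_def Q_def case_prod_beta)
qed

lemma sum_indicator_eq_cum:
  assumes "finite {y. m y \<noteq> 0}"
  shows "\<exists>M. (\<forall>z\<ge>M. vec m z = 0) \<and>
    (\<forall>a. (\<Sum>z<M. cum m a z) = (\<Sum>k | m (a,k) \<noteq> 0. real (u a * k) * m (a,k)))"
proof -
  obtain M where M: "\<And>z. z \<ge> M \<Longrightarrow> vec m z = 0" "\<And>y. m y \<noteq> 0 \<Longrightarrow> u (fst y) * snd y \<le> M"
    using vec_eventually_0[OF assms] by blast
  have "(\<Sum>z<M. cum m a z) = (\<Sum>k | m (a,k) \<noteq> 0. real (u a * k) * m (a,k))" for a
  proof -
    have "(\<Sum>z<M. cum m a z) = (\<Sum>z<M. \<Sum>k | m (a,k) \<noteq> 0. if z < u a * k then m (a,k) else 0)"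
      by (subst cum_eq[OF finite_slice[OF assms] order_refl]) simp
    also have "\<dots> = (\<Sum>k | m (a,k) \<noteq> 0. \<Sum>z<M. if z < u a * k then m (a,k) else 0)"
      by (rule sum.swap)
    also have "\<dots> = (\<Sum>k | m (a,k) \<noteq> 0. real (u a * k) * m (a,k))"
      using M(2)[of "(a,_)"] by (intro sum.cong) (auto simp: sum_below_min min_absorb2)
    finally show ?thesis .
  qed
  then show ?thesis using M(1) by blast
qed

section \<open>Finiteness of sets of configurations\<close>

lemma cum_nat:
  assumes "finite {y. (m :: nat \<times> nat \<Rightarrow> nat) y \<noteq> 0}"
  shows "\<exists>n::nat. cum (real \<circ> m) a z = real n"
proof -
  have "cum (real \<circ> m) a z = real (\<Sum>k | m (a,k) \<noteq> 0 \<and> z < u a * k. m (a,k))"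
    by (simp add: cum_def)
  then show ?thesis by blast
qed

text \<open>By Cauchy--Schwarz against \<open>\<Lambda> a\<close>, and because \<open>k \<le> k\<^sup>2\<close> for natural numbers.\<close>
lemma linear_bound:
  assumes m: "supported (real \<circ> m)" and a: "a \<in> vertices X"
  shows "(\<Sum>k | m (a,k) \<noteq> 0. real (k * m (a,k))) \<le> 6 * (\<Lambda> a \<bullet> \<Lambda> a) * bil (real \<circ> m) (real \<circ> m)"
proof -
  have f: "finite {y. m y \<noteq> 0}" "finite {y. (real \<circ> m) y \<noteq> 0}"
    using m by (auto simp: supported_def)
  obtain M where M: "\<forall>z\<ge>M. vec (real \<circ> m) z = 0"
    and M2: "\<forall>a. (\<Sum>z<M. cum (real \<circ> m) a z)
      = (\<Sum>k | (real \<circ> m) (a,k) \<noteq> 0. real (u a * k) * (real \<circ> m) (a,k))"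
    using sum_indicator_eq_cum[OF f(2)] by blast
  have "cum (real \<circ> m) a z \<le> (vec (real \<circ> m) z \<bullet> vec (real \<circ> m) z) * (\<Lambda> a \<bullet> \<Lambda> a)" for z
  proof -
    obtain n where n: "cum (real \<circ> m) a z = real n" using cum_nat[OF f(1)] by blast
    have "real n \<le> real n ^ 2" by (cases n) (auto simp: power2_eq_square)
    also have "\<dots> = (vec (real \<circ> m) z \<bullet> \<Lambda> a)\<^sup>2" by (simp add: vec_weight[OF a] n)
    also have "\<dots> \<le> (vec (real \<circ> m) z \<bullet> vec (real \<circ> m) z) * (\<Lambda> a \<bullet> \<Lambda> a)"
      by (rule Cauchy_Schwarz_ineq)
    finally show ?thesis by (simp add: n)
  qed
  then have "(\<Sum>z<M. cum (real \<circ> m) a z)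
      \<le> (\<Sum>z<M. (vec (real \<circ> m) z \<bullet> vec (real \<circ> m) z) * (\<Lambda> a \<bullet> \<Lambda> a))"
    by (intro sum_mono)
  also have "\<dots> = 6 * (\<Lambda> a \<bullet> \<Lambda> a) * bil (real \<circ> m) (real \<circ> m)"
    using bil_vec[OF m m, of M] M by (simp flip: sum_distrib_right)
  finally have "(\<Sum>k | m (a,k) \<noteq> 0. real (u a * k * m (a,k))) \<le> 6 * (\<Lambda> a \<bullet> \<Lambda> a) * bil (real \<circ> m) (real \<circ> m)"
    using M2 by simp
  moreover have "(\<Sum>k | m (a,k) \<noteq> 0. real (k * m (a,k))) \<le> (\<Sum>k | m (a,k) \<noteq> 0. real (u a * k * m (a,k)))"
    using u_pos[OF a] by (intro sum_mono) (simp del: of_nat_mult)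
  ultimately show ?thesis by linarith
qed

lemma single_le_sum:
  assumes "supported (real \<circ> m)"
  shows "real (k * m (a,k)) \<le> (\<Sum>k | m (a,k) \<noteq> 0. real (k * m (a,k)))"
proof (cases "m (a,k) = 0")
  case False
  have "finite {k. m (a,k) \<noteq> 0}"
    using assms finite_slice[of m a] by (auto simp: supported_def)
  then show ?thesis using False by (intro member_le_sum) auto
qed (simp add: sum_nonneg)

lemma finite_families:
  assumes C: "\<And>m a. m \<in> A \<Longrightarrow> a \<in> vertices X \<Longrightarrow> (\<Sum>k | m (a,k) \<noteq> 0. real (k * m (a,k))) \<le> C a"
    and A: "\<And>m. m \<in> A \<Longrightarrow> supported (real \<circ> m)"
  shows "finite (A :: (nat \<times> nat \<Rightarrow> nat) set)"
proof (rule finite_subset[OF _ finite_bounded_families])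
  define D where "D = nat \<lceil>Max (insert 0 (C ` vertices X))\<rceil>"
  have D: "C a \<le> real D" if "a \<in> vertices X" for a
  proof -
    have "C a \<le> Max (insert 0 (C ` vertices X))" using that by (intro Max_ge) auto
    also have "\<dots> \<le> real D" unfolding D_def by (rule real_nat_ceiling_ge)
    finally show ?thesis .
  qed
  show "A \<subseteq> {m. finite {y. m y \<noteq> 0} \<and> {y. m y \<noteq> 0} \<subseteq> all_indices X \<and> (\<forall>y. snd y * m y \<le> D)}"
  proof
    fix m assume m: "m \<in> A"
    have "snd y * m y \<le> D" for y
    proof (cases "m y = 0")
      case False
      then have "fst y \<in> vertices X" using A[OF m] by (auto simp: supported_def all_indices_def)
      then have "real (snd y * m (fst y, snd y)) \<le> real D"
        using single_le_sum[OF A[OF m], of "snd y" "fst y"] C[OF m, of "fst y"] D[of "fst y"] by linarith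
      then show ?thesis by (simp only: of_nat_le_iff prod.collapse)
    qed auto
    then show "m \<in> {m. finite {y. m y \<noteq> 0} \<and> {y. m y \<noteq> 0} \<subseteq> all_indices X \<and> (\<forall>y. snd y * m y \<le> D)}"
      using A[OF m] unfolding supported_def mem_Collect_eq o_apply of_nat_eq_0_iff by blast
  qed
qed

lemma finite_bil_bounded:
  "finite {m. supported (real \<circ> m) \<and> bil (real \<circ> m) (real \<circ> m) \<le> B}"
proof (rule finite_families)
  fix m a assume m: "m \<in> {m. supported (real \<circ> m) \<and> bil (real \<circ> m) (real \<circ> m) \<le> B}"
    and a: "a \<in> vertices X"
  then have "6 * (\<Lambda> a \<bullet> \<Lambda> a) * bil (real \<circ> m) (real \<circ> m) \<le> 6 * (\<Lambda> a \<bullet> \<Lambda> a) * B"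
    by (intro mult_left_mono) auto
  then show "(\<Sum>k | m (a,k) \<noteq> 0. real (k * m (a,k))) \<le> 6 * (\<Lambda> a \<bullet> \<Lambda> a) * B"
    using linear_bound[OF _ a, of m] m by auto
qed auto

text \<open>By duality \<open>t_a \<Lambda> a\<close> extracts the coefficient of
  \<open>\<alpha> a\<close>. For natural entries this coefficient bounds all entries of component
  \<open>a\<close>, and its integrality later puts zeta into the root lattice.\<close>

lemma wt_inner_weight:
  assumes m: "supported m" and a: "a \<in> vertices X"
  shows "tnum \<alpha> a * (wt m \<bullet> \<Lambda> a) = (\<Sum>k | m (a,k) \<noteq> 0. real k * m (a,k))"
proof -
  have S: "finite {y. m y \<noteq> 0}" "{y. m y \<noteq> 0} \<subseteq> all_indices X" using m by (auto simp: supported_def)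
  have "tnum \<alpha> a * (wt m \<bullet> \<Lambda> a) = (\<Sum>y | m y \<noteq> 0. if fst y = a then real (snd y) * m y else 0)"
    unfolding wt_def inner_sum_left sum_distrib_left
    using S a tnum_pos[OF a] by (intro sum.cong) (auto simp: root_weight all_indices_def)
  also have "\<dots> = (\<Sum>y\<in>{y. m y \<noteq> 0 \<and> fst y = a}. real (snd y) * m y)"
    by (rule sum.mono_neutral_cong_right) (use S in auto)
  also have "\<dots> = (\<Sum>k | m (a,k) \<noteq> 0. real k * m (a,k))"
    by (rule sum.reindex_bij_witness[of _ "\<lambda>k. (a, k)" snd]) auto
  finally show ?thesis .
qed

lemma finite_wt_fixed: "finite {m. supported (real \<circ> m) \<and> wt (real \<circ> m) = v}"
proof (rule finite_families)
  fix m a assume "m \<in> {m. supported (real \<circ> m) \<and> wt (real \<circ> m) = v}" "a \<in> vertices X"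
  then show "(\<Sum>k | m (a,k) \<noteq> 0. real (k * m (a,k))) \<le> tnum \<alpha> a * (v \<bullet> \<Lambda> a)"
    using wt_inner_weight[of "real \<circ> m" a] by auto
qed auto

lemma configurations_eq:
  assumes "H \<subseteq> all_indices X"
  shows "configurations \<alpha> \<Lambda> H \<nu> v =
    {m. supported (real \<circ> m) \<and> {y. m y \<noteq> 0} \<subseteq> H \<and>
        (\<forall>(a,i)\<in>H. source H \<nu> a i + pot (real \<circ> m) a i \<ge> 0) \<and>
        wt (real \<circ> m) = (\<Sum>(a,i)\<in>supp H \<nu>. real (i * \<nu> (a,i)) *\<^sub>R \<Lambda> a) - v}"
    (is "?l = ?r")
proof -
  have "m \<in> ?l \<longleftrightarrow> m \<in> ?r" for m
  proof (cases "finite {y. m y \<noteq> 0} \<and> {y. m y \<noteq> 0} \<subseteq> H")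
    case True
    then have s: "supported (real \<circ> m)" using assms by (auto simp: supported_def)
    have "vacancy \<alpha> H \<nu> (real \<circ> m) a i = source H \<nu> a i + pot (real \<circ> m) a i" if "(a,i) \<in> H" for a i
      by (rule vacancy_eq[OF s]) (use True assms that in \<open>auto simp: all_indices_def\<close>)
    moreover have "(\<Sum>(a,i)\<in>supp H m. real (i * m (a,i)) *\<^sub>R \<alpha> a) = wt (real \<circ> m)"
      using True by (simp add: supp_eq wt_def case_prod_beta)
    ultimately show ?thesis using True s by (auto simp: configurations_def)
  qed (auto simp: configurations_def supported_def)
  then show ?thesis by blast
qed

text \<open>The weight condition alone suffices. Finiteness matters because a \<open>sum\<close>
  over an infinite set would be 0 by convention.\<close>

lemma finite_configurations: "H \<subseteq> all_indices X \<Longrightarrow> finite (configurations \<alpha> \<Lambda> H \<nu> v)"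
proof (rule finite_subset[OF _ finite_wt_fixed])
  assume "H \<subseteq> all_indices X"
  then show "configurations \<alpha> \<Lambda> H \<nu> v \<subseteq> {m. supported (real \<circ> m) \<and>
      wt (real \<circ> m) = (\<Sum>(a,i)\<in>supp H \<nu>. real (i * \<nu> (a,i)) *\<^sub>R \<Lambda> a) - v}"
    by (simp only: configurations_eq) blast
qed

section \<open>Addition of families\<close>

lemma bil_add:
  assumes m: "supported m" and n: "supported n"
  shows "bil (\<lambda>y. m y + n y) (\<lambda>y. m y + n y) = bil m m + 2 * bil m n + bil n n"
    and "bil (\<lambda>y. m y + n y) n = bil m n + bil n n"
proof -
  obtain M N where M: "\<forall>z\<ge>M. vec m z = 0" and N: "\<forall>z\<ge>N. vec n z = 0"
    using supported_bound[OF m] supported_bound[OF n] by blast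
  have "bil f g = 1/6 * (\<Sum>z<max M N. vec f z \<bullet> vec g z)"
    if "f \<in> {m, n, \<lambda>y. m y + n y}" "g \<in> {m, n, \<lambda>y. m y + n y}" for f g
    by (rule bil_vec) (use that m n supported_add[OF m n] M N in \<open>auto simp: vec_add[OF m n]\<close>)
  then have b: "bil f g = 1/6 * (\<Sum>z<max M N. vec f z \<bullet> vec g z)"
    if "f = m \<or> f = n \<or> f = (\<lambda>y. m y + n y)" "g = m \<or> g = n \<or> g = (\<lambda>y. m y + n y)" for f g
    using that by blast
  have "(\<Sum>z<max M N. vec (\<lambda>y. m y + n y) z \<bullet> vec (\<lambda>y. m y + n y) z)
      = (\<Sum>z<max M N. vec m z \<bullet> vec m z) + 2 * (\<Sum>z<max M N. vec m z \<bullet> vec n z)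
        + (\<Sum>z<max M N. vec n z \<bullet> vec n z)"
    unfolding vec_add[OF m n]
    by (simp add: inner_add_left inner_add_right sum.distrib sum_distrib_left inner_commute)
  then show "bil (\<lambda>y. m y + n y) (\<lambda>y. m y + n y) = bil m m + 2 * bil m n + bil n n"
    using b[of "\<lambda>y. m y + n y" "\<lambda>y. m y + n y"] b[of m m] b[of m n] b[of n n] by simp
  show "bil (\<lambda>y. m y + n y) n = bil m n + bil n n"
    using b[of "\<lambda>y. m y + n y" n] b[of m n] b[of n n]
    by (simp add: vec_add[OF m n] inner_add_left sum.distrib)
qed

lemma pot_add:
  "supported m \<Longrightarrow> supported n \<Longrightarrow> pot (\<lambda>y. m y + n y) a i = pot m a i + pot n a i"
  by (simp add: pot_def vec_add inner_add_right sum.distrib distrib_left)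

lemma wt_vec:
  "supported m \<Longrightarrow> (\<And>z. z \<ge> M \<Longrightarrow> vec m z = 0) \<Longrightarrow> wt m = (1/6) *\<^sub>R (\<Sum>z<M. vec m z)"
  unfolding wt_def by (rule weight_vec)

lemma wt_add:
  assumes m: "supported m" and n: "supported n"
  shows "wt (\<lambda>y. m y + n y) = wt m + wt n"
proof -
  obtain M N where M: "\<forall>z\<ge>M. vec m z = 0" and N: "\<forall>z\<ge>N. vec n z = 0"
    using supported_bound[OF m] supported_bound[OF n] by blast
  have "wt m = (1/6) *\<^sub>R (\<Sum>z<max M N. vec m z)" "wt n = (1/6) *\<^sub>R (\<Sum>z<max M N. vec n z)"
    by (rule wt_vec[OF m], use M in simp, rule wt_vec[OF n], use N in simp)
  moreover have "wt (\<lambda>y. m y + n y) = (1/6) *\<^sub>R (\<Sum>z<max M N. vec (\<lambda>y. m y + n y) z)"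
    by (intro wt_vec supported_add m n) (simp add: vec_add[OF m n] M N)
  ultimately show ?thesis by (simp add: vec_add[OF m n] sum.distrib scaleR_add_right)
qed

end

section \<open>Gluing configurations\<close>

text \<open>The right hand side and the index set of the limit depend on \<open>r\<close> and
  \<open>s\<close> only through \<open>l = s / t_r\<close>; the weight lambda is called
  \<open>\<mu>\<close>.\<close>

locale level_data = root_data +
  fixes l :: nat and \<mu> :: 'a
  assumes l_pos: "l \<ge> 1"
begin

text \<open>In every component the index \<open>e a\<close> marks the same point
  \<open>x = l\<close>, which is \<open>6 * l\<close> in cells; this allows one cut for all
  components.\<close>

definition e :: "nat \<Rightarrow> nat" where "e a = tnat a * l"

lemma u_e: "a \<in> vertices X \<Longrightarrow> u a * e a = 6 * l"
  using u_tnat[of a] by (simp add: e_def flip: mult.assoc)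

lemma e_pos: "a \<in> vertices X \<Longrightarrow> e a \<ge> 1"
  using tnat_cases[of a] l_pos by (auto simp: e_def)

text \<open>In the limit the entries at \<open>k = e a\<close> are unconstrained integers. Families below and above
  this position are glued there; \<open>m\<close> appears reflected.\<close>
definition glue :: "(nat \<times> nat \<Rightarrow> nat) \<Rightarrow> (nat \<times> nat \<Rightarrow> nat) \<Rightarrow> nat \<times> nat \<Rightarrow> int" where
  "glue m' m = (\<lambda>(a,k). if a \<in> vertices X \<and> 1 \<le> k then
      (if k < e a then int (m (a, e a - k)) else if e a < k then int (m' (a, k - e a))
       else - \<lfloor>cum (real \<circ> m') a 0\<rfloor> - \<lfloor>cum (real \<circ> m) a 0\<rfloor>) else 0)"

lemma cum_interval:
  assumes "supported m" "\<And>k. m (a,k) \<noteq> 0 \<Longrightarrow> k \<le> K"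
  shows "cum m a x = (\<Sum>k=1..K. if x < u a * k then m (a,k) else 0)"
proof (rule cum_eq)
  show "{k. m (a,k) \<noteq> 0} \<subseteq> {1..K}" using assms(2) supportedD(4)[OF assms(1), of "(a,_)"] by auto
qed auto

lemma supported_index_bound:
  assumes "supported m"
  shows "\<exists>K. \<forall>a k. m (a,k) \<noteq> 0 \<longrightarrow> k \<le> K"
proof -
  have "finite (snd ` {y. m y \<noteq> 0})" using supportedD(1)[OF assms] by simp
  then obtain K where "\<forall>k\<in>snd ` {y. m y \<noteq> 0}. k \<le> K" using finite_nat_set_iff_bounded_le by blast
  then have "\<forall>a k. m (a,k) \<noteq> 0 \<longrightarrow> k \<le> K" by force
  then show ?thesis by blast
qed

lemma of_int_floor_cum: "real_of_int \<lfloor>cum (real \<circ> m) a x\<rfloor> = cum (real \<circ> m) a x"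
  unfolding cum_def by (intro of_int_floor_Ints Ints_sum) simp

context
  fixes m' m :: "nat \<times> nat \<Rightarrow> nat" and n :: "nat \<times> nat \<Rightarrow> real"
  assumes m': "supported (real \<circ> m')" and m: "supported (real \<circ> m)"
    and level: "\<And>a k. m (a,k) \<noteq> 0 \<Longrightarrow> k \<le> e a"
    and n_def: "n = real_of_int \<circ> glue m' m"
begin

lemma glue_nonzero:
  assumes K: "\<forall>a k. (real \<circ> m') (a,k) \<noteq> 0 \<longrightarrow> k \<le> K" and n: "n (a,k) \<noteq> 0"
  shows "a \<in> vertices X \<and> 1 \<le> k \<and> k \<le> e a + K"
proof (cases "e a < k")
  case True
  then have "m' (a, k - e a) \<noteq> 0" "a \<in> vertices X"
    using n by (auto simp: n_def glue_def split: if_splits)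
  then show ?thesis using K[rule_format, of a "k - e a"] True by auto
qed (use n in \<open>auto simp: n_def glue_def split: if_splits\<close>)

lemma supported_glue: "supported n"
proof -
  obtain K where K: "\<forall>a k. (real \<circ> m') (a,k) \<noteq> 0 \<longrightarrow> k \<le> K"
    using supported_index_bound[OF m'] by blast
  have "{y. n y \<noteq> 0} \<subseteq> (SIGMA a:vertices X. {1..e a + K})"
    using glue_nonzero[OF K] by auto
  moreover have "finite (SIGMA a:vertices X. {1..e a + K})" by auto
  moreover have "{y. n y \<noteq> 0} \<subseteq> all_indices X"
    by (auto simp: n_def glue_def all_indices_def split: if_splits)
  ultimately show ?thesis unfolding supported_def using finite_subset by blast
qed

text \<open>Entries are the downward jumps of \<open>cum\<close>. Reflection combined with negation
  preserves the jumps inside [0, l), and the entry at \<open>e a\<close> is the jump from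
  \<open>- cum m a 0\<close> to \<open>cum m' a 0\<close>. The last entry \<open>m (a, e a)\<close>
  is not copied by \<open>glue\<close>: it survives as minus the initial value of
  \<open>cum n a\<close>.\<close>

lemma cum_glue:
  assumes a: "a \<in> vertices X"
  shows "cum n a x = (if x < 6 * l then - cum (real \<circ> m) a (6 * l - Suc x)
      else cum (real \<circ> m') a (x - 6 * l))"
proof -
  obtain K where K: "\<forall>a k. (real \<circ> m') (a,k) \<noteq> 0 \<longrightarrow> k \<le> K"
    using supported_index_bound[OF m'] by blast
  define E where "E = e a"
  have E: "E \<ge> 1" "u a * E = 6 * l" "u a > 0" using e_pos u_e u_pos a by (auto simp: E_def)
  have nlow: "n (a,k) = m (a, E - k)" if "k \<in> {1..<E}" for k
    using that a by (simp add: n_def glue_def E_def)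
  have nhigh: "n (a,k) = m' (a, k - E)" if "k \<in> {E+1..E+K}" for k
    using that a by (simp add: n_def glue_def E_def)
  have nmid: "n (a,E) = - cum (real \<circ> m') a 0 - cum (real \<circ> m) a 0"
    using E(1) a by (simp add: n_def glue_def E_def of_int_floor_cum)
  have nK: "k \<le> E + K" if "n (a,k) \<noteq> 0" for k
    using glue_nonzero[OF K that] by (simp add: E_def)
  have cm': "cum (real \<circ> m') a y = (\<Sum>j=1..K. if y < u a * j then real (m' (a,j)) else 0)" for y
    using K by (subst cum_interval[OF m', of a K]) (auto cong: if_cong)
  have cm: "cum (real \<circ> m) a y = (\<Sum>j=1..E. if y < u a * j then real (m (a,j)) else 0)" for y
    using level by (subst cum_interval[OF m, of a E]) (auto simp: E_def cong: if_cong)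
  have sE: "(\<Sum>j=1..E. f j) = (\<Sum>j\<in>{1..<E}. f j) + f E" for f :: "nat \<Rightarrow> real"
    using E(1) by (simp add: atLeastLessThanSuc_atLeastAtMost[symmetric])
  have "cum n a x = (\<Sum>k=1..E+K. if x < u a * k then n (a,k) else 0)"
    by (rule cum_interval[OF supported_glue nK])
  also have "{1..E+K} = {1..<E} \<union> ({E} \<union> {E+1..E+K})" using E(1) by auto
  also have "(\<Sum>k\<in>\<dots>. if x < u a * k then n (a,k) else 0) =
      (\<Sum>k\<in>{1..<E}. if x < u a * k then n (a,k) else 0) + ((if x < u a * E then n (a,E) else 0) +
      (\<Sum>k=E+1..E+K. if x < u a * k then n (a,k) else 0))"
    by (subst sum.union_disjoint, simp, simp, force, subst sum.union_disjoint) auto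
  also have "(\<Sum>k\<in>{1..<E}. if x < u a * k then n (a,k) else 0)
      = (\<Sum>j\<in>{1..<E}. if x < u a * (E - j) then real (m (a,j)) else 0)"
    by (rule sum.reindex_bij_witness[of _ "\<lambda>j. E - j" "\<lambda>k. E - k"]) (auto simp: nlow)
  also have "(\<Sum>k=E+1..E+K. if x < u a * k then n (a,k) else 0)
      = (\<Sum>j=1..K. if x < u a * (E + j) then real (m' (a,j)) else 0)"
    by (rule sum.reindex_bij_witness[of _ "\<lambda>j. E + j" "\<lambda>k. k - E"]) (auto simp: nhigh)
  finally have main: "cum n a x = (\<Sum>j\<in>{1..<E}. if x < u a * (E - j) then real (m (a,j)) else 0)
      + ((if x < 6 * l then n (a,E) else 0)
      + (\<Sum>j=1..K. if x < u a * (E + j) then real (m' (a,j)) else 0))"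
    by (simp only: E(2))
  show ?thesis
  proof (cases "x < 6 * l")
    case True
    have t: "x < u a * (E + j)" for j
      using True E(2) by (simp add: distrib_left)
    have "(\<Sum>j=1..K. if x < u a * (E + j) then real (m' (a,j)) else 0) = cum (real \<circ> m') a 0"
      unfolding cm' using E(3) by (intro sum.cong) (auto simp: t)
    moreover have "cum (real \<circ> m) a 0 = (\<Sum>j\<in>{1..<E}. real (m (a,j))) + real (m (a,E))"
      unfolding cm sE using E(1,3) by (auto intro!: sum.cong)
    \<comment> \<open>Reflection sends the unit cell starting at \<open>x\<close> to the one
      starting at \<open>6 * l - Suc x\<close>, so the strict comparison becomes a negated
      one.\<close>
    moreover have "cum (real \<circ> m) a (6 * l - Suc x)
        = (\<Sum>j\<in>{1..<E}. if x < u a * (E - j) then 0 else real (m (a,j))) + real (m (a,E))"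
    proof -
      have "6 * l - Suc x < u a * j \<longleftrightarrow> \<not> x < u a * (E - j)" if "j \<in> {1..<E}" for j
      proof -
        have "u a * (E - j) = 6 * l - u a * j" by (simp add: diff_mult_distrib2 E(2))
        moreover have "u a * j \<le> 6 * l" using that E(2) by (metis mult_le_mono2 atLeastLessThan_iff less_imp_le)
        ultimately show ?thesis using True by linarith
      qed
      then have "(\<Sum>j\<in>{1..<E}. if 6 * l - Suc x < u a * j then real (m (a,j)) else 0)
          = (\<Sum>j\<in>{1..<E}. if x < u a * (E - j) then 0 else real (m (a,j)))"
        by (intro sum.cong) auto
      moreover have "6 * l - Suc x < u a * E" using True E(2) by simp
      ultimately show ?thesis unfolding cm sE by simp
    qed
    moreover have "(\<Sum>j\<in>{1..<E}. real (m (a,j))) = (\<Sum>j\<in>{1..<E}. if x < u a * (E - j) then real (m (a,j)) else 0)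
        + (\<Sum>j\<in>{1..<E}. if x < u a * (E - j) then 0 else real (m (a,j)))"
      unfolding sum.distrib[symmetric] by (intro sum.cong) auto
    ultimately show ?thesis using True main nmid by simp
  next
    case False
    have "\<not> x < u a * (E - j)" for j
    proof -
      have "u a * (E - j) \<le> u a * E" by (intro mult_le_mono2) simp
      then show ?thesis using False E(2) by linarith
    qed
    moreover have "x < u a * (E + j) \<longleftrightarrow> x - 6 * l < u a * j" for j
      using False E(2) by (auto simp: distrib_left)
    ultimately show ?thesis using False main by (simp add: cm')
  qed
qed

lemma vec_glue:
  "vec n x = (if x < 6 * l then - vec (real \<circ> m) (6 * l - Suc x) else vec (real \<circ> m') (x - 6 * l))"
  by (auto simp: vec_def cum_glue sum_negf[symmetric] intro!: sum.cong)

lemma vec_level: "x \<ge> 6 * l \<Longrightarrow> vec (real \<circ> m) x = 0"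
proof -
  assume x: "x \<ge> 6 * l"
  have "cum (real \<circ> m) a x = 0" if "a \<in> vertices X" for a
  proof -
    have "\<not> (m (a,k) \<noteq> 0 \<and> x < u a * k)" for k
    proof
      assume k: "m (a,k) \<noteq> 0 \<and> x < u a * k"
      then have "u a * k \<le> u a * e a" using level by (intro mult_le_mono2) auto
      then show False using k x u_e[OF that] by linarith
    qed
    then have none: "{k. (real \<circ> m) (a,k) \<noteq> 0 \<and> x < u a * k} = {}" by auto
    show ?thesis unfolding cum_def none by simp
  qed
  then show ?thesis by (simp add: vec_def)
qed

lemma sum_vec_glue: "(\<Sum>z<6 * l. vec n z) = - (6 *\<^sub>R wt (real \<circ> m))"
proof -
  have "(\<Sum>z<6 * l. vec n z) = - (\<Sum>z<6 * l. vec (real \<circ> m) (6 * l - Suc z))"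
    by (simp add: vec_glue sum_negf)
  also have "(\<Sum>z<6 * l. vec (real \<circ> m) (6 * l - Suc z)) = (\<Sum>z<6 * l. vec (real \<circ> m) z)"
    by (rule sum.nat_diff_reindex)
  also have "\<dots> = 6 *\<^sub>R wt (real \<circ> m)"
    by (simp add: wt_vec[OF m vec_level])
  finally show ?thesis .
qed

lemma glue_bound: "\<exists>N. (\<forall>z\<ge>N. vec (real \<circ> m') z = 0) \<and> (\<forall>z\<ge>6 * l + N. vec n z = 0)"
proof -
  obtain N where N: "\<forall>z\<ge>N. vec (real \<circ> m') z = 0" using supported_bound[OF m'] by blast
  then have "\<forall>z\<ge>6 * l + N. vec n z = 0" by (auto simp: vec_glue)
  then show ?thesis using N by blast
qed

lemma wt_glue: "wt n = wt (real \<circ> m') - wt (real \<circ> m)"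
proof -
  obtain N where N: "\<forall>z\<ge>N. vec (real \<circ> m') z = 0" "\<forall>z\<ge>6 * l + N. vec n z = 0"
    using glue_bound by blast
  have "wt n = (1/6) *\<^sub>R (\<Sum>z<6 * l + N. vec n z)"
    by (rule wt_vec[OF supported_glue]) (use N in blast)
  also have "\<dots> = (1/6) *\<^sub>R (- (6 *\<^sub>R wt (real \<circ> m)) + (\<Sum>z<N. vec (real \<circ> m') z))"
    unfolding sum_lessThan_add sum_vec_glue by (simp add: vec_glue)
  also have "\<dots> = wt (real \<circ> m') - wt (real \<circ> m)"
    using wt_vec[OF m', of N] N(1) by (simp add: scaleR_add_right scaleR_diff_right)
  finally show ?thesis .
qed

lemma bil_glue: "bil n n = bil (real \<circ> m') (real \<circ> m') + bil (real \<circ> m) (real \<circ> m)"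
proof -
  obtain N where N: "\<forall>z\<ge>N. vec (real \<circ> m') z = 0" "\<forall>z\<ge>6 * l + N. vec n z = 0"
    using glue_bound by blast
  have "bil n n = 1/6 * (\<Sum>z<6 * l + N. vec n z \<bullet> vec n z)"
    by (rule bil_vec[OF supported_glue supported_glue]) (use N in simp)
  also have "\<dots> = 1/6 * ((\<Sum>z<6 * l. vec (real \<circ> m) (6 * l - Suc z) \<bullet> vec (real \<circ> m) (6 * l - Suc z))
      + (\<Sum>z<N. vec (real \<circ> m') z \<bullet> vec (real \<circ> m') z))"
    unfolding sum_lessThan_add by (simp add: vec_glue)
  also have "(\<Sum>z<6 * l. vec (real \<circ> m) (6 * l - Suc z) \<bullet> vec (real \<circ> m) (6 * l - Suc z))
      = (\<Sum>z<6 * l. vec (real \<circ> m) z \<bullet> vec (real \<circ> m) z)"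
    by (rule sum.nat_diff_reindex)
  also have "\<dots> = 6 * bil (real \<circ> m) (real \<circ> m)"
    using bil_vec[OF m m, of "6 * l"] vec_level by simp
  also have "(\<Sum>z<N. vec (real \<circ> m') z \<bullet> vec (real \<circ> m') z) = 6 * bil (real \<circ> m') (real \<circ> m')"
    using bil_vec[OF m' m', of N] N(1) by simp
  finally have "bil n n = 1/6 * (6 * bil (real \<circ> m) (real \<circ> m) + 6 * bil (real \<circ> m') (real \<circ> m'))" .
  moreover have "1/6 * (6 * x + 6 * y) = y + x" for x y :: real by simp
  ultimately show ?thesis by (simp only:)
qed

lemma pot_glue_above:
  assumes a: "a \<in> vertices X"
  shows "pot n a (e a + i) = pot n a (e a) + pot (real \<circ> m') a i"
proof -
  have "u a * (e a + i) = 6 * l + u a * i" using u_e[OF a] by (simp add: distrib_left)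
  then show ?thesis
    by (simp add: pot_def u_e[OF a] sum_lessThan_add vec_glue distrib_left)
qed

text \<open>Moving back from the cut removes the integral over the last \<open>u a * j\<close>
  cells. There \<open>n\<close> is the negated mirror image of an initial stretch of
  \<open>m\<close>, and the two sign changes cancel.\<close>

lemma pot_glue_below:
  assumes a: "a \<in> vertices X" and j: "j \<le> e a"
  shows "pot n a (e a - j) = pot n a (e a) + pot (real \<circ> m) a j"
proof -
  have le: "u a * j \<le> 6 * l" using mult_le_mono2[OF j, of "u a"] u_e[OF a] by simp
  have ud: "u a * (e a - j) = 6 * l - u a * j" using u_e[OF a] by (simp add: diff_mult_distrib2)
  have "(\<Sum>z<6 * l. \<alpha> a \<bullet> vec n z) = (\<Sum>z<(6 * l - u a * j) + u a * j. \<alpha> a \<bullet> vec n z)"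
    using le by simp
  also have "\<dots> = (\<Sum>z<6 * l - u a * j. \<alpha> a \<bullet> vec n z)
      + (\<Sum>z<u a * j. \<alpha> a \<bullet> vec n (6 * l - u a * j + z))"
    by (rule sum_lessThan_add)
  also have "(\<Sum>z<u a * j. \<alpha> a \<bullet> vec n (6 * l - u a * j + z))
      = (\<Sum>z<u a * j. - (\<alpha> a \<bullet> vec (real \<circ> m) (u a * j - Suc z)))"
  proof (rule sum.cong[OF refl])
    fix z assume z: "z \<in> {..<u a * j}"
    then have "6 * l - u a * j + z < 6 * l" "6 * l - Suc (6 * l - u a * j + z) = u a * j - Suc z"
      using le by auto
    then show "\<alpha> a \<bullet> vec n (6 * l - u a * j + z) = - (\<alpha> a \<bullet> vec (real \<circ> m) (u a * j - Suc z))"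
      by (simp only: vec_glue if_True inner_minus_right)
  qed
  also have "\<dots> = - (\<Sum>z<u a * j. \<alpha> a \<bullet> vec (real \<circ> m) z)"
    unfolding sum_negf by (subst sum.nat_diff_reindex) simp
  finally have "(\<Sum>z<6 * l - u a * j. \<alpha> a \<bullet> vec n z)
      = (\<Sum>z<6 * l. \<alpha> a \<bullet> vec n z) + (\<Sum>z<u a * j. \<alpha> a \<bullet> vec (real \<circ> m) z)"
    by simp
  then show ?thesis unfolding pot_def u_e[OF a] ud by (simp add: distrib_left)
qed

text \<open>Over [0, l) the glued step function has integral \<open>- wt m\<close>, and the values
  of \<open>pot\<close> at \<open>e a\<close> are minus the fundamental weight coordinates of this
  integral. So the weight condition on the lower part says exactly that these values are
  zeta.\<close>

lemma weight_of_pot_glue: "(\<Sum>a\<in>vertices X. pot n a (e a) *\<^sub>R \<Lambda> a) = wt (real \<circ> m)"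
proof -
  have span: "wt (real \<circ> m) \<in> rspan"
    unfolding wt_def using supportedD(3)[OF m]
    by (intro span_sum span_scale root_in_rspan) blast
  have "pot n a (e a) = tnum \<alpha> a * (\<alpha> a \<bullet> wt (real \<circ> m))" if "a \<in> vertices X" for a
  proof -
    have "pot n a (e a) = - (tnum \<alpha> a / 6 * (\<alpha> a \<bullet> (\<Sum>z<6 * l. vec n z)))"
      by (simp add: pot_def u_e[OF that] inner_sum_right)
    then show ?thesis by (simp add: sum_vec_glue)
  qed
  then have "(\<Sum>a\<in>vertices X. pot n a (e a) *\<^sub>R \<Lambda> a)
      = (\<Sum>a\<in>vertices X. (tnum \<alpha> a * (\<alpha> a \<bullet> wt (real \<circ> m))) *\<^sub>R \<Lambda> a)"
    by (intro sum.cong) auto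
  then show ?thesis using weight_expansion[OF span] by simp
qed

end

text \<open>The index set of the limiting sum: differences of configurations from the minimizing one.\<close>
definition limit_configs :: "(nat \<times> nat \<Rightarrow> int) set" where
  "limit_configs = {n. supported (real_of_int \<circ> n) \<and>
     (\<forall>a\<in>vertices X. \<forall>k\<ge>1. k \<noteq> e a \<longrightarrow> n (a,k) \<ge> 0) \<and>
     (\<forall>a\<in>vertices X. \<forall>i\<ge>1. pot (real_of_int \<circ> n) a i \<ge> 0) \<and>
     wt (real_of_int \<circ> n) = - \<mu>}"

definition zeta_of :: "(nat \<times> nat \<Rightarrow> int) \<Rightarrow> nat \<Rightarrow> nat" where
  "zeta_of n a = (if a \<in> vertices X then nat \<lfloor>pot (real_of_int \<circ> n) a (e a)\<rfloor> else 0)"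

definition upper :: "(nat \<times> nat \<Rightarrow> int) \<Rightarrow> nat \<times> nat \<Rightarrow> nat" where
  "upper n = (\<lambda>(a,k). if a \<in> vertices X \<and> 1 \<le> k then nat (n (a, e a + k)) else 0)"

text \<open>The last entry comes from the initial value of the step function, since
  \<open>glue\<close> does not store it at any index. By \<open>cum_0_nonpos\<close> the conversion
  to \<open>nat\<close> loses nothing.\<close>

definition lower :: "(nat \<times> nat \<Rightarrow> int) \<Rightarrow> nat \<times> nat \<Rightarrow> nat" where
  "lower n = (\<lambda>(a,k). if a \<in> vertices X \<and> 1 \<le> k \<and> k < e a then nat (n (a, e a - k))
     else if a \<in> vertices X \<and> k = e a then nat \<lfloor>- cum (real_of_int \<circ> n) a 0\<rfloor> else 0)"

lemma pot_Ints:
  assumes "supported (real_of_int \<circ> n)" "a \<in> vertices X"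
  shows "pot (real_of_int \<circ> n) a i \<in> \<int>"
proof -
  have "pairing (a,i) y * (real_of_int \<circ> n) y \<in> \<int>" if "y \<in> {y. (real_of_int \<circ> n) y \<noteq> 0}" for y
    using that supportedD(3)[OF assms(1), of y] pairing_Ints[OF sr assms(2), of "fst y" i "snd y"]
    by (auto simp: pairing_def)
  then have "- pot (real_of_int \<circ> n) a i \<in> \<int>"
    unfolding pairing_vec[OF assms, symmetric] by (rule Ints_sum)
  then show ?thesis by simp
qed

lemma real_zeta_of:
  assumes "n \<in> limit_configs" "a \<in> vertices X"
  shows "real (zeta_of n a) = pot (real_of_int \<circ> n) a (e a)"
proof -
  have "pot (real_of_int \<circ> n) a (e a) \<in> \<int>" "pot (real_of_int \<circ> n) a (e a) \<ge> 0"
    using assms e_pos[OF assms(2)] by (auto intro: pot_Ints simp: limit_configs_def)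
  then show ?thesis using assms(2) of_int_floor_Ints by (simp add: zeta_of_def)
qed

text \<open>Over the first \<open>u b\<close> cells component \<open>b\<close> is constant and the
  other components can only decrease; as they pair nonpositively with \<open>\<alpha> b\<close>, the
  product \<open>\<alpha> b \<bullet> vec n z\<close> is smallest at \<open>z = 0\<close>. The
  vacancy number at \<open>i = 1\<close> makes its average nonpositive, so \<open>- vec n 0\<close>
  is dominant and has nonnegative root coordinates.\<close>

lemma cum_0_nonpos:
  assumes n: "n \<in> limit_configs" and a: "a \<in> vertices X"
  shows "cum (real_of_int \<circ> n) a 0 \<le> 0"
proof -
  let ?n = "real_of_int \<circ> n"
  have supp: "supported ?n" using n by (simp add: limit_configs_def)
  have "\<alpha> b \<bullet> - vec ?n 0 \<ge> 0" if b: "b \<in> vertices X" for b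
  proof -
    have le: "\<alpha> b \<bullet> vec ?n 0 \<le> \<alpha> b \<bullet> vec ?n z" if z: "z < u b" for z
    proof -
      have "cum ?n d z = cum ?n d 0" if "d = b" for d
      proof -
        have "z < u d * k \<longleftrightarrow> 0 < u d * k" for k
          using z that by (cases k) auto
        then show ?thesis by (simp add: cum_def)
      qed
      moreover have "cum ?n d z \<le> cum ?n d 0" if d: "d \<in> vertices X" for d
      proof -
        have fin: "finite {k. ?n (d,k) \<noteq> 0}" by (rule finite_slice[OF supportedD(1)[OF supp]])
        have "(if z < u d * k then ?n (d,k) else 0) \<le> (if 0 < u d * k then ?n (d,k) else 0)" for k
        proof (cases "z < u d * k \<or> k = 0")
          case False
          \<comment> \<open>Indices passed within the first \<open>u b \<le> 6 \<le> 6 * l\<close>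
            cells lie strictly below the cut, where entries are nonnegative.\<close>
          have "u b \<le> 6" using u_tnat[OF b] tnat_cases[OF b] by auto
          then have "u d * k < u d * e d" using False z u_e[OF d] l_pos by linarith
          then have "k < e d" by simp
          then have "n (d,k) \<ge> 0" using n d False by (auto simp: limit_configs_def)
          then show ?thesis using False by simp
        qed auto
        then show ?thesis
          unfolding cum_eq[OF fin order_refl] by (intro sum_mono)
      qed
      ultimately have "(tnum \<alpha> d * cum ?n d 0) * (\<alpha> b \<bullet> \<alpha> d) \<le> (tnum \<alpha> d * cum ?n d z) * (\<alpha> b \<bullet> \<alpha> d)"
        if "d \<in> vertices X" for d
        using that root_inner_nonpos[OF b that] tnum_pos[OF that]
        by (cases "b = d") (auto intro!: mult_right_mono_neg)
      then show ?thesis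
        unfolding vec_def inner_sum_right inner_scaleR_right by (rule sum_mono)
    qed
    have "pot ?n b 1 \<ge> 0" using n b by (auto simp: limit_configs_def)
    then have "(\<Sum>z<u b. \<alpha> b \<bullet> vec ?n z) \<le> 0"
      using tnum_pos[OF b] by (simp add: pot_def mult_le_0_iff)
    moreover have "(\<Sum>z<u b. \<alpha> b \<bullet> vec ?n 0) \<le> (\<Sum>z<u b. \<alpha> b \<bullet> vec ?n z)"
      using le by (intro sum_mono) auto
    ultimately have "real (u b) * (\<alpha> b \<bullet> vec ?n 0) \<le> 0" by simp
    then show ?thesis using u_pos[OF b] by (simp add: mult_le_0_iff)
  qed
  then have "- vec ?n 0 \<bullet> \<Lambda> a \<ge> 0"
    by (intro dominant_imp_nonneg[OF span_neg[OF vec_in_rspan] _ a])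
  then show ?thesis by (simp add: vec_weight[OF a])
qed

lemma glue_upper_lower:
  assumes n: "n \<in> limit_configs"
  shows "supported (real \<circ> upper n)" "supported (real \<circ> lower n)"
    and "lower n (a,k) \<noteq> 0 \<Longrightarrow> k \<le> e a"
    and "glue (upper n) (lower n) = n"
proof -
  let ?n = "real_of_int \<circ> n"
  have supp: "supported ?n" using n by (simp add: limit_configs_def)
  obtain K where K: "\<forall>a k. ?n (a,k) \<noteq> 0 \<longrightarrow> k \<le> K"
    using supported_index_bound[OF supp] by blast
  have le: "k \<le> e a" if "lower n (a,k) \<noteq> 0" for a k
    using that by (auto simp: lower_def split: if_splits)
  then show "lower n (a,k) \<noteq> 0 \<Longrightarrow> k \<le> e a" .
  have ui: "upper n (a,k) \<noteq> 0 \<Longrightarrow> a \<in> vertices X \<and> 1 \<le> k \<and> k \<le> K" for a k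
    using K[rule_format, of a "e a + k"] by (auto simp: upper_def split: if_splits)
  have "{y. (real \<circ> upper n) y \<noteq> 0} \<subseteq> vertices X \<times> {1..K}"
    using ui by fastforce
  then show u: "supported (real \<circ> upper n)"
    unfolding supported_def all_indices_def by (auto intro: finite_subset)
  have "{y. (real \<circ> lower n) y \<noteq> 0} \<subseteq> (SIGMA a:vertices X. {1..e a})"
    using e_pos by (fastforce simp: lower_def split: if_splits)
  moreover have "finite (SIGMA a:vertices X. {1..e a})" by auto
  ultimately show l: "supported (real \<circ> lower n)"
    unfolding supported_def all_indices_def by (auto intro: finite_subset)
  have "glue (upper n) (lower n) (a,k) = n (a,k)" for a k
  proof (cases "a \<in> vertices X \<and> 1 \<le> k")
    case False
    then have "n (a,k) = 0" using supportedD(3,4)[OF supp, of "(a,k)"] by auto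
    then show ?thesis using False by (auto simp: glue_def)
  next
    case True
    then have a: "a \<in> vertices X" and k: "1 \<le> k" by auto
    have nn: "n (a,j) \<ge> 0" if "j \<ge> 1" "j \<noteq> e a" for j
      using n a that by (auto simp: limit_configs_def)
    consider "k < e a" | "e a < k" | "k = e a" by linarith
    then show ?thesis
    proof cases
      case 1
      then have "int (lower n (a, e a - k)) = n (a,k)" using a k nn[of k] by (simp add: lower_def)
      then show ?thesis using 1 a k by (simp add: glue_def)
    next
      case 2
      then have "int (upper n (a, k - e a)) = n (a,k)" using a k nn[of k] by (simp add: upper_def)
      then show ?thesis using 2 a k by (simp add: glue_def)
    next
      \<comment> \<open>The entries of component \<open>a\<close> sum to \<open>cum n a 0\<close>.
        The lower part contains this value negated as its last entry, which determines the entry at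
        the cut.\<close>
      case 3
      define E where "E = e a"
      have E: "E \<ge> 1" "u a > 0" using e_pos u_pos a by (auto simp: E_def)
      have cu: "cum (real \<circ> upper n) a 0 = (\<Sum>j=1..K. real (upper n (a,j)))"
        using ui E(2) by (subst cum_interval[OF u, of a K]) (auto intro!: sum.cong)
      have cl: "cum (real \<circ> lower n) a 0 = (\<Sum>j=1..E. real (lower n (a,j)))"
        using le E(2) by (subst cum_interval[OF l, of a E]) (auto intro!: sum.cong simp: E_def)
      have ub: "(\<Sum>j=1..K. real (upper n (a,j))) = (\<Sum>k=E+1..E+K. ?n (a,k))"
      proof (rule sum.reindex_bij_witness[of _ "\<lambda>k. k - E" "\<lambda>j. E + j"])
        fix j assume "j \<in> {1..K}"
        then show "?n (a, E + j) = real (upper n (a,j))"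
          using nn[of "E + j"] a by (simp add: upper_def E_def)
      qed auto
      have lb: "(\<Sum>j\<in>{1..<E}. real (lower n (a,j))) = (\<Sum>k\<in>{1..<E}. ?n (a,k))"
      proof (rule sum.reindex_bij_witness[of _ "\<lambda>k. E - k" "\<lambda>j. E - j"])
        fix j assume j: "j \<in> {1..<E}"
        then have "E - j \<ge> 1" "E - j \<noteq> e a" by (auto simp: E_def)
        then have "n (a, E - j) \<ge> 0" by (rule nn)
        then show "?n (a, E - j) = real (lower n (a,j))"
          using j a by (simp add: lower_def E_def)
      qed auto
      have "- cum ?n a 0 \<in> \<int>" unfolding cum_def by (intro Ints_minus Ints_sum) simp
      then have "real_of_int \<lfloor>- cum ?n a 0\<rfloor> = - cum ?n a 0" by (rule of_int_floor_Ints)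
      then have "real (nat \<lfloor>- cum ?n a 0\<rfloor>) = - cum ?n a 0"
        using cum_0_nonpos[OF n a] by linarith
      then have le0: "real (lower n (a,E)) = - cum ?n a 0"
        using a by (simp only: lower_def E_def prod.case) simp
      have "cum ?n a 0 = (\<Sum>k=1..E+K. ?n (a,k))"
        using K E(2) by (subst cum_interval[OF supp, of a "E + K"]) (force intro!: sum.cong)+
      also have "{1..E+K} = {1..<E} \<union> ({E} \<union> {E+1..E+K})" using E(1) by auto
      also have "(\<Sum>k\<in>\<dots>. ?n (a,k)) = (\<Sum>k\<in>{1..<E}. ?n (a,k)) + (?n (a,E) + (\<Sum>k=E+1..E+K. ?n (a,k)))"
        by (subst sum.union_disjoint, simp, simp, force, subst sum.union_disjoint) auto
      finally have "cum ?n a 0 = (\<Sum>k\<in>{1..<E}. ?n (a,k)) + (?n (a,E) + (\<Sum>k=E+1..E+K. ?n (a,k)))" .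
      moreover have "y = - z - (x + - c)" if "c = x + (y + z)" for c x y z :: real
        using that by simp
      moreover have "(\<Sum>j=1..E. real (lower n (a,j))) = (\<Sum>k\<in>{1..<E}. ?n (a,k)) + - cum ?n a 0"
        unfolding lb[symmetric] le0[symmetric]
        using E(1) by (simp add: atLeastLessThanSuc_atLeastAtMost[symmetric])
      ultimately have "?n (a,E) = - cum (real \<circ> upper n) a 0 - cum (real \<circ> lower n) a 0"
        unfolding cu cl ub by metis
      then have "real_of_int (n (a,E)) = real_of_int (- \<lfloor>cum (real \<circ> upper n) a 0\<rfloor> - \<lfloor>cum (real \<circ> lower n) a 0\<rfloor>)"
        by (simp add: of_int_floor_cum)
      then have "n (a,E) = - \<lfloor>cum (real \<circ> upper n) a 0\<rfloor> - \<lfloor>cum (real \<circ> lower n) a 0\<rfloor>"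
        by (simp only: of_int_eq_iff)
      then show ?thesis using 3 a k by (simp add: glue_def E_def)
    qed
  qed
  then show "glue (upper n) (lower n) = n" by auto
qed

text \<open>Since \<open>min i 1 = 1\<close> for positive \<open>i\<close>, the data W(zeta) shift
  all vacancy numbers of component \<open>a\<close> equally, which is the shift produced by
  \<open>pot_glue_above\<close> and \<open>pot_glue_below\<close>.\<close>

lemma source_W_zeta:
  assumes "(a,1) \<in> H" "1 \<le> i"
  shows "source H (W_zeta \<zeta>) a i = real (\<zeta> a)"
proof -
  have "{j. (a,j) \<in> supp H (W_zeta \<zeta>)} = (if \<zeta> a = 0 then {} else {1})"
    using assms(1) by (auto simp: supp_def W_zeta_def split: if_splits)
  then show ?thesis using assms(2) by (simp add: source_def W_zeta_def)
qed

lemma level_indices_eq: "level_indices X \<alpha> l = {(a,j). a \<in> vertices X \<and> 1 \<le> j \<and> j \<le> e a}"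
proof -
  have "real j \<le> tnum \<alpha> a * real l \<longleftrightarrow> j \<le> e a" if "a \<in> vertices X" for a j
    unfolding real_tnat[OF that, symmetric] e_def of_nat_mult[symmetric] of_nat_le_iff ..
  then show ?thesis unfolding level_indices_def by blast
qed

lemma supp_W_zeta:
  assumes H: "\<forall>a\<in>vertices X. (a,1) \<in> H" and \<zeta>: "\<forall>a. a \<notin> vertices X \<longrightarrow> \<zeta> a = 0"
  shows "supp H (W_zeta \<zeta>) = (\<lambda>a. (a,1)) ` {a\<in>vertices X. \<zeta> a \<noteq> 0}"
proof
  show "supp H (W_zeta \<zeta>) \<subseteq> (\<lambda>a. (a,1)) ` {a\<in>vertices X. \<zeta> a \<noteq> 0}"
  proof
    fix y assume "y \<in> supp H (W_zeta \<zeta>)"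
    then have "snd y = 1" "\<zeta> (fst y) \<noteq> 0"
      by (cases y; auto simp: supp_def W_zeta_def split: if_splits)+
    then show "y \<in> (\<lambda>a. (a,1)) ` {a\<in>vertices X. \<zeta> a \<noteq> 0}"
      using \<zeta> by (intro image_eqI[of _ _ "fst y"]) (auto simp: prod_eq_iff)
  qed
  show "(\<lambda>a. (a,1)) ` {a\<in>vertices X. \<zeta> a \<noteq> 0} \<subseteq> supp H (W_zeta \<zeta>)"
    using H by (auto simp: supp_def W_zeta_def)
qed

lemma weight_W_zeta:
  assumes H: "\<forall>a\<in>vertices X. (a,1) \<in> H" and \<zeta>: "\<forall>a. a \<notin> vertices X \<longrightarrow> \<zeta> a = 0"
  shows "(\<Sum>(a,i)\<in>supp H (W_zeta \<zeta>). real (i * W_zeta \<zeta> (a,i)) *\<^sub>R \<Lambda> a)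
    = (\<Sum>a\<in>vertices X. real (\<zeta> a) *\<^sub>R \<Lambda> a)"
proof -
  have "(\<Sum>(a,i)\<in>supp H (W_zeta \<zeta>). real (i * W_zeta \<zeta> (a,i)) *\<^sub>R \<Lambda> a)
      = (\<Sum>a\<in>{a\<in>vertices X. \<zeta> a \<noteq> 0}. real (\<zeta> a) *\<^sub>R \<Lambda> a)"
    unfolding supp_W_zeta[OF H \<zeta>] by (subst sum.reindex) (auto simp: inj_on_def W_zeta_def)
  also have "\<dots> = (\<Sum>a\<in>vertices X. real (\<zeta> a) *\<^sub>R \<Lambda> a)"
    by (rule sum.mono_neutral_left) auto
  finally show ?thesis .
qed

abbreviation upper_configs :: "(nat \<Rightarrow> nat) \<Rightarrow> (nat \<times> nat \<Rightarrow> nat) set" where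
  "upper_configs \<zeta> \<equiv> configurations \<alpha> \<Lambda> (all_indices X) (W_zeta \<zeta>) \<mu>"

abbreviation lower_configs :: "(nat \<Rightarrow> nat) \<Rightarrow> (nat \<times> nat \<Rightarrow> nat) set" where
  "lower_configs \<zeta> \<equiv> configurations \<alpha> \<Lambda> (level_indices X \<alpha> l) (W_zeta \<zeta>) 0"

lemma mem_upper_configs:
  assumes \<zeta>: "\<forall>a. a \<notin> vertices X \<longrightarrow> \<zeta> a = 0"
  shows "m \<in> upper_configs \<zeta> \<longleftrightarrow> supported (real \<circ> m) \<and>
    (\<forall>a\<in>vertices X. \<forall>i\<ge>1. real (\<zeta> a) + pot (real \<circ> m) a i \<ge> 0) \<and>
    wt (real \<circ> m) = (\<Sum>a\<in>vertices X. real (\<zeta> a) *\<^sub>R \<Lambda> a) - \<mu>"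
proof -
  let ?H = "all_indices X"
  have H: "\<forall>a\<in>vertices X. (a,1) \<in> ?H" by (simp add: all_indices_def)
  have "(\<forall>(a,i)\<in>?H. source ?H (W_zeta \<zeta>) a i + pot (real \<circ> m) a i \<ge> 0) \<longleftrightarrow>
      (\<forall>a\<in>vertices X. \<forall>i\<ge>1. real (\<zeta> a) + pot (real \<circ> m) a i \<ge> 0)"
    using source_W_zeta[OF bspec[OF H]] by (auto simp: all_indices_def)
  moreover have "supported (real \<circ> m) \<Longrightarrow> {y. m y \<noteq> 0} \<subseteq> ?H"
    by (simp add: supported_def)
  ultimately show ?thesis
    unfolding configurations_eq[OF order_refl] weight_W_zeta[OF H \<zeta>] by blast
qed

lemma mem_lower_configs:
  assumes \<zeta>: "\<forall>a. a \<notin> vertices X \<longrightarrow> \<zeta> a = 0"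
  shows "m \<in> lower_configs \<zeta> \<longleftrightarrow> supported (real \<circ> m) \<and> (\<forall>a k. m (a,k) \<noteq> 0 \<longrightarrow> k \<le> e a) \<and>
    (\<forall>a\<in>vertices X. \<forall>i. 1 \<le> i \<and> i \<le> e a \<longrightarrow> real (\<zeta> a) + pot (real \<circ> m) a i \<ge> 0) \<and>
    wt (real \<circ> m) = (\<Sum>a\<in>vertices X. real (\<zeta> a) *\<^sub>R \<Lambda> a)"
proof -
  let ?H = "level_indices X \<alpha> l"
  have H: "\<forall>a\<in>vertices X. (a,1) \<in> ?H"
    using e_pos by (simp add: level_indices_eq)
  have "(\<forall>(a,i)\<in>?H. source ?H (W_zeta \<zeta>) a i + pot (real \<circ> m) a i \<ge> 0) \<longleftrightarrow>
      (\<forall>a\<in>vertices X. \<forall>i. 1 \<le> i \<and> i \<le> e a \<longrightarrow> real (\<zeta> a) + pot (real \<circ> m) a i \<ge> 0)"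
    using source_W_zeta[OF bspec[OF H]] by (auto simp: level_indices_eq)
  moreover have "{y. m y \<noteq> 0} \<subseteq> ?H \<longleftrightarrow> (\<forall>a k. m (a,k) \<noteq> 0 \<longrightarrow> k \<le> e a)" if s: "supported (real \<circ> m)"
  proof
    show "{y. m y \<noteq> 0} \<subseteq> ?H \<Longrightarrow> \<forall>a k. m (a,k) \<noteq> 0 \<longrightarrow> k \<le> e a"
      unfolding level_indices_eq by blast
    show "\<forall>a k. m (a,k) \<noteq> 0 \<longrightarrow> k \<le> e a \<Longrightarrow> {y. m y \<noteq> 0} \<subseteq> ?H"
      using supportedD(2)[OF s] unfolding level_indices_eq all_indices_def by auto
  qed
  moreover have "?H \<subseteq> all_indices X" by (auto simp: level_indices_def all_indices_def)
  ultimately show ?thesis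
    unfolding configurations_eq[OF \<open>?H \<subseteq> all_indices X\<close>] weight_W_zeta[OF H \<zeta>] diff_0_right by blast
qed

lemma weights_unique:
  assumes "(\<Sum>a\<in>vertices X. c a *\<^sub>R \<Lambda> a) = (\<Sum>a\<in>vertices X. d a *\<^sub>R \<Lambda> a)" and a: "a \<in> vertices X"
  shows "c a = d a"
proof -
  have "\<alpha> a \<bullet> (\<Sum>b\<in>vertices X. f b *\<^sub>R \<Lambda> b) = f a / tnum \<alpha> a" for f
  proof -
    have "\<alpha> a \<bullet> (\<Sum>b\<in>vertices X. f b *\<^sub>R \<Lambda> b) = (\<Sum>b\<in>vertices X. if a = b then f b / tnum \<alpha> a else 0)"
      unfolding inner_sum_right using a by (intro sum.cong) (auto simp: root_weight)
    then show ?thesis using a by simp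
  qed
  then have "c a / tnum \<alpha> a = d a / tnum \<alpha> a" using assms(1) by metis
  then show ?thesis using tnum_pos[OF a] by simp
qed

text \<open>The weight condition on \<open>m\<close> forces the vacancy numbers at the cut to equal
  \<open>\<zeta>\<close>. All others are then vacancy numbers of \<open>m\<close> or
  \<open>m'\<close>, and \<open>\<zeta>\<close> cancels from the difference of the two
  weights.\<close>

lemma glue_mem_limit_configs:
  assumes \<zeta>: "\<forall>a. a \<notin> vertices X \<longrightarrow> \<zeta> a = 0"
    and m': "m' \<in> upper_configs \<zeta>" and m: "m \<in> lower_configs \<zeta>"
  shows "glue m' m \<in> limit_configs" "zeta_of (glue m' m) = \<zeta>"
    and "a \<in> vertices X \<Longrightarrow> pot (real_of_int \<circ> glue m' m) a (e a) = real (\<zeta> a)"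
proof -
  let ?n = "real_of_int \<circ> glue m' m"
  note M' = m'[unfolded mem_upper_configs[OF \<zeta>]] and M = m[unfolded mem_lower_configs[OF \<zeta>]]
  have s': "supported (real \<circ> m')" and s: "supported (real \<circ> m)"
    and lv: "\<And>a k. m (a,k) \<noteq> 0 \<Longrightarrow> k \<le> e a" using M' M by blast+
  have pe: "pot ?n a (e a) = real (\<zeta> a)" if "a \<in> vertices X" for a
  proof (rule weights_unique[OF _ that])
    have "(\<Sum>a\<in>vertices X. pot ?n a (e a) *\<^sub>R \<Lambda> a) = wt (real \<circ> m)"
      by (rule weight_of_pot_glue[OF s' s _ refl]) (rule lv)
    then show "(\<Sum>a\<in>vertices X. pot ?n a (e a) *\<^sub>R \<Lambda> a) = (\<Sum>a\<in>vertices X. real (\<zeta> a) *\<^sub>R \<Lambda> a)"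
      using M by metis
  qed
  then show "a \<in> vertices X \<Longrightarrow> pot ?n a (e a) = real (\<zeta> a)" .
  show "zeta_of (glue m' m) = \<zeta>"
    using pe \<zeta> by (auto simp: zeta_of_def)
  have "pot ?n a i \<ge> 0" if a: "a \<in> vertices X" and i: "i \<ge> 1" for a i
  proof (cases "i < e a")
    case True
    then have "pot ?n a i = real (\<zeta> a) + pot (real \<circ> m) a (e a - i)"
      using pot_glue_below[OF s' s lv refl a, of "e a - i"] pe[OF a] by simp
    then show ?thesis using M a True i by auto
  next
    case False
    show ?thesis
    proof (cases "i = e a")
      case False
      then have "pot ?n a i = real (\<zeta> a) + pot (real \<circ> m') a (i - e a)"
        using pot_glue_above[OF s' s lv refl a, of "i - e a"] pe[OF a] \<open>\<not> i < e a\<close> by simp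
      then show ?thesis using M' a False \<open>\<not> i < e a\<close> by auto
    qed (simp add: pe[OF a])
  qed
  moreover have "wt ?n = - \<mu>"
  proof -
    have "wt ?n = wt (real \<circ> m') - wt (real \<circ> m)"
      by (rule wt_glue[OF s' s _ refl]) (rule lv)
    also have "\<dots> = ((\<Sum>a\<in>vertices X. real (\<zeta> a) *\<^sub>R \<Lambda> a) - \<mu>) - (\<Sum>a\<in>vertices X. real (\<zeta> a) *\<^sub>R \<Lambda> a)"
      using M M' by metis
    finally show ?thesis by simp
  qed
  moreover have "glue m' m (a,k) \<ge> 0" if "k \<noteq> e a" for a k
    using that by (simp add: glue_def)
  ultimately show "glue m' m \<in> limit_configs"
    using supported_glue[OF s' s lv refl] by (auto simp: limit_configs_def)
qed

lemma upper_lower_mem: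
  assumes n: "n \<in> limit_configs"
  shows "upper n \<in> upper_configs (zeta_of n)" "lower n \<in> lower_configs (zeta_of n)"
    and "(\<Sum>a\<in>vertices X. real (zeta_of n a) *\<^sub>R \<Lambda> a) = wt (real \<circ> lower n)"
proof -
  let ?n = "real_of_int \<circ> n"
  note ul = glue_upper_lower[OF n]
  have s: "supported (real \<circ> upper n)" "supported (real \<circ> lower n)" "\<And>a k. lower n (a,k) \<noteq> 0 \<Longrightarrow> k \<le> e a"
    by (fact ul)+
  have ne: "?n = real_of_int \<circ> glue (upper n) (lower n)" by (simp only: ul(4))
  have z0: "\<forall>a. a \<notin> vertices X \<longrightarrow> zeta_of n a = 0" by (auto simp: zeta_of_def)
  have w: "(\<Sum>a\<in>vertices X. real (zeta_of n a) *\<^sub>R \<Lambda> a) = wt (real \<circ> lower n)"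
    using weight_of_pot_glue[OF s ne] by (simp add: real_zeta_of[OF n])
  then show "(\<Sum>a\<in>vertices X. real (zeta_of n a) *\<^sub>R \<Lambda> a) = wt (real \<circ> lower n)" .
  have "real (zeta_of n a) + pot (real \<circ> upper n) a i \<ge> 0" if "a \<in> vertices X" "i \<ge> 1" for a i
  proof -
    have "pot ?n a (e a + i) \<ge> 0" using n that by (simp add: limit_configs_def)
    then show ?thesis using pot_glue_above[OF s ne that(1), of i] real_zeta_of[OF n that(1)] by simp
  qed
  moreover have "wt (real \<circ> upper n) = (\<Sum>a\<in>vertices X. real (zeta_of n a) *\<^sub>R \<Lambda> a) - \<mu>"
    using wt_glue[OF s ne] n w by (simp add: limit_configs_def algebra_simps)
  ultimately show "upper n \<in> upper_configs (zeta_of n)"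
    unfolding mem_upper_configs[OF z0] using s(1) by blast
  have "real (zeta_of n a) + pot (real \<circ> lower n) a i \<ge> 0" if "a \<in> vertices X" "1 \<le> i" "i \<le> e a" for a i
  proof -
    have "pot ?n a (e a - i) \<ge> 0"
    \<comment> \<open>The top index \<open>i = e a\<close> is reflected to position 0, which is not
      covered by the conditions on \<open>n\<close>; there \<open>pot\<close> is an empty
      sum.\<close>
    proof (cases "e a - i = 0")
      case True
      then show ?thesis by (simp add: pot_def)
    next
      case False
      then show ?thesis using n that by (auto simp: limit_configs_def)
    qed
    then show ?thesis using pot_glue_below[OF s ne that(1,3)] real_zeta_of[OF n that(1)] by simp
  qed
  then show "lower n \<in> lower_configs (zeta_of n)"
    unfolding mem_lower_configs[OF z0] using s(2,3) w[symmetric] by blast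
qed

lemma glue_bij:
  assumes \<zeta>: "\<forall>a. a \<notin> vertices X \<longrightarrow> \<zeta> a = 0"
  shows "bij_betw (\<lambda>(m',m). glue m' m) (upper_configs \<zeta> \<times> lower_configs \<zeta>)
    {n\<in>limit_configs. zeta_of n = \<zeta>}"
proof (rule bij_betw_byWitness[where f' = "\<lambda>n. (upper n, lower n)"])
  show "\<forall>x\<in>upper_configs \<zeta> \<times> lower_configs \<zeta>.
      (upper (case x of (m',m) \<Rightarrow> glue m' m), lower (case x of (m',m) \<Rightarrow> glue m' m)) = x"
  proof (clarify, intro conjI ext; clarify?)
    fix m' m a k assume m': "m' \<in> upper_configs \<zeta>" and m: "m \<in> lower_configs \<zeta>"
    have s': "supported (real \<circ> m')" and s: "supported (real \<circ> m)"
      and lv: "\<And>a k. m (a,k) \<noteq> 0 \<Longrightarrow> k \<le> e a"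
      using m m' unfolding mem_upper_configs[OF \<zeta>] mem_lower_configs[OF \<zeta>] by blast+
    have m'0: "m' (a,k) = 0" if "\<not> (a \<in> vertices X \<and> 1 \<le> k)"
      using that supportedD(3,4)[OF s', of "(a,k)"] by auto
    have m0: "m (a,k) = 0" if "\<not> (a \<in> vertices X \<and> 1 \<le> k \<and> k \<le> e a)"
      using that supportedD(3,4)[OF s, of "(a,k)"] lv[of a k] by auto
    show "upper (glue m' m) (a,k) = m' (a,k)"
      using m'0 by (auto simp: upper_def glue_def)
    \<comment> \<open>Only an entry at \<open>e a\<close> reaches the last cell
      \<open>6 * l - 1\<close>, so the initial value of the glued family isolates it.\<close>
    have top: "lower (glue m' m) (a, e a) = m (a, e a)" if a: "a \<in> vertices X"
    proof -
      have "6 * l - Suc 0 < u a * j \<longleftrightarrow> e a \<le> j" for j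
      proof -
        have "6 * l - Suc 0 < u a * j \<longleftrightarrow> u a * e a \<le> u a * j" using u_e[OF a] l_pos by auto
        then show ?thesis using u_pos[OF a] by simp
      qed
      then have "{j. (real \<circ> m) (a,j) \<noteq> 0 \<and> 6 * l - Suc 0 < u a * j} = (if m (a, e a) = 0 then {} else {e a})"
        using lv[of a] by (auto intro: antisym) (metis antisym not_gr_zero)
      then have "cum (real \<circ> m) a (6 * l - Suc 0) = real (m (a, e a))"
        unfolding cum_def by simp
      then show ?thesis
        using l_pos a by (simp add: lower_def cum_glue[OF s' s lv refl a])
    qed
    show "lower (glue m' m) (a,k) = m (a,k)"
    proof (cases "a \<in> vertices X \<and> 1 \<le> k \<and> k < e a")
      case True
      then show ?thesis by (auto simp: lower_def glue_def)
    next
      case False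
      then show ?thesis using top m0 by (cases "a \<in> vertices X \<and> k = e a") (auto simp: lower_def)
    qed
  qed
  show "\<forall>n\<in>{n\<in>limit_configs. zeta_of n = \<zeta>}. (case (upper n, lower n) of (m',m) \<Rightarrow> glue m' m) = n"
    using glue_upper_lower(4) by auto
  show "(\<lambda>(m',m). glue m' m) ` (upper_configs \<zeta> \<times> lower_configs \<zeta>) \<subseteq> {n\<in>limit_configs. zeta_of n = \<zeta>}"
    using glue_mem_limit_configs[OF \<zeta>] by auto
  show "(\<lambda>n. (upper n, lower n)) ` {n\<in>limit_configs. zeta_of n = \<zeta>} \<subseteq> upper_configs \<zeta> \<times> lower_configs \<zeta>"
    using upper_lower_mem by auto
qed

lemma zeta_of_mem:
  assumes n: "n \<in> limit_configs"
  shows "zeta_of n \<in> zetas X \<alpha> \<Lambda>"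
proof -
  have s: "supported (real \<circ> lower n)" by (rule glue_upper_lower[OF n])
  define c where "c a = (\<Sum>k | lower n (a,k) \<noteq> 0. int k * int (lower n (a,k)))" for a
  have span: "wt (real \<circ> lower n) \<in> rspan"
    unfolding wt_def using supportedD(3)[OF s]
    by (intro span_sum span_scale root_in_rspan) blast
  have "wt (real \<circ> lower n) = (\<Sum>a\<in>vertices X. (tnum \<alpha> a * (wt (real \<circ> lower n) \<bullet> \<Lambda> a)) *\<^sub>R \<alpha> a)"
    by (rule root_expansion[OF span])
  also have "\<dots> = (\<Sum>a\<in>vertices X. of_int (c a) *\<^sub>R \<alpha> a)"
    by (intro sum.cong refl) (simp only: wt_inner_weight[OF s], simp add: c_def)
  finally have "wt (real \<circ> lower n) \<in> int_span X \<alpha>" unfolding int_span_def by blast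
  then show ?thesis
    using upper_lower_mem(3)[OF n] by (simp add: zetas_def zeta_of_def)
qed

text \<open>\<open>finite_bil_bounded\<close> concerns natural entries, whereas those at the cut may
  be negative. Additivity of the norm bounds both halves of \<open>n\<close> instead, and the halves
  determine \<open>n\<close>.\<close>

lemma finite_limit_configs:
  "finite {n\<in>limit_configs. bil (real_of_int \<circ> n) (real_of_int \<circ> n) \<le> B}"
proof (rule finite_subset)
  let ?F = "{m. supported (real \<circ> m) \<and> bil (real \<circ> m) (real \<circ> m) \<le> B}"
  show "finite ((\<lambda>(m',m). glue m' m) ` (?F \<times> ?F))"
    by (intro finite_imageI finite_cartesian_product finite_bil_bounded)
  show "{n\<in>limit_configs. bil (real_of_int \<circ> n) (real_of_int \<circ> n) \<le> B} \<subseteq> (\<lambda>(m',m). glue m' m) ` (?F \<times> ?F)"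
  proof clarify
    fix n assume n: "n \<in> limit_configs" and B: "bil (real_of_int \<circ> n) (real_of_int \<circ> n) \<le> B"
    note ul = glue_upper_lower[OF n]
    have "bil (real_of_int \<circ> n) (real_of_int \<circ> n) = bil (real \<circ> upper n) (real \<circ> upper n)
        + bil (real \<circ> lower n) (real \<circ> lower n)"
    proof (rule bil_glue)
      show "supported (real \<circ> upper n)" "supported (real \<circ> lower n)"
        "\<And>a k. lower n (a,k) \<noteq> 0 \<Longrightarrow> k \<le> e a" by (fact ul)+
      show "real_of_int \<circ> n = real_of_int \<circ> glue (upper n) (lower n)" by (simp only: ul(4))
    qed
    then have "upper n \<in> ?F" "lower n \<in> ?F"
      using B bil_nonneg[OF ul(1)] bil_nonneg[OF ul(2)] ul(1,2) by auto
    then show "n \<in> (\<lambda>(m',m). glue m' m) ` (?F \<times> ?F)"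
      using ul(4) by (intro image_eqI[of _ _ "(upper n, lower n)"]) auto
  qed
qed

end

section \<open>The limit\<close>

context level_data
begin

abbreviation of_int_family :: "(nat \<times> nat \<Rightarrow> int) \<Rightarrow> nat \<times> nat \<Rightarrow> real" where
  "of_int_family n \<equiv> real_of_int \<circ> n"

definition energy :: "(nat \<times> nat \<Rightarrow> real) \<Rightarrow> nat" where
  "energy m = nat \<lfloor>1/2 * bil m m\<rfloor>"

text \<open>Only the factors at the cut positions depend on \<open>L\<close>; omitting them leaves a
  product that is common to all \<open>L\<close> and to the limit.\<close>

definition regular_part :: "(nat \<times> nat \<Rightarrow> int) \<Rightarrow> 'c::field fps" where
  "regular_part n = (\<Prod>y | n y \<noteq> 0 \<and> snd y \<noteq> e (fst y).
      qbinom_fps (nat \<lfloor>pot (of_int_family n) (fst y) (snd y)\<rfloor>) (nat (n y)))"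

definition limit_coeff :: "(nat \<times> nat \<Rightarrow> int) \<Rightarrow> 'c::field fps" where
  "limit_coeff n = regular_part n * (\<Prod>a\<in>vertices X. inverse (qfact_fps (zeta_of n a)))"

definition vac_prod :: "(nat \<times> nat) set \<Rightarrow> (nat \<Rightarrow> nat) \<Rightarrow> (nat \<times> nat \<Rightarrow> nat) \<Rightarrow> 'c::field fps" where
  "vac_prod H \<zeta> m = (\<Prod>y | m y \<noteq> 0.
      qbinom_fps (nat \<lfloor>vacancy \<alpha> H (W_zeta \<zeta>) (real \<circ> m) (fst y) (snd y)\<rfloor>) (m y))"

lemma vacancy_W_zeta:
  assumes "supported (real \<circ> m)" "{y. m y \<noteq> 0} \<subseteq> H" "\<forall>a\<in>vertices X. (a,1) \<in> H"
    and "a \<in> vertices X" "1 \<le> i"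
  shows "vacancy \<alpha> H (W_zeta \<zeta>) (real \<circ> m) a i = real (\<zeta> a) + pot (real \<circ> m) a i"
proof -
  have "{y. (real \<circ> m) y \<noteq> 0} \<subseteq> H" using assms(2) by simp
  then show ?thesis
    using vacancy_eq[OF assms(1) _ assms(4)] source_W_zeta[OF bspec[OF assms(3,4)] assms(5)] by simp
qed

lemma level_indices_vertices: "\<forall>a\<in>vertices X. (a,1) \<in> level_indices X \<alpha> l"
  using e_pos by (simp add: level_indices_eq)

lemma all_indices_vertices: "\<forall>a\<in>vertices X. (a,1) \<in> all_indices X"
  by (simp add: all_indices_def)

lemma level_indices_subset: "level_indices X \<alpha> l \<subseteq> all_indices X"
  by (auto simp: level_indices_def all_indices_def)

lemma finite_supp_W_zeta:
  "\<forall>a\<in>vertices X. (a,1) \<in> H \<Longrightarrow> \<forall>a. a \<notin> vertices X \<longrightarrow> \<zeta> a = 0 \<Longrightarrow> finite (supp H (W_zeta \<zeta>))"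
  by (simp add: supp_W_zeta)

lemma inverse_q_form:
  assumes H: "H \<subseteq> all_indices X" "\<forall>a\<in>vertices X. (a,1) \<in> H" and \<zeta>: "\<forall>a. a \<notin> vertices X \<longrightarrow> \<zeta> a = 0"
  shows "fermionic_form \<alpha> \<Lambda> H (W_zeta \<zeta>) v (inverse (fls_X :: 'c::field fls))
    = fps_to_fls (\<Sum>m\<in>configurations \<alpha> \<Lambda> H (W_zeta \<zeta>) v. fps_X ^ energy (real \<circ> m) * vac_prod H \<zeta> m)"
  unfolding fermionic_form_def fps_to_fls_sum
proof (rule sum.cong[OF refl])
  fix m assume m: "m \<in> configurations \<alpha> \<Lambda> H (W_zeta \<zeta>) v"
  show "inverse fls_X powi \<lfloor>charge \<alpha> H (W_zeta \<zeta>) (real \<circ> m)\<rfloor> *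
        (\<Prod>(a,i)\<in>supp H m. qbinom (inverse fls_X) \<lfloor>vacancy \<alpha> H (W_zeta \<zeta>) (real \<circ> m) a i\<rfloor> (m (a,i)))
      = fps_to_fls (fps_X ^ energy (real \<circ> m) * vac_prod H \<zeta> m)"
    unfolding energy_def vac_prod_def
  proof (rule summand_inverse_q)
    show "supported (real \<circ> m)" "{y. m y \<noteq> 0} \<subseteq> H"
      using m unfolding configurations_eq[OF H(1)] by blast+
    show "H \<subseteq> all_indices X" by (rule H)
    show "finite (supp H (W_zeta \<zeta>))" by (rule finite_supp_W_zeta[OF H(2) \<zeta>])
    show "(a,i) \<in> H \<Longrightarrow> vacancy \<alpha> H (W_zeta \<zeta>) (real \<circ> m) a i \<ge> 0" for a i
      using m unfolding configurations_def by blast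
  qed
qed

lemma energy_half_bil:
  assumes "supported (real \<circ> m)"
  shows "real (energy (real \<circ> m)) = 1/2 * bil (real \<circ> m) (real \<circ> m)"
  using of_int_floor_Ints[OF half_bil_Ints[OF assms]] bil_nonneg[OF assms] by (simp add: energy_def)

lemma glue_summand:
  assumes \<zeta>: "\<forall>a. a \<notin> vertices X \<longrightarrow> \<zeta> a = 0"
    and m': "m' \<in> upper_configs \<zeta>" and m: "m \<in> lower_configs \<zeta>"
  shows "energy (of_int_family (glue m' m)) = energy (real \<circ> m') + energy (real \<circ> m)"
    and "(regular_part (glue m' m) :: 'c::field fps)
      = vac_prod (all_indices X) \<zeta> m' * vac_prod (level_indices X \<alpha> l) \<zeta> m"
proof -
  define n where "n = glue m' m"
  have s': "supported (real \<circ> m')" and s: "supported (real \<circ> m)"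
    and lv: "\<And>a k. m (a,k) \<noteq> 0 \<Longrightarrow> k \<le> e a"
    using m m' unfolding mem_upper_configs[OF \<zeta>] mem_lower_configs[OF \<zeta>] by blast+
  have nd: "of_int_family n = real_of_int \<circ> glue m' m" by (simp add: n_def)
  have "bil (of_int_family n) (of_int_family n) = bil (real \<circ> m') (real \<circ> m') + bil (real \<circ> m) (real \<circ> m)"
    by (rule bil_glue[OF s' s _ nd]) (rule lv)
  then have "1/2 * bil (of_int_family n) (of_int_family n) = real (energy (real \<circ> m') + energy (real \<circ> m))"
    by (simp add: energy_half_bil[OF s] energy_half_bil[OF s'])
  then show "energy (of_int_family (glue m' m)) = energy (real \<circ> m') + energy (real \<circ> m)"
    unfolding energy_def[of "of_int_family (glue m' m)"] n_def by (simp only: floor_of_nat nat_int)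
  have pe: "pot (of_int_family n) a (e a) = real (\<zeta> a)" if "a \<in> vertices X" for a
    unfolding n_def by (rule glue_mem_limit_configs(3)[OF \<zeta> m' m that])
  have above: "pot (of_int_family n) a (e a + i) = real (\<zeta> a) + pot (real \<circ> m') a i" if "a \<in> vertices X" for a i
    unfolding pe[OF that, symmetric] by (rule pot_glue_above[OF s' s _ nd that]) (rule lv)
  have below: "pot (of_int_family n) a (e a - i) = real (\<zeta> a) + pot (real \<circ> m) a i" if "a \<in> vertices X" "i \<le> e a" for a i
    unfolding pe[OF that(1), symmetric] by (rule pot_glue_below[OF s' s _ nd that]) (rule lv)
  have H': "{y. m' y \<noteq> 0} \<subseteq> all_indices X" using s' by (simp add: supported_def)
  have H: "{y. m y \<noteq> 0} \<subseteq> level_indices X \<alpha> l"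
    using m unfolding configurations_eq[OF level_indices_subset] by blast
  have fn: "finite {y. n y \<noteq> 0}"
    using glue_mem_limit_configs(1)[OF \<zeta> m' m] by (simp add: limit_configs_def supported_def n_def)
  define f where "f y = (qbinom_fps (nat \<lfloor>pot (of_int_family n) (fst y) (snd y)\<rfloor>) (nat (n y)) :: 'c fps)" for y
  have nV: "fst y \<in> vertices X \<and> 1 \<le> snd y" if "n y \<noteq> 0" for y
    using that by (cases y) (auto simp: n_def glue_def split: if_splits)
  let ?A = "{y. n y \<noteq> 0 \<and> e (fst y) < snd y}" and ?B = "{y. n y \<noteq> 0 \<and> snd y < e (fst y)}"
  have "{y. n y \<noteq> 0 \<and> snd y \<noteq> e (fst y)} = ?A \<union> ?B" by (auto simp: neq_iff)
  then have "regular_part n = prod f (?A \<union> ?B)" by (simp add: regular_part_def f_def)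
  also have "\<dots> = prod f ?A * prod f ?B"
    by (rule prod.union_disjoint) (auto intro: finite_subset[OF _ fn])
  also have "prod f ?A = vac_prod (all_indices X) \<zeta> m'"
    unfolding vac_prod_def
  proof (rule prod.reindex_bij_witness[of _ "\<lambda>y. (fst y, e (fst y) + snd y)" "\<lambda>y. (fst y, snd y - e (fst y))"])
    fix y assume "y \<in> ?A"
    then show "(fst (fst y, snd y - e (fst y)), e (fst (fst y, snd y - e (fst y))) + snd (fst y, snd y - e (fst y))) = y"
      by (simp add: prod_eq_iff)
  next
    fix y assume y: "y \<in> ?A"
    then have a: "fst y \<in> vertices X" "1 \<le> snd y" using nV by auto
    have ny: "n y = int (m' (fst y, snd y - e (fst y)))"
      using y a by (cases y) (simp add: n_def glue_def)
    then show "(fst y, snd y - e (fst y)) \<in> {y. m' y \<noteq> 0}" using y by auto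
    have "vacancy \<alpha> (all_indices X) (W_zeta \<zeta>) (real \<circ> m') (fst y) (snd y - e (fst y))
        = real (\<zeta> (fst y)) + pot (real \<circ> m') (fst y) (snd y - e (fst y))"
      by (rule vacancy_W_zeta[OF s' H' all_indices_vertices a(1)]) (use y in \<open>simp add: Suc_le_eq\<close>)
    also have "\<dots> = pot (of_int_family n) (fst y) (snd y)"
      using above[OF a(1), of "snd y - e (fst y)"] y by simp
    finally show "qbinom_fps (nat \<lfloor>vacancy \<alpha> (all_indices X) (W_zeta \<zeta>) (real \<circ> m')
        (fst (fst y, snd y - e (fst y))) (snd (fst y, snd y - e (fst y)))\<rfloor>) (m' (fst y, snd y - e (fst y))) = f y"
      by (simp add: f_def ny)
  next
    fix y assume "y \<in> {y. m' y \<noteq> 0}"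
    then have y: "m' y \<noteq> 0" "fst y \<in> vertices X" "1 \<le> snd y" using supportedD(3,4)[OF s', of y] by auto
    show "(fst (fst y, e (fst y) + snd y), snd (fst y, e (fst y) + snd y) - e (fst (fst y, e (fst y) + snd y))) = y"
      by simp
    show "(fst y, e (fst y) + snd y) \<in> ?A" using y by (simp add: n_def glue_def)
  qed
  also have "prod f ?B = (\<Prod>y | m y \<noteq> 0 \<and> snd y < e (fst y).
      qbinom_fps (nat \<lfloor>vacancy \<alpha> (level_indices X \<alpha> l) (W_zeta \<zeta>) (real \<circ> m) (fst y) (snd y)\<rfloor>) (m y))"
  proof (rule prod.reindex_bij_witness[of _ "\<lambda>y. (fst y, e (fst y) - snd y)" "\<lambda>y. (fst y, e (fst y) - snd y)"])
    fix y assume y: "y \<in> ?B"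
    then have a: "fst y \<in> vertices X" "1 \<le> snd y" using nV by auto
    then show "(fst (fst y, e (fst y) - snd y), e (fst (fst y, e (fst y) - snd y)) - snd (fst y, e (fst y) - snd y)) = y"
      using y by (simp add: prod_eq_iff)
    have ny: "n y = int (m (fst y, e (fst y) - snd y))"
      using y a by (cases y) (simp add: n_def glue_def)
    then show "(fst y, e (fst y) - snd y) \<in> {y. m y \<noteq> 0 \<and> snd y < e (fst y)}" using y a by auto
    have "vacancy \<alpha> (level_indices X \<alpha> l) (W_zeta \<zeta>) (real \<circ> m) (fst y) (e (fst y) - snd y)
        = real (\<zeta> (fst y)) + pot (real \<circ> m) (fst y) (e (fst y) - snd y)"
      by (rule vacancy_W_zeta[OF s H level_indices_vertices a(1)]) (use y in \<open>simp add: Suc_le_eq\<close>)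
    also have "\<dots> = pot (of_int_family n) (fst y) (snd y)"
      using below[OF a(1), of "e (fst y) - snd y"] y by simp
    finally show "qbinom_fps (nat \<lfloor>vacancy \<alpha> (level_indices X \<alpha> l) (W_zeta \<zeta>) (real \<circ> m)
        (fst (fst y, e (fst y) - snd y)) (snd (fst y, e (fst y) - snd y))\<rfloor>) (m (fst y, e (fst y) - snd y)) = f y"
      by (simp add: f_def ny)
  next
    fix y assume "y \<in> {y. m y \<noteq> 0 \<and> snd y < e (fst y)}"
    then have y: "m y \<noteq> 0" "snd y < e (fst y)" "fst y \<in> vertices X" "1 \<le> snd y"
      using supportedD(3,4)[OF s, of y] by auto
    then show "(fst (fst y, e (fst y) - snd y), e (fst (fst y, e (fst y) - snd y)) - snd (fst y, e (fst y) - snd y)) = y"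
      by (simp add: prod_eq_iff)
    show "(fst y, e (fst y) - snd y) \<in> ?B" using y by (simp add: n_def glue_def)
  qed
  \<comment> \<open>Entries of \<open>m\<close> at \<open>e a\<close> have no counterpart in the
    regular part. Their vacancy number is \<open>pot\<close> at position 0, so their binomials are
    1.\<close>
  also have "\<dots> = vac_prod (level_indices X \<alpha> l) \<zeta> m"
    unfolding vac_prod_def
  proof (rule prod.mono_neutral_left)
    show "finite {y. m y \<noteq> 0}" using s by (simp add: supported_def)
    show "\<forall>y\<in>{y. m y \<noteq> 0} - {y. m y \<noteq> 0 \<and> snd y < e (fst y)}.
        (qbinom_fps (nat \<lfloor>vacancy \<alpha> (level_indices X \<alpha> l) (W_zeta \<zeta>) (real \<circ> m) (fst y) (snd y)\<rfloor>) (m y) :: 'c fps) = 1"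
    proof
      fix y assume "y \<in> {y. m y \<noteq> 0} - {y. m y \<noteq> 0 \<and> snd y < e (fst y)}"
      then have y: "fst y \<in> vertices X" "1 \<le> snd y" "snd y = e (fst y)"
        using supportedD(3,4)[OF s, of y] lv[of "fst y" "snd y"] by auto
      have "vacancy \<alpha> (level_indices X \<alpha> l) (W_zeta \<zeta>) (real \<circ> m) (fst y) (snd y)
          = real (\<zeta> (fst y)) + pot (real \<circ> m) (fst y) (snd y)"
        by (rule vacancy_W_zeta[OF s H level_indices_vertices y(1,2)])
      also have "\<dots> = pot (of_int_family n) (fst y) 0" using below[OF y(1), of "snd y"] y(3) by simp
      finally have "vacancy \<alpha> (level_indices X \<alpha> l) (W_zeta \<zeta>) (real \<circ> m) (fst y) (snd y) = 0"
        by (simp add: pot_def)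
      then show "(qbinom_fps (nat \<lfloor>vacancy \<alpha> (level_indices X \<alpha> l) (W_zeta \<zeta>) (real \<circ> m) (fst y) (snd y)\<rfloor>) (m y) :: 'c fps) = 1"
        by (simp add: qbinom_fps_0_left)
    qed
  qed auto
  finally show "(regular_part (glue m' m) :: 'c fps)
      = vac_prod (all_indices X) \<zeta> m' * vac_prod (level_indices X \<alpha> l) \<zeta> m"
    by (simp add: n_def)
qed

lemma finite_fiber:
  assumes \<zeta>: "\<forall>a. a \<notin> vertices X \<longrightarrow> \<zeta> a = 0"
  shows "finite {n\<in>limit_configs. zeta_of n = \<zeta>}"
proof -
  have "finite (upper_configs \<zeta> \<times> lower_configs \<zeta>)"
    by (intro finite_cartesian_product finite_configurations level_indices_subset order_refl)
  then show ?thesis using bij_betw_finite[OF glue_bij[OF \<zeta>]] by blast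
qed

lemma zeta_summand:
  assumes \<zeta>: "\<forall>a. a \<notin> vertices X \<longrightarrow> \<zeta> a = 0"
  shows "M_form X \<alpha> \<Lambda> (W_zeta \<zeta>) \<mu> (inverse (fls_X :: 'c::field fls))
      * M_level X \<alpha> \<Lambda> l (W_zeta \<zeta>) (inverse fls_X) / (\<Prod>a\<in>vertices X. qfact fls_X (\<zeta> a))
    = fps_to_fls (\<Sum>n | n \<in> limit_configs \<and> zeta_of n = \<zeta>. fps_X ^ energy (of_int_family n) * limit_coeff n)"
proof -
  let ?U = "upper_configs \<zeta>" and ?L = "lower_configs \<zeta>"
  let ?H' = "all_indices X" and ?H = "level_indices X \<alpha> l"
  define D where "D = (\<Prod>a\<in>vertices X. inverse (qfact_fps (\<zeta> a)) :: 'c fps)"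
  have "(\<Prod>a\<in>vertices X. qfact fls_X (\<zeta> a)) = inverse (fps_to_fls D)"
    by (simp add: D_def fps_to_fls_prod fps_to_fls_inverse qfact_fls_X prod_inversef[symmetric])
  then have "M_form X \<alpha> \<Lambda> (W_zeta \<zeta>) \<mu> (inverse (fls_X :: 'c fls))
      * M_level X \<alpha> \<Lambda> l (W_zeta \<zeta>) (inverse fls_X) / (\<Prod>a\<in>vertices X. qfact fls_X (\<zeta> a))
    = fps_to_fls ((\<Sum>m'\<in>?U. fps_X ^ energy (real \<circ> m') * vac_prod ?H' \<zeta> m')
        * (\<Sum>m\<in>?L. fps_X ^ energy (real \<circ> m) * vac_prod ?H \<zeta> m) * D)"
    by (simp only: M_form_def M_level_def inverse_q_form[OF order_refl all_indices_vertices \<zeta>]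
        inverse_q_form[OF level_indices_subset level_indices_vertices \<zeta>]
        divide_inverse inverse_inverse_eq fls_times_fps_to_fls)
  also have "(\<Sum>m'\<in>?U. fps_X ^ energy (real \<circ> m') * vac_prod ?H' \<zeta> m')
        * (\<Sum>m\<in>?L. fps_X ^ energy (real \<circ> m) * vac_prod ?H \<zeta> m) * D
      = (\<Sum>x\<in>?U \<times> ?L. fps_X ^ energy (of_int_family (case x of (m',m) \<Rightarrow> glue m' m))
          * limit_coeff (case x of (m',m) \<Rightarrow> glue m' m))"
  proof (subst sum_product, subst sum.cartesian_product, subst sum_distrib_right, rule sum.cong[OF refl])
    fix x assume "x \<in> ?U \<times> ?L"
    then obtain m' m where x: "x = (m', m)" and m: "m' \<in> ?U" "m \<in> ?L" by blast
    show "(case x of (m',m) \<Rightarrow> fps_X ^ energy (real \<circ> m') * vac_prod ?H' \<zeta> m'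
          * (fps_X ^ energy (real \<circ> m) * vac_prod ?H \<zeta> m)) * D
        = fps_X ^ energy (of_int_family (case x of (m',m) \<Rightarrow> glue m' m)) * limit_coeff (case x of (m',m) \<Rightarrow> glue m' m)"
      by (simp add: x limit_coeff_def glue_summand[OF \<zeta> m] glue_mem_limit_configs(2)[OF \<zeta> m] D_def
          power_add mult_ac)
  qed
  also have "\<dots> = (\<Sum>n | n \<in> limit_configs \<and> zeta_of n = \<zeta>. fps_X ^ energy (of_int_family n) * limit_coeff n)"
    by (rule sum.reindex_bij_betw[OF glue_bij[OF \<zeta>]])
  finally show ?thesis .
qed

text \<open>The index set may be infinite, so the series is assembled coefficientwise; by
  \<open>finite_energy_bounded\<close> each coefficient is a finite sum.\<close>

definition limit_series :: "'c::field fps" where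
  "limit_series = Abs_fps (\<lambda>N. \<Sum>n | n \<in> limit_configs \<and> energy (of_int_family n) \<le> N.
      (fps_X ^ energy (of_int_family n) * limit_coeff n) $ N)"

text \<open>\<open>energy\<close> is a floor, so bounding it by \<open>N\<close> bounds half the
  norm only by \<open>N + 1\<close>.\<close>

lemma finite_energy_bounded: "finite {n\<in>limit_configs. energy (of_int_family n) \<le> N}"
proof (rule finite_subset[OF _ finite_limit_configs[of "2 * (real N + 1)"]])
  show "{n\<in>limit_configs. energy (of_int_family n) \<le> N}
      \<subseteq> {n\<in>limit_configs. bil (of_int_family n) (of_int_family n) \<le> 2 * (real N + 1)}"
  proof clarify
    fix n assume "energy (of_int_family n) \<le> N"
    then have "\<lfloor>1/2 * bil (of_int_family n) (of_int_family n)\<rfloor> \<le> int N" by (simp add: energy_def)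
    then have "1/2 * bil (of_int_family n) (of_int_family n) < real N + 1" by (simp add: floor_le_iff)
    moreover have "x \<le> 2 * y" if "1/2 * x < y" for x y :: real using that by simp
    ultimately show "bil (of_int_family n) (of_int_family n) \<le> 2 * (real N + 1)" by blast
  qed
qed

lemma has_sum_limit_series:
  "((\<lambda>\<zeta>. M_form X \<alpha> \<Lambda> (W_zeta \<zeta>) \<mu> (inverse (fls_X :: 'c::field fls))
      * M_level X \<alpha> \<Lambda> l (W_zeta \<zeta>) (inverse fls_X) / (\<Prod>a\<in>vertices X. qfact fls_X (\<zeta> a)))
    has_sum fps_to_fls limit_series) (zetas X \<alpha> \<Lambda>)"
  (is "(?f has_sum _) ?Z")
  unfolding has_sum_def
proof -
  let ?g = "\<lambda>n. fps_X ^ energy (of_int_family n) * limit_coeff n :: 'c fps"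
  \<comment> \<open>Empty outside the finite subsets of the index set, because
    \<open>graded_limit\<close> requires finite index sets for every \<open>Y\<close>; the filter
    does not see the difference.\<close>
  define S where "S Y = (if finite Y \<and> Y \<subseteq> ?Z then {n\<in>limit_configs. zeta_of n \<in> Y} else {})" for Y
  have z0: "\<forall>a. a \<notin> vertices X \<longrightarrow> \<zeta> a = 0" if "\<zeta> \<in> ?Z" for \<zeta>
    using that by (simp add: zetas_def)
  have SU: "{n\<in>limit_configs. zeta_of n \<in> Y} = (\<Union>\<zeta>\<in>Y. {n\<in>limit_configs. zeta_of n = \<zeta>})" for Y
    by auto
  have fin: "finite (S Y)" for Y
    unfolding S_def SU using finite_fiber[OF z0] by auto
  have sumS: "sum ?f Y = fps_to_fls (\<Sum>n\<in>S Y. ?g n)" if Y: "finite Y" "Y \<subseteq> ?Z" for Y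
  proof -
    have "sum ?f Y = (\<Sum>\<zeta>\<in>Y. fps_to_fls (\<Sum>n | n \<in> limit_configs \<and> zeta_of n = \<zeta>. ?g n))"
      using Y z0 by (intro sum.cong refl zeta_summand) blast
    also have "\<dots> = fps_to_fls (\<Sum>\<zeta>\<in>Y. \<Sum>n | n \<in> limit_configs \<and> zeta_of n = \<zeta>. ?g n)"
      by (simp only: fps_to_fls_sum)
    also have "(\<Sum>\<zeta>\<in>Y. \<Sum>n | n \<in> limit_configs \<and> zeta_of n = \<zeta>. ?g n) = (\<Sum>n\<in>S Y. ?g n)"
    proof -
      have "S Y = (\<Union>\<zeta>\<in>Y. {n\<in>limit_configs. zeta_of n = \<zeta>})" using Y by (auto simp: S_def)
      moreover have "finite {n\<in>limit_configs. zeta_of n = \<zeta>}" if "\<zeta> \<in> Y" for \<zeta>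
        using Y finite_fiber[OF z0] that by blast
      ultimately show ?thesis
        by (simp only:) (rule sum.UNION_disjoint[OF Y(1), symmetric]; auto)
    qed
    finally show ?thesis .
  qed
  have "((\<lambda>Y. fps_to_fls (\<Sum>n\<in>S Y. ?g n)) \<longlongrightarrow> fps_to_fls limit_series) (finite_subsets_at_top ?Z)"
    unfolding limit_series_def
  proof (rule graded_limit[where b = "\<lambda>_. limit_coeff"])
    show "finite {n\<in>limit_configs. energy (of_int_family n) \<le> N}" for N by (rule finite_energy_bounded)
    show "finite (S Y)" "S Y \<subseteq> limit_configs" for Y using fin by (auto simp: S_def)
    show "\<forall>\<^sub>F Y in finite_subsets_at_top ?Z. n \<in> S Y" if "n \<in> limit_configs" for n
      unfolding eventually_finite_subsets_at_top
      using zeta_of_mem[OF that] that by (intro exI[of _ "{zeta_of n}"]) (auto simp: S_def)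
  qed auto
  then show "(sum ?f \<longlongrightarrow> fps_to_fls limit_series) (finite_subsets_at_top ?Z)"
    by (rule Lim_transform_eventually)
      (rule eventually_finite_subsets_at_top_weakI, rule sumS[symmetric])
qed

end

section \<open>The minimizing configuration and convergence in L\<close>

locale scaling_limit = level_data +
  fixes r s :: nat
  assumes r: "r \<in> vertices X" and s: "s = e r"
begin

lemma s_pos: "s \<ge> 1"
  using e_pos[OF r] by (simp add: s)

abbreviation Ls :: "nat set" where "Ls \<equiv> integral_powers X \<alpha> \<Lambda> r"

text \<open>A version of \<open>m_zero\<close> with natural entries, as configurations require; the
  floor is exact for the admissible \<open>L\<close>.\<close>

definition ground :: "nat \<Rightarrow> nat \<times> nat \<Rightarrow> nat" where
  "ground L = (\<lambda>(a,k). if a \<in> vertices X \<and> k = e a then nat \<lfloor>real L * cartan_inv \<alpha> \<Lambda> r a\<rfloor> else 0)"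

lemma cartan_inv_pos: "a \<in> vertices X \<Longrightarrow> cartan_inv \<alpha> \<Lambda> r a > 0"
  using weight_inner_pos[OF r, of a] tnum_pos[OF r] by (simp add: cartan_inv_def)

lemma ground_top:
  assumes "L \<in> Ls" "a \<in> vertices X"
  shows "real (ground L (a, e a)) = real L * cartan_inv \<alpha> \<Lambda> r a"
proof -
  have "real L * cartan_inv \<alpha> \<Lambda> r a \<in> \<int>" using assms by (auto simp: integral_powers_def)
  then have "real_of_int \<lfloor>real L * cartan_inv \<alpha> \<Lambda> r a\<rfloor> = real L * cartan_inv \<alpha> \<Lambda> r a"
    by (rule of_int_floor_Ints)
  moreover have "real L * cartan_inv \<alpha> \<Lambda> r a \<ge> 0" using cartan_inv_pos[OF assms(2)] by simp
  ultimately show ?thesis using assms(2) by (simp add: ground_def)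
qed

lemma m_zero_eq:
  assumes "L \<in> Ls"
  shows "m_zero X \<alpha> \<Lambda> r s L = real \<circ> ground L"
proof (intro ext, clarify)
  fix a i
  show "m_zero X \<alpha> \<Lambda> r s L (a,i) = (real \<circ> ground L) (a,i)"
  proof (cases "a \<in> vertices X")
    case True
    have "tnum \<alpha> a * real s / tnum \<alpha> r = real (e a)"
      using real_tnat[OF True] real_tnat[OF r] tnum_pos[OF r] by (simp add: s e_def)
    then have "m_zero X \<alpha> \<Lambda> r s L (a,i) = (if i = e a then real L * cartan_inv \<alpha> \<Lambda> r a else 0)"
      using True e_pos[OF True] by (auto simp: m_zero_def)
    then show ?thesis using ground_top[OF assms True] True by (auto simp: ground_def)
  qed (auto simp: m_zero_def ground_def)
qed

lemma supported_ground: "supported (real \<circ> ground L)"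
proof -
  have "{y. (real \<circ> ground L) y \<noteq> 0} \<subseteq> (\<lambda>a. (a, e a)) ` vertices X"
    by (auto simp: ground_def split: if_splits)
  moreover have "(\<lambda>a. (a, e a)) ` vertices X \<subseteq> all_indices X"
    using e_pos by (auto simp: all_indices_def)
  moreover have "finite ((\<lambda>a. (a, e a)) ` vertices X)" by simp
  ultimately show ?thesis unfolding supported_def by (meson finite_subset order_trans)
qed

lemma vec_ground:
  assumes L: "L \<in> Ls"
  shows "vec (real \<circ> ground L) z = (if z < 6 * l then (real L * tnum \<alpha> r) *\<^sub>R \<Lambda> r else 0)"
proof -
  have "cum (real \<circ> ground L) a z = (if z < 6 * l then real L * cartan_inv \<alpha> \<Lambda> r a else 0)"
    if a: "a \<in> vertices X" for a
  proof -
    have "cum (real \<circ> ground L) a z = (\<Sum>k\<in>{e a}. if z < u a * k then (real \<circ> ground L) (a,k) else 0)"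
      by (rule cum_eq) (auto simp: ground_def split: if_splits)
    then show ?thesis using ground_top[OF L a] by (simp add: u_e[OF a])
  qed
  then have "vec (real \<circ> ground L) z = (\<Sum>a\<in>vertices X. (tnum \<alpha> a *
      (if z < 6 * l then real L * cartan_inv \<alpha> \<Lambda> r a else 0)) *\<^sub>R \<alpha> a)"
    unfolding vec_def by (intro sum.cong) auto
  also have "\<dots> = (if z < 6 * l then
      (real L * tnum \<alpha> r) *\<^sub>R (\<Sum>a\<in>vertices X. (tnum \<alpha> a * (\<Lambda> r \<bullet> \<Lambda> a)) *\<^sub>R \<alpha> a) else 0)"
    by (simp add: cartan_inv_def scaleR_sum_right mult_ac)
  also have "(\<Sum>a\<in>vertices X. (tnum \<alpha> a * (\<Lambda> r \<bullet> \<Lambda> a)) *\<^sub>R \<alpha> a) = \<Lambda> r"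
    using root_expansion[OF weight_in_rspan[OF r]] by simp
  finally show ?thesis .
qed

lemma real_s: "real s = tnum \<alpha> r * real l"
  using real_tnat[OF r] by (simp add: s e_def)

lemma supp_W_pow: "L \<ge> 1 \<Longrightarrow> supp (all_indices X) (W_pow r s L) = {(r,s)}"
  using r s_pos by (auto simp: supp_def W_pow_def all_indices_def split: if_splits)

text \<open>The step function of \<open>ground\<close> points along \<open>\<Lambda> r\<close>, so
  it pairs only with \<open>\<alpha> r\<close>, and the overlap of [0, i/t_r) with [0, l) is
  \<open>min i s / t_r\<close>. Hence all vacancy numbers of the minimizing configuration
  vanish.\<close>

lemma source_ground:
  assumes L: "L \<in> Ls" and a: "a \<in> vertices X"
  shows "source (all_indices X) (W_pow r s L) a i = - pot (real \<circ> ground L) a i"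
proof -
  have L1: "L \<ge> 1" using L by (simp add: integral_powers_def)
  have "- pot (real \<circ> ground L) a i = tnum \<alpha> a / 6 * (\<Sum>z<u a * i. if z < 6 * l
      then real L * tnum \<alpha> r * (\<alpha> a \<bullet> \<Lambda> r) else 0)"
    by (simp add: pot_def vec_ground[OF L] if_distrib cong: if_cong)
  also have "\<dots> = tnum \<alpha> a / 6 * (real (min (u a * i) (6 * l)) * (real L * tnum \<alpha> r * (\<alpha> a \<bullet> \<Lambda> r)))"
    by (simp only: sum_below_min real_scaleR_def)
  also have "\<dots> = (if a = r then real L * min (real i) (real s) else 0)"
  proof (cases "a = r")
    case True
    have "min (u r * i) (6 * l) = u r * min i s"
      unfolding s u_e[OF r, symmetric] by (rule nat_mult_min_right[symmetric])
    then show ?thesis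
      using tnum_pos[OF r] by (simp add: True root_weight[OF r r] real_u[OF r] of_nat_min)
  qed (simp add: root_weight[OF a r])
  also have "\<dots> = source (all_indices X) (W_pow r s L) a i"
    unfolding source_def supp_W_pow[OF L1] by (simp add: W_pow_def)
  finally show ?thesis by simp
qed

lemma charge_shift:
  assumes L: "L \<in> Ls" and m: "supported m"
  shows "charge \<alpha> (all_indices X) (W_pow r s L) m = 1/2 * bil m m - bil m (real \<circ> ground L)"
proof -
  have L1: "L \<ge> 1" using L by (simp add: integral_powers_def)
  have "charge \<alpha> (all_indices X) (W_pow r s L) m
      = 1/2 * bil m m - (\<Sum>y | m y \<noteq> 0. source (all_indices X) (W_pow r s L) (fst y) (snd y) * m y)"
    by (rule charge_eq) (use m L1 in \<open>simp_all add: supported_def supp_W_pow\<close>)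
  also have "(\<Sum>y | m y \<noteq> 0. source (all_indices X) (W_pow r s L) (fst y) (snd y) * m y)
      = (\<Sum>y | m y \<noteq> 0. - (m y * pot (real \<circ> ground L) (fst y) (snd y)))"
  proof (rule sum.cong[OF refl])
    fix y assume "y \<in> {y. m y \<noteq> 0}"
    then have "fst y \<in> vertices X" using supportedD(3)[OF m] by blast
    then show "source (all_indices X) (W_pow r s L) (fst y) (snd y) * m y
        = - (m y * pot (real \<circ> ground L) (fst y) (snd y))"
      using source_ground[OF L] by simp
  qed
  also have "\<dots> = bil m (real \<circ> ground L)"
    unfolding bil_pot[OF m supported_ground] by (rule sum_negf)
  finally show ?thesis .
qed

lemma bil_ground:
  assumes L: "L \<in> Ls"
  shows "bil (real \<circ> ground L) (real \<circ> ground L) = real L ^ 2 * real s * cartan_inv \<alpha> \<Lambda> r r"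
proof -
  have "bil (real \<circ> ground L) (real \<circ> ground L)
      = 1/6 * (\<Sum>z<6 * l. vec (real \<circ> ground L) z \<bullet> vec (real \<circ> ground L) z)"
    by (rule bil_vec[OF supported_ground supported_ground]) (simp add: vec_ground[OF L])
  also have "\<dots> = 1/6 * (\<Sum>z<6 * l. (real L * tnum \<alpha> r)\<^sup>2 * (\<Lambda> r \<bullet> \<Lambda> r))"
    by (intro arg_cong[where f = "\<lambda>x. 1/6 * x"] sum.cong)
      (simp_all add: vec_ground[OF L] power2_eq_square)
  finally show ?thesis by (simp add: real_s cartan_inv_def power2_eq_square)
qed

lemma charge_ground:
  assumes L: "L \<in> Ls"
  shows "charge \<alpha> (all_indices X) (W_pow r s L) (real \<circ> ground L)
    = - (1/2 * bil (real \<circ> ground L) (real \<circ> ground L))"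
  using charge_shift[OF L supported_ground] by simp

lemma charge_ground_Ints:
  "charge \<alpha> (all_indices X) (W_pow r s L) (real \<circ> ground L) \<in> \<int>"
  by (rule charge_Ints[OF sr order_refl]) (use supported_ground in \<open>simp add: supported_def\<close>)

text \<open>Completing the square: by \<open>charge_shift\<close> the linear part of the charge is
  the pairing with \<open>ground\<close>, so the terms mixing \<open>n\<close> and
  \<open>ground\<close> cancel.\<close>

lemma charge_ground_add:
  assumes L: "L \<in> Ls" and n: "supported n"
  shows "charge \<alpha> (all_indices X) (W_pow r s L) (\<lambda>y. n y + (real \<circ> ground L) y)
    = 1/2 * bil n n + charge \<alpha> (all_indices X) (W_pow r s L) (real \<circ> ground L)"
  unfolding charge_shift[OF L supported_add[OF n supported_ground]] charge_ground[OF L]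
    bil_add[OF n supported_ground] by (simp add: field_simps)

lemma wt_ground:
  assumes L: "L \<in> Ls"
  shows "wt (real \<circ> ground L) = real (s * L) *\<^sub>R \<Lambda> r"
proof -
  have "wt (real \<circ> ground L) = (1/6) *\<^sub>R (\<Sum>z<6 * l. vec (real \<circ> ground L) z)"
    by (rule wt_vec[OF supported_ground]) (simp add: vec_ground[OF L])
  also have "\<dots> = (1/6) *\<^sub>R (\<Sum>z<6 * l. (real L * tnum \<alpha> r) *\<^sub>R \<Lambda> r)"
    by (intro arg_cong[where f = "\<lambda>x. (1/6) *\<^sub>R x"] sum.cong) (simp_all add: vec_ground[OF L])
  finally show ?thesis by (simp add: sum_constant_scaleR real_s mult_ac)
qed

text \<open>The differences that occur for a given \<open>L\<close>; the only trace of
  \<open>L\<close> is the lower bound at the cut, which recedes as \<open>L\<close> grows. The value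
  outside \<open>Ls\<close> keeps all sets finite for \<open>graded_limit\<close>.\<close>

definition shifted :: "nat \<Rightarrow> (nat \<times> nat \<Rightarrow> int) set" where
  "shifted L = (if L \<in> Ls then
     {n\<in>limit_configs. \<forall>a\<in>vertices X. n (a, e a) + int (ground L (a, e a)) \<ge> 0} else {})"

lemma ground_regular: "k \<noteq> e a \<Longrightarrow> ground L (a,k) = 0" "a \<notin> vertices X \<Longrightarrow> ground L (a,k) = 0"
  by (auto simp: ground_def)

lemma mem_configurations_W_pow:
  assumes L: "L \<in> Ls" and m: "\<And>y. int (m y) = n y + int (ground L y)"
  shows "m \<in> configurations \<alpha> \<Lambda> (all_indices X) (W_pow r s L) \<mu> \<longleftrightarrow> n \<in> shifted L"
    and "n \<in> shifted L \<Longrightarrow> a \<in> vertices X \<Longrightarrow>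
      vacancy \<alpha> (all_indices X) (W_pow r s L) (real \<circ> m) a i = pot (of_int_family n) a i"
proof -
  let ?H = "all_indices X"
  have L1: "L \<ge> 1" using L by (simp add: integral_powers_def)
  have mr: "real (m y) = real_of_int (n y) + real (ground L y)" for y
    using m[of y] by (metis of_int_add of_int_of_nat_eq)
  then have mn: "real \<circ> m = (\<lambda>y. of_int_family n y + (real \<circ> ground L) y)" by (auto simp: fun_eq_iff)
  have nm: "of_int_family n = (\<lambda>y. (real \<circ> m) y + - (real \<circ> ground L) y)" by (auto simp: fun_eq_iff mr)
  have "supported (\<lambda>y. - (real \<circ> ground L) y)" using supported_ground[of L] by (simp add: supported_def)
  then have supp: "supported (real \<circ> m) \<longleftrightarrow> supported (of_int_family n)"
    using supported_add[of "of_int_family n" "real \<circ> ground L"] supported_add[of "real \<circ> m" "\<lambda>y. - (real \<circ> ground L) y"]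
      supported_ground[of L] mn nm by metis
  have vac: "source ?H (W_pow r s L) a i + pot (real \<circ> m) a i = pot (of_int_family n) a i"
    if "supported (of_int_family n)" "a \<in> vertices X" for a i
    using source_ground[OF L that(2)] unfolding mn pot_add[OF that(1) supported_ground] by simp
  have wt: "wt (real \<circ> m) = wt (of_int_family n) + real (s * L) *\<^sub>R \<Lambda> r" if "supported (of_int_family n)"
    unfolding mn wt_add[OF that supported_ground] wt_ground[OF L] ..
  have w: "(\<Sum>(a,i)\<in>supp ?H (W_pow r s L). real (i * W_pow r s L (a,i)) *\<^sub>R \<Lambda> a) = real (s * L) *\<^sub>R \<Lambda> r"
    unfolding supp_W_pow[OF L1] by (simp add: W_pow_def)
  have sub: "supported (real \<circ> m) \<Longrightarrow> {y. m y \<noteq> 0} \<subseteq> ?H" by (simp add: supported_def)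
  have pos: "(\<forall>a\<in>vertices X. \<forall>k\<ge>1. k \<noteq> e a \<longrightarrow> n (a,k) \<ge> 0)"
    "\<forall>a\<in>vertices X. n (a, e a) + int (ground L (a, e a)) \<ge> 0"
    using m by (metis ground_regular(1) add.right_neutral of_nat_0 of_nat_0_le_iff, metis of_nat_0_le_iff)
  \<comment> \<open>With \<open>y\<close> the vector \<open>s L \<Lambda> r\<close>, which is both
    the weight of \<open>ground\<close> and the weight of the data, \<open>L\<close> disappears from
    the weight condition.\<close>
  have eqw: "x + y = y - z \<longleftrightarrow> x = - z" for x y z :: 'a
  proof -
    have "y - z = - z + y" by simp
    then show ?thesis by (simp only: add_right_cancel)
  qed
  show "m \<in> configurations \<alpha> \<Lambda> ?H (W_pow r s L) \<mu> \<longleftrightarrow> n \<in> shifted L"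
  proof (cases "supported (of_int_family n)")
    case True
    have "(\<forall>(a,i)\<in>?H. source ?H (W_pow r s L) a i + pot (real \<circ> m) a i \<ge> 0) \<longleftrightarrow>
        (\<forall>a\<in>vertices X. \<forall>i\<ge>1. pot (of_int_family n) a i \<ge> 0)"
      using vac[OF True] by (auto simp: all_indices_def)
    then show ?thesis
      unfolding configurations_eq[OF order_refl] w mem_Collect_eq shifted_def limit_configs_def
        wt[OF True] eqw
      using True supp sub pos L by simp
  next
    case False
    then show ?thesis
      unfolding configurations_eq[OF order_refl] shifted_def limit_configs_def using supp by auto
  qed
  show "vacancy \<alpha> ?H (W_pow r s L) (real \<circ> m) a i = pot (of_int_family n) a i"
    if n: "n \<in> shifted L" and a: "a \<in> vertices X"
  proof -
    have sn: "supported (of_int_family n)" using n L by (simp add: shifted_def limit_configs_def)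
    have "{y. (real \<circ> m) y \<noteq> 0} \<subseteq> ?H" using sub supp sn by simp
    then show ?thesis using vacancy_eq[of "real \<circ> m" ?H a] supp sn a vac[OF sn a] by simp
  qed
qed

definition level_coeff :: "nat \<Rightarrow> (nat \<times> nat \<Rightarrow> int) \<Rightarrow> 'c::field fps" where
  "level_coeff L n = regular_part n *
     (\<Prod>a\<in>vertices X. qbinom_fps (zeta_of n a) (nat (n (a, e a) + int (ground L (a, e a)))))"

lemma shifted_witness:
  assumes "L \<in> Ls" "n \<in> shifted L"
  shows "int (nat (n y + int (ground L y))) = n y + int (ground L y)"
proof -
  have n: "n \<in> limit_configs" "\<forall>a\<in>vertices X. n (a, e a) + int (ground L (a, e a)) \<ge> 0"
    using assms by (auto simp: shifted_def)
  have "n y + int (ground L y) \<ge> 0"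
  proof (cases "n y = 0")
    case False
    then have y: "fst y \<in> vertices X" "1 \<le> snd y"
      using n(1) supportedD(3,4)[of "of_int_family n" y] by (auto simp: limit_configs_def)
    show ?thesis
    proof (cases "snd y = e (fst y)")
      case True
      then show ?thesis using n(2) y by (metis prod.collapse)
    next
      case False
      then have "n y \<ge> 0" using n(1) y by (cases y) (auto simp: limit_configs_def)
      then show ?thesis by simp
    qed
  qed simp
  then show ?thesis by simp
qed

lemma finite_shifted: "finite (shifted L)"
proof (cases "L \<in> Ls")
  case True
  define f where "f m = (\<lambda>y. int (m y) - int (ground L y))" for m
  have "shifted L \<subseteq> f ` configurations \<alpha> \<Lambda> (all_indices X) (W_pow r s L) \<mu>"
  proof
    fix n assume n: "n \<in> shifted L"
    note w = shifted_witness[OF True n]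
    have "(\<lambda>y. nat (n y + int (ground L y))) \<in> configurations \<alpha> \<Lambda> (all_indices X) (W_pow r s L) \<mu>"
      using mem_configurations_W_pow(1)[OF True, of "\<lambda>y. nat (n y + int (ground L y))" n] w n by blast
    moreover have "n = f (\<lambda>y. nat (n y + int (ground L y)))"
      unfolding f_def w by simp
    ultimately show "n \<in> f ` configurations \<alpha> \<Lambda> (all_indices X) (W_pow r s L) \<mu>" by blast
  qed
  then show ?thesis by (rule finite_subset) (intro finite_imageI finite_configurations order_refl)
qed (simp add: shifted_def)

lemma summand_W_pow:
  assumes L: "L \<in> Ls" and n: "n \<in> shifted L" and m: "\<And>y. int (m y) = n y + int (ground L y)"
  shows "fls_X powi (- \<lfloor>charge \<alpha> (all_indices X) (W_pow r s L) (real \<circ> ground L)\<rfloor>) *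
      (fls_X powi \<lfloor>charge \<alpha> (all_indices X) (W_pow r s L) (real \<circ> m)\<rfloor> *
      (\<Prod>(a,i)\<in>supp (all_indices X) m.
         qbinom fls_X \<lfloor>vacancy \<alpha> (all_indices X) (W_pow r s L) (real \<circ> m) a i\<rfloor> (m (a,i))))
    = (fps_to_fls (fps_X ^ energy (of_int_family n) * level_coeff L n) :: 'c::field fls)"
proof -
  let ?H = "all_indices X" and ?c = "charge \<alpha> (all_indices X) (W_pow r s L)"
  have lc: "n \<in> limit_configs" and top: "\<forall>a\<in>vertices X. n (a, e a) + int (ground L (a, e a)) \<ge> 0"
    using n L by (auto simp: shifted_def)
  have sn: "supported (of_int_family n)" using lc by (simp add: limit_configs_def)
  have mr: "real (m y) = real_of_int (n y) + real (ground L y)" for y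
    using m[of y] by (metis of_int_add of_int_of_nat_eq)
  then have mn: "real \<circ> m = (\<lambda>y. of_int_family n y + (real \<circ> ground L) y)" by (auto simp: fun_eq_iff)
  have sm: "supported (real \<circ> m)" unfolding mn by (rule supported_add[OF sn supported_ground])
  have mH: "{y. m y \<noteq> 0} \<subseteq> ?H" and fm: "finite {y. m y \<noteq> 0}" using sm by (simp_all add: supported_def)
  have eqc: "?c (real \<circ> m) = 1/2 * bil (of_int_family n) (of_int_family n) + ?c (real \<circ> ground L)"
    unfolding mn by (rule charge_ground_add[OF L sn])
  have "?c (real \<circ> m) \<in> \<int>" by (rule charge_Ints[OF sr order_refl fm])
  then have "real_of_int \<lfloor>?c (real \<circ> m)\<rfloor> = ?c (real \<circ> m)" by (rule of_int_floor_Ints)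
  moreover have "real_of_int \<lfloor>?c (real \<circ> ground L)\<rfloor> = ?c (real \<circ> ground L)"
    by (rule of_int_floor_Ints[OF charge_ground_Ints])
  ultimately have "real_of_int (- \<lfloor>?c (real \<circ> ground L)\<rfloor> + \<lfloor>?c (real \<circ> m)\<rfloor>)
      = - ?c (real \<circ> ground L) + ?c (real \<circ> m)"
    by (simp only: of_int_add of_int_minus)
  then have h: "1/2 * bil (of_int_family n) (of_int_family n)
      = real_of_int (- \<lfloor>?c (real \<circ> ground L)\<rfloor> + \<lfloor>?c (real \<circ> m)\<rfloor>)"
    unfolding eqc by simp
  have "0 \<le> real_of_int (- \<lfloor>?c (real \<circ> ground L)\<rfloor> + \<lfloor>?c (real \<circ> m)\<rfloor>)"
    using bil_nonneg[OF sn] unfolding h[symmetric] by simp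
  then have en: "int (energy (of_int_family n)) = - \<lfloor>?c (real \<circ> ground L)\<rfloor> + \<lfloor>?c (real \<circ> m)\<rfloor>"
    unfolding energy_def h floor_of_int by simp
  define f where "f y = (qbinom fls_X \<lfloor>pot (of_int_family n) (fst y) (snd y)\<rfloor> (m y) :: 'c fls)" for y
  have p0: "pot (of_int_family n) a i \<ge> 0" if "a \<in> vertices X" "1 \<le> i" for a i
    using lc that by (simp add: limit_configs_def)
  have ff: "f y = fps_to_fls (qbinom_fps (nat \<lfloor>pot (of_int_family n) (fst y) (snd y)\<rfloor>) (m y))"
    if "fst y \<in> vertices X" "1 \<le> snd y" for y
    using p0[OF that] unfolding f_def qbinom_fls_X[symmetric] by simp
  have "(\<Prod>(a,i)\<in>supp ?H m. qbinom fls_X \<lfloor>vacancy \<alpha> ?H (W_pow r s L) (real \<circ> m) a i\<rfloor> (m (a,i)))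
      = prod f {y. m y \<noteq> 0}"
    unfolding supp_eq[OF mH]
  proof (rule prod.cong[OF refl])
    fix y assume "y \<in> {y. m y \<noteq> 0}"
    then have "fst y \<in> vertices X" using supportedD(3)[OF sm, of y] by simp
    then show "(case y of (a,i) \<Rightarrow> qbinom fls_X \<lfloor>vacancy \<alpha> ?H (W_pow r s L) (real \<circ> m) a i\<rfloor> (m (a,i))) = f y"
      using mem_configurations_W_pow(2)[OF L m n, of "fst y" "snd y"] by (cases y) (simp add: f_def)
  qed
  also have "{y. m y \<noteq> 0} = {y. m y \<noteq> 0 \<and> snd y \<noteq> e (fst y)} \<union> {y. m y \<noteq> 0 \<and> snd y = e (fst y)}"
    by auto
  also have "prod f \<dots> = prod f {y. m y \<noteq> 0 \<and> snd y \<noteq> e (fst y)} * prod f {y. m y \<noteq> 0 \<and> snd y = e (fst y)}"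
    by (rule prod.union_disjoint) (auto intro: finite_subset[OF _ fm])
  also have "prod f {y. m y \<noteq> 0 \<and> snd y \<noteq> e (fst y)} = fps_to_fls (regular_part n)"
    unfolding regular_part_def fps_to_fls_prod
  proof (rule prod.cong)
    have mn0: "int (m y) = n y" if "snd y \<noteq> e (fst y)" for y
      using m[of y] ground_regular(1)[OF that, of L] by simp
    then show "{y. m y \<noteq> 0 \<and> snd y \<noteq> e (fst y)} = {y. n y \<noteq> 0 \<and> snd y \<noteq> e (fst y)}"
      by (metis of_nat_eq_0_iff)
    fix y assume y: "y \<in> {y. n y \<noteq> 0 \<and> snd y \<noteq> e (fst y)}"
    then have "m y = nat (n y)" using mn0[of y] by simp
    then show "f y = fps_to_fls (qbinom_fps (nat \<lfloor>pot (of_int_family n) (fst y) (snd y)\<rfloor>) (nat (n y)))"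
      using ff[of y] supportedD(3,4)[OF sn, of y] y by simp
  qed
  \<comment> \<open>Vertices whose entry at the cut is 0 contribute the factor 1, so the product may
    run over all vertices.\<close>
  also have "prod f {y. m y \<noteq> 0 \<and> snd y = e (fst y)} = prod f ((\<lambda>a. (a, e a)) ` vertices X)"
  proof (rule prod.mono_neutral_left)
    show "finite ((\<lambda>a. (a, e a)) ` vertices X)" by simp
    show "{y. m y \<noteq> 0 \<and> snd y = e (fst y)} \<subseteq> (\<lambda>a. (a, e a)) ` vertices X"
    proof
      fix y assume "y \<in> {y. m y \<noteq> 0 \<and> snd y = e (fst y)}"
      then have "fst y \<in> vertices X" "y = (fst y, e (fst y))"
        using supportedD(3)[OF sm, of y] by (auto simp: prod_eq_iff)
      then show "y \<in> (\<lambda>a. (a, e a)) ` vertices X" by blast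
    qed
    show "\<forall>y\<in>(\<lambda>a. (a, e a)) ` vertices X - {y. m y \<noteq> 0 \<and> snd y = e (fst y)}. f y = 1"
    proof
      fix y assume "y \<in> (\<lambda>a. (a, e a)) ` vertices X - {y. m y \<noteq> 0 \<and> snd y = e (fst y)}"
      then have "m y = 0" "pot (of_int_family n) (fst y) (snd y) \<ge> 0" using p0 e_pos by auto
      then show "f y = 1" by (simp add: f_def qbinom_0_right)
    qed
  qed
  also have "\<dots> = (\<Prod>a\<in>vertices X. f (a, e a))"
    by (subst prod.reindex) (auto simp: inj_on_def)
  also have "\<dots> = (\<Prod>a\<in>vertices X. fps_to_fls (qbinom_fps (zeta_of n a) (nat (n (a, e a) + int (ground L (a, e a))))))"
  proof (rule prod.cong[OF refl])
    fix a assume a: "a \<in> vertices X"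
    have "m (a, e a) = nat (n (a, e a) + int (ground L (a, e a)))" using m[of "(a, e a)"] by simp
    then show "f (a, e a) = fps_to_fls (qbinom_fps (zeta_of n a) (nat (n (a, e a) + int (ground L (a, e a)))))"
      using ff[of "(a, e a)"] a e_pos[OF a] by (simp add: zeta_of_def)
  qed
  also have "fps_to_fls (regular_part n) * \<dots> = fps_to_fls (level_coeff L n :: 'c fps)"
    by (simp only: level_coeff_def fls_times_fps_to_fls fps_to_fls_prod)
  finally have P: "(\<Prod>(a,i)\<in>supp ?H m. qbinom fls_X \<lfloor>vacancy \<alpha> ?H (W_pow r s L) (real \<circ> m) a i\<rfloor> (m (a,i)))
      = fps_to_fls (level_coeff L n :: 'c fps)" .
  have "(fls_X :: 'c fls) powi (- \<lfloor>?c (real \<circ> ground L)\<rfloor>) * fls_X powi \<lfloor>?c (real \<circ> m)\<rfloor>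
      = fls_X powi int (energy (of_int_family n))"
    unfolding en by (rule power_int_add[symmetric]) simp
  also have "\<dots> = fps_to_fls (fps_X ^ energy (of_int_family n))"
    by (simp only: power_int_of_nat fps_to_fls_power fps_X_to_fls)
  finally show ?thesis
    unfolding P by (simp only: mult.assoc[symmetric] fls_times_fps_to_fls)
qed

lemma M_form_W_pow:
  assumes L: "L \<in> Ls"
  shows "fls_X powi (- \<lfloor>charge \<alpha> (all_indices X) (W_pow r s L) (real \<circ> ground L)\<rfloor>) *
      M_form X \<alpha> \<Lambda> (W_pow r s L) \<mu> (fls_X :: 'c::field fls)
    = fps_to_fls (\<Sum>n\<in>shifted L. fps_X ^ energy (of_int_family n) * level_coeff L n)"
  unfolding M_form_def fermionic_form_def sum_distrib_left fps_to_fls_sum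
proof (rule sum.reindex_bij_witness[of _ "\<lambda>n y. nat (n y + int (ground L y))" "\<lambda>m y. int (m y) - int (ground L y)"])
  fix m assume m: "m \<in> configurations \<alpha> \<Lambda> (all_indices X) (W_pow r s L) \<mu>"
  let ?n = "\<lambda>y. int (m y) - int (ground L y)"
  show "(\<lambda>y. nat (?n y + int (ground L y))) = m" by auto
  have mn: "\<And>y. int (m y) = ?n y + int (ground L y)" by simp
  then show n: "?n \<in> shifted L" using mem_configurations_W_pow(1)[OF L, of m ?n] m by blast
  show "fps_to_fls (fps_X ^ energy (of_int_family ?n) * level_coeff L ?n)
      = fls_X powi (- \<lfloor>charge \<alpha> (all_indices X) (W_pow r s L) (real \<circ> ground L)\<rfloor>) *
      ((fls_X :: 'c fls) powi \<lfloor>charge \<alpha> (all_indices X) (W_pow r s L) (real \<circ> m)\<rfloor> *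
      (\<Prod>(a,i)\<in>supp (all_indices X) m.
         qbinom fls_X \<lfloor>vacancy \<alpha> (all_indices X) (W_pow r s L) (real \<circ> m) a i\<rfloor> (m (a,i))))"
    by (rule summand_W_pow[OF L n mn, symmetric])
next
  fix n assume n: "n \<in> shifted L"
  note w = shifted_witness[OF L n]
  show "(\<lambda>y. int (nat (n y + int (ground L y))) - int (ground L y)) = n" unfolding w by simp
  show "(\<lambda>y. nat (n y + int (ground L y))) \<in> configurations \<alpha> \<Lambda> (all_indices X) (W_pow r s L) \<mu>"
    using mem_configurations_W_pow(1)[OF L, of "\<lambda>y. nat (n y + int (ground L y))" n] w n by blast
qed

text \<open>Strict positivity of the inverse Cartan matrix enters here: each entry of
  \<open>ground\<close> at the cut grows linearly in \<open>L\<close> and outweighs any fixed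
  \<open>n\<close>.\<close>

lemma eventually_large:
  "\<forall>\<^sub>F L in inf sequentially (principal Ls). L \<in> Ls \<and>
     (\<forall>a\<in>vertices X. n (a, e a) + int (ground L (a, e a)) \<ge> int N)"
  unfolding eventually_inf_principal
proof -
  have "\<forall>\<^sub>F L in sequentially. L \<in> Ls \<longrightarrow> n (a, e a) + int (ground L (a, e a)) \<ge> int N"
    if a: "a \<in> vertices X" for a
  proof -
    obtain k where k: "real_of_int (int N - n (a, e a)) < real k * cartan_inv \<alpha> \<Lambda> r a"
      using ex_less_of_nat_mult[OF cartan_inv_pos[OF a]] by blast
    show ?thesis
    proof (rule eventually_sequentiallyI[of k], rule impI)
      fix L assume "k \<le> L" and L: "L \<in> Ls"
      then have "real k * cartan_inv \<alpha> \<Lambda> r a \<le> real L * cartan_inv \<alpha> \<Lambda> r a"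
        using cartan_inv_pos[OF a] by (intro mult_right_mono) auto
      then have "real_of_int (int N - n (a, e a)) < real (ground L (a, e a))"
        using k ground_top[OF L a] by linarith
      then show "n (a, e a) + int (ground L (a, e a)) \<ge> int N" by linarith
    qed
  qed
  then have "\<forall>\<^sub>F L in sequentially. \<forall>a\<in>vertices X. L \<in> Ls \<longrightarrow> n (a, e a) + int (ground L (a, e a)) \<ge> int N"
    by (intro eventually_ball_finite) auto
  then show "\<forall>\<^sub>F L in sequentially. L \<in> Ls \<longrightarrow> L \<in> Ls \<and>
      (\<forall>a\<in>vertices X. n (a, e a) + int (ground L (a, e a)) \<ge> int N)"
    by eventually_elim blast
qed

text \<open>Once the entries at the cut are at least \<open>N\<close>, each binomial there equals
  its limit up to a factor that is 1 modulo \<open>fps_X ^ Suc N\<close>.\<close>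

lemma level_coeff_nth:
  assumes "\<forall>a\<in>vertices X. n (a, e a) + int (ground L (a, e a)) \<ge> int N"
  shows "level_coeff L n $ N = (limit_coeff n :: 'c::field fps) $ N"
proof -
  define M where "M a = nat (n (a, e a) + int (ground L (a, e a)))" for a
  have M: "M a \<ge> N" if "a \<in> vertices X" for a using bspec[OF assms that] unfolding M_def by linarith
  have "\<forall>a. \<exists>h. qbinom_fps (zeta_of n a) (M a) = inverse (qfact_fps (zeta_of n a)) * h \<and>
      fps_X ^ Suc (M a) dvd (h :: 'c fps) - 1"
    using qbinom_fps_limit by blast
  then obtain h :: "nat \<Rightarrow> 'c fps" where h: "\<And>a. qbinom_fps (zeta_of n a) (M a) = inverse (qfact_fps (zeta_of n a)) * h a"
    "\<And>a. fps_X ^ Suc (M a) dvd h a - 1"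
    by metis
  have "level_coeff L n = limit_coeff n * (\<Prod>a\<in>vertices X. h a)"
    unfolding level_coeff_def limit_coeff_def M_def[symmetric] h(1) prod.distrib by (simp only: mult.assoc)
  moreover have "fps_X ^ Suc N dvd (\<Prod>a\<in>vertices X. h a) - 1"
  proof (rule dvd_prod_minus_1)
    fix a assume "a \<in> vertices X"
    then have "(fps_X ^ Suc N :: 'c fps) dvd fps_X ^ Suc (M a)" using M by (intro le_imp_power_dvd) auto
    then show "fps_X ^ Suc N dvd h a - 1" using h(2) dvd_trans by blast
  qed
  ultimately show ?thesis by (simp only: fps_nth_mult_near_1)
qed

lemma tendsto_limit_series:
  "((\<lambda>L. fls_X powi (- \<lfloor>charge \<alpha> (all_indices X) (W_pow r s L) (m_zero X \<alpha> \<Lambda> r s L)\<rfloor>) *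
      M_form X \<alpha> \<Lambda> (W_pow r s L) \<mu> (fls_X :: 'c::field fls))
    \<longlongrightarrow> fps_to_fls limit_series) (inf sequentially (principal Ls))"
proof (rule Lim_transform_eventually)
  show "((\<lambda>L. fps_to_fls (\<Sum>n\<in>shifted L. fps_X ^ energy (of_int_family n) * level_coeff L n))
      \<longlongrightarrow> fps_to_fls (limit_series :: 'c fps)) (inf sequentially (principal Ls))"
    unfolding limit_series_def
  proof (rule graded_limit)
    show "finite {n\<in>limit_configs. energy (of_int_family n) \<le> N}" for N by (rule finite_energy_bounded)
    show "finite (shifted L)" "shifted L \<subseteq> limit_configs" for L
      using finite_shifted by (auto simp: shifted_def)
    show "\<forall>\<^sub>F L in inf sequentially (principal Ls). n \<in> shifted L" if "n \<in> limit_configs" for n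
      using eventually_large[of 0 n] by eventually_elim (use that in \<open>simp add: shifted_def\<close>)
    show "\<forall>\<^sub>F L in inf sequentially (principal Ls). level_coeff L n $ N = (limit_coeff n :: 'c fps) $ N" for n N
      using eventually_large[of N n] by eventually_elim (simp add: level_coeff_nth)
  qed
  show "\<forall>\<^sub>F L in inf sequentially (principal Ls).
      fps_to_fls (\<Sum>n\<in>shifted L. fps_X ^ energy (of_int_family n) * level_coeff L n)
      = fls_X powi (- \<lfloor>charge \<alpha> (all_indices X) (W_pow r s L) (m_zero X \<alpha> \<Lambda> r s L)\<rfloor>) *
      M_form X \<alpha> \<Lambda> (W_pow r s L) \<mu> (fls_X :: 'c fls)"
    unfolding eventually_inf_principal
    by (intro always_eventually allI impI) (simp only: m_zero_eq M_form_W_pow)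
qed

end

text \<open>The series \<open>F\<close> expresses the equality: it is the limit of one side and the
  sum of the other, both in the metric of formal Laurent series, which for power series is
  coefficientwise convergence.\<close>

theorem theorem5p4:
  fixes X :: dynkin and \<alpha> \<Lambda> :: "nat \<Rightarrow> 'v::real_inner" and \<mu> :: 'v and r s :: nat
  assumes "finite_type X" and "simple_roots X \<alpha>" and "fundamental_weights X \<alpha> \<Lambda>"
    and "r \<in> vertices X" and "s \<ge> 1" and "\<mu> \<in> int_span X \<Lambda>"
    and "real s / tnum \<alpha> r \<in> \<int>"
  shows "let q = (fls_X :: rat fls);
             c = (\<lambda>L. charge \<alpha> (all_indices X) (W_pow r s L) (m_zero X \<alpha> \<Lambda> r s L))
         in (\<forall>L\<in>integral_powers X \<alpha> \<Lambda> r.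
               c L = - (real L ^ 2 * real s * cartan_inv \<alpha> \<Lambda> r r / 2) \<and> c L \<in> \<int>) \<and>
            (\<exists>F :: rat fps.
               ((\<lambda>L. q powi (- \<lfloor>c L\<rfloor>) * M_form X \<alpha> \<Lambda> (W_pow r s L) \<mu> q)
                 \<longlongrightarrow> fps_to_fls F)
                 (inf sequentially (principal (integral_powers X \<alpha> \<Lambda> r))) \<and>
               ((\<lambda>\<zeta>. M_form X \<alpha> \<Lambda> (W_zeta \<zeta>) \<mu> (inverse q)
                     * M_level X \<alpha> \<Lambda> (nat \<lfloor>real s / tnum \<alpha> r\<rfloor>) (W_zeta \<zeta>) (inverse q)
                     / (\<Prod>a\<in>vertices X. qfact q (\<zeta> a)))
                 has_sum fps_to_fls F) (zetas X \<alpha> \<Lambda>))"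
proof -
  interpret R: root_data X \<alpha> \<Lambda> using assms(1-3) by unfold_locales
  define l where "l = nat \<lfloor>real s / tnum \<alpha> r\<rfloor>"
  have "real s / tnum \<alpha> r > 0" using R.tnum_pos[OF assms(4)] assms(5) by simp
  then have l: "real l = real s / tnum \<alpha> r"
    unfolding l_def using of_int_floor_Ints[OF assms(7)] by linarith
  have "l \<ge> 1" using l \<open>real s / tnum \<alpha> r > 0\<close> by (cases l) auto
  then interpret D: level_data X \<alpha> \<Lambda> l \<mu> by unfold_locales
  have "real s = real (D.e r)"
    using l R.tnum_pos[OF assms(4)] R.real_tnat[OF assms(4)] by (simp add: D.e_def)
  then interpret S: scaling_limit X \<alpha> \<Lambda> l \<mu> r s
    using assms(4) by unfold_locales simp_all
  have "charge \<alpha> (all_indices X) (W_pow r s L) (m_zero X \<alpha> \<Lambda> r s L)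
        = - (real L ^ 2 * real s * cartan_inv \<alpha> \<Lambda> r r / 2)"
    "charge \<alpha> (all_indices X) (W_pow r s L) (m_zero X \<alpha> \<Lambda> r s L) \<in> \<int>"
    if "L \<in> integral_powers X \<alpha> \<Lambda> r" for L
    unfolding S.m_zero_eq[OF that]
    by (simp add: S.charge_ground[OF that] S.bil_ground[OF that]) (rule S.charge_ground_Ints)
  then show ?thesis
    unfolding Let_def l_def[symmetric]
    using S.tendsto_limit_series D.has_sum_limit_series by blast
qed

end
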